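(* Let $n>1$, $I=[1,n]$, $\mathrm{Br}^+_{n+1}=\mathrm{Br}^+(A_n)$ and $\sigma(i)=n+1-i$ for $i\in I$. Let $K\subsetneq I$ be an interval with $|K|>1$ and let $I'(K)\sqcup I''(K)$ be the unique partition of $I\setminus K$ into self-orthogonal subsets such that $I'(K)$ and $K$ are orthogonal. Then the assignments $$\widehat T_1\mapsto T_{w_\circ^{I'(K)\cup K}},\qquad\widehat T_2\mapsto T_{w_\circ^{I''(K)}}$$ define an optimal (disjoint standard) homomorphism $\mathrm{Br}^+(I_2(2m(K)))\to\mathrm{Br}^+_{n+1}$, where $$m(K)=\begin{cases}\tfrac12(n-|K|)+1,&\sigma(K)=K,\\ n-|K|+2,&\text{otherwise}.\end{cases}$$ Conversely, suppose that $N\in\mathbb Z_{\ge2}$ and $\Phi:\mathrm{Br}^+(I_2(N))\to\mathrm{Br}^+_{n+1}$ is an optimal fully supported disjoint standard homomorphism such that $[\Phi](i)\neq\emptyset$, $i\in\{1,2\}$. Then: (a) either both $[\Phi](1)$ and $[\Phi](2)$ are self-orthogonal, or exactly one of them contains a unique connected component of cardinality $>1$ (and the other contains none); (b) if $[\Phi](1)$ and $[\Phi](2)$ are self-orthogonal, then $n=N-1$ and, up to interchanging $\widehat T_1$ and $\widehat T_2$, $\Phi$ is given by $\widehat T_1\mapsto\prod_{j\in[1,n],\,j\text{ even}}T_j$, $\widehat T_2\mapsto\prod_{j\in[1,n],\,j\text{ odd}}T_j$; (c) if precisely one of the $[\Phi](i)$, $i\in\{1,2\}$, contains a unique connected component $K$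 with $|K|>1$, then $N=2m(K)$.
   Context: $[a,b]=\{i\in\mathbb Z:a\le i\le b\}$. For a Coxeter matrix $M=(m_{ij})_{i,j\in I}$ (symmetric, $m_{ii}=1$, $m_{ij}\in\mathbb Z_{\ge2}\cup\{\infty\}$ for $i\ne j$), the Artin monoid $\mathrm{Br}^+(M)$ is generated by $T_i$, $i\in I$, subject to $T_iT_jT_i\cdots=T_jT_iT_j\cdots$ ($m_{ij}$ factors) for $i\neq j$, $m_{ij}<\infty$. $A_n$: $I=[1,n]$, $m_{ij}=3$ if $|i-j|=1$, $m_{ij}=2$ if $|i-j|>1$. $I_2(N)$: index set $\{1,2\}$, $m_{12}=N$; generators of $\mathrm{Br}^+(I_2(N))$ are denoted $\widehat T_1,\widehat T_2$. For $w$ in the Coxeter group, $T_w$ is the product of the $T_i$ along any reduced expression; $w_\circ^J$ is the longest element of the parabolic subgroup generated by $s_j$, $j\in J$. In type $A_n$: $J,K\subset I$ are orthogonal if $m_{jk}=2$ for all $j\in J$, $k\in K$ (i.e. $|j-k|>1$); $J$ is self-orthogonal if $m_{ij}\le2$ for all $i,j\in J$; connected components of $J\subset I$ are its maximal subintervals. For a homomorphism $\Phi:\mathrm{Br}^+(\widehat M)\to\mathrm{Br}^+(M)$, $[\Phi](i)\subset I$ is the set of indices of generators occurring in $\Phi(\widehat T_i)$. $\Phi$ is: standard if $\Phi(\widehat T_i)=T_{w_\circ^{[\Phi](i)}}$ for all $i$; disjoint if $[\Phi](i)\cap[\Phi](j)=\emptyset$ for $i\neq j$; fully supported if $\bigcup_i[\Phi](i)=I$;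 optimal if for all $i\ne j$ with $\Phi(\widehat T_i)\neq\Phi(\widehat T_j)$ such that the set $B$ of $k\in\mathbb Z_{>0}$ for which the alternating products of length $k$, $\Phi(\widehat T_i)\Phi(\widehat T_j)\Phi(\widehat T_i)\cdots$ and $\Phi(\widehat T_j)\Phi(\widehat T_i)\Phi(\widehat T_j)\cdots$, coincide is non-empty, one has $\widehat m_{ij}=\min B$. *)

theory Defs
  imports "HOL-Algebra.Generated_Groups" "HOL-Library.Extended_Nat"
begin

section \<open>Monoids given by generators and relations\<close>

inductive_set pres_cong :: "'a set \<Rightarrow> ('a list \<times> 'a list) set \<Rightarrow> ('a list \<times> 'a list) set"
  for I :: "'a set" and R :: "('a list \<times> 'a list) set" where
  rel: "\<lbrakk>(u, v) \<in> R; u \<in> lists I; v \<in> lists I; x \<in> lists I; y \<in> lists I\<rbrakk>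
          \<Longrightarrow> (x @ u @ y, x @ v @ y) \<in> pres_cong I R"
| refl: "x \<in> lists I \<Longrightarrow> (x, x) \<in> pres_cong I R"
| sym: "(x, y) \<in> pres_cong I R \<Longrightarrow> (y, x) \<in> pres_cong I R"
| trans: "\<lbrakk>(x, y) \<in> pres_cong I R; (y, z) \<in> pres_cong I R\<rbrakk> \<Longrightarrow> (x, z) \<in> pres_cong I R"

text \<open>The elements of the presented monoid are the congruence classes of words, so
  \<open>u \<in> w\<close> says that the word \<open>u\<close> is an expression for the element \<open>w\<close>.\<close>

definition pres_monoid :: "'a set \<Rightarrow> ('a list \<times> 'a list) set \<Rightarrow> 'a list set monoid" where
  "pres_monoid I R =
    \<lparr>carrier = lists I // pres_cong I R,
     mult = (\<lambda>X Y. \<Union>x\<in>X. \<Union>y\<in>Y. pres_cong I R `` {x @ y}),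
     one = pres_cong I R `` {[]}\<rparr>"

definition pres_gen :: "'a set \<Rightarrow> ('a list \<times> 'a list) set \<Rightarrow> 'a \<Rightarrow> 'a list set" where
  "pres_gen I R i = pres_cong I R `` {[i]}"

definition prod_in :: "('m, 'b) monoid_scheme \<Rightarrow> 'm list \<Rightarrow> 'm" where
  "prod_in G xs = foldr (\<lambda>x y. x \<otimes>\<^bsub>G\<^esub> y) xs \<one>\<^bsub>G\<^esub>"

text \<open>The alternating word \<open>i j i \<dots>\<close> with \<open>k\<close> letters.\<close>

fun alternating :: "nat \<Rightarrow> 'a \<Rightarrow> 'a \<Rightarrow> 'a list" where
  "alternating 0 i j = []"
| "alternating (Suc k) i j = i # alternating k j i"


section \<open>Coxeter matrices, Artin monoids and Coxeter groups\<close>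

record 'i coxeter_matrix =
  index :: "'i set"
  coeff :: "'i \<Rightarrow> 'i \<Rightarrow> enat"

definition is_coxeter_matrix :: "'i coxeter_matrix \<Rightarrow> bool" where
  "is_coxeter_matrix M \<longleftrightarrow>
    (\<forall>i\<in>index M. coeff M i i = 1) \<and>
    (\<forall>i\<in>index M. \<forall>j\<in>index M. coeff M i j = coeff M j i \<and> (i \<noteq> j \<longrightarrow> coeff M i j \<ge> 2))"

definition braid_rels :: "'i coxeter_matrix \<Rightarrow> ('i list \<times> 'i list) set" where
  "braid_rels M = {(alternating m i j, alternating m j i) | m i j.
      i \<in> index M \<and> j \<in> index M \<and> i \<noteq> j \<and> coeff M i j = enat m}"

definition artin_monoid :: "'i coxeter_matrix \<Rightarrow> 'i list set monoid" where
  "artin_monoid M = pres_monoid (index M) (braid_rels M)"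

definition artin_gen :: "'i coxeter_matrix \<Rightarrow> 'i \<Rightarrow> 'i list set" where
  "artin_gen M i = pres_gen (index M) (braid_rels M) i"

text \<open>The relations \<open>(s\<^sub>i s\<^sub>j)\<^bsup>m\<^esup> = 1\<close> with \<open>m = m\<^sub>i\<^sub>j < \<infinity>\<close>; the case \<open>i = j\<close>, where \<open>m = 1\<close>,
  gives \<open>s\<^sub>i\<^sup>2 = 1\<close>, so that the monoid with these relations is already the Coxeter group.\<close>

definition coxeter_rels :: "'i coxeter_matrix \<Rightarrow> ('i list \<times> 'i list) set" where
  "coxeter_rels M = {(concat (replicate m [i, j]), []) | m i j.
      i \<in> index M \<and> j \<in> index M \<and> coeff M i j = enat m}"

definition coxeter_group :: "'i coxeter_matrix \<Rightarrow> 'i list set monoid" where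
  "coxeter_group M = pres_monoid (index M) (coxeter_rels M)"

definition coxeter_gen :: "'i coxeter_matrix \<Rightarrow> 'i \<Rightarrow> 'i list set" where
  "coxeter_gen M i = pres_gen (index M) (coxeter_rels M) i"

definition cox_length :: "'i list set \<Rightarrow> nat" where
  "cox_length w = (LEAST k. \<exists>u\<in>w. length u = k)"

definition reduced_expr :: "'i list \<Rightarrow> 'i list set \<Rightarrow> bool" where
  "reduced_expr u w \<longleftrightarrow> u \<in> w \<and> length u = cox_length w"

text \<open>By Matsumoto's theorem the product does not depend on the chosen reduced expression.\<close>

definition artin_T :: "'i coxeter_matrix \<Rightarrow> 'i list set \<Rightarrow> 'i list set" where
  "artin_T M w = prod_in (artin_monoid M) (map (artin_gen M) (SOME u. reduced_expr u w))"

definition parabolic :: "'i coxeter_matrix \<Rightarrow> 'i set \<Rightarrow> 'i list set set" where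
  "parabolic M J = generate (coxeter_group M) (coxeter_gen M ` J)"

text \<open>Meaningful when the parabolic subgroup is finite (always so in type \<open>A\<^sub>n\<close>); the
  longest element is then unique.\<close>

definition longest_elt :: "'i coxeter_matrix \<Rightarrow> 'i set \<Rightarrow> 'i list set" where
  "longest_elt M J = arg_max_on cox_length (parabolic M J)"


section \<open>Homomorphisms of Artin monoids\<close>

text \<open>\<^const>\<open>hom\<close> does not demand that the unit be preserved.\<close>

definition artin_homs ::
  "'j coxeter_matrix \<Rightarrow> 'i coxeter_matrix \<Rightarrow> ('j list set \<Rightarrow> 'i list set) set" where
  "artin_homs M' M = {\<Phi> \<in> hom (artin_monoid M') (artin_monoid M).
      \<Phi> \<one>\<^bsub>artin_monoid M'\<^esub> = \<one>\<^bsub>artin_monoid M\<^esub>}"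

text \<open>Indices of the generators occurring in \<open>\<Phi>(T\<^sub>i)\<close>; both sides of a braid relation contain
  the same letters, so all expressions of an element do.\<close>

definition supp :: "'j coxeter_matrix \<Rightarrow> ('j list set \<Rightarrow> 'i list set) \<Rightarrow> 'j \<Rightarrow> 'i set" where
  "supp M' \<Phi> i = (\<Union>u \<in> \<Phi> (artin_gen M' i). set u)"

definition standard ::
  "'j coxeter_matrix \<Rightarrow> 'i coxeter_matrix \<Rightarrow> ('j list set \<Rightarrow> 'i list set) \<Rightarrow> bool" where
  "standard M' M \<Phi> \<longleftrightarrow>
    (\<forall>i\<in>index M'. \<Phi> (artin_gen M' i) = artin_T M (longest_elt M (supp M' \<Phi> i)))"

definition disjoint_hom :: "'j coxeter_matrix \<Rightarrow> ('j list set \<Rightarrow> 'i list set) \<Rightarrow> bool" where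
  "disjoint_hom M' \<Phi> \<longleftrightarrow>
    (\<forall>i\<in>index M'. \<forall>j\<in>index M'. i \<noteq> j \<longrightarrow> supp M' \<Phi> i \<inter> supp M' \<Phi> j = {})"

definition fully_supported ::
  "'j coxeter_matrix \<Rightarrow> 'i coxeter_matrix \<Rightarrow> ('j list set \<Rightarrow> 'i list set) \<Rightarrow> bool" where
  "fully_supported M' M \<Phi> \<longleftrightarrow> (\<Union>i\<in>index M'. supp M' \<Phi> i) = index M"

definition braid_lengths :: "('m, 'b) monoid_scheme \<Rightarrow> 'm \<Rightarrow> 'm \<Rightarrow> nat set" where
  "braid_lengths G x y =
    {k. k > 0 \<and> prod_in G (alternating k x y) = prod_in G (alternating k y x)}"

definition optimal ::
  "'j coxeter_matrix \<Rightarrow> 'i coxeter_matrix \<Rightarrow> ('j list set \<Rightarrow> 'i list set) \<Rightarrow> bool" where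
  "optimal M' M \<Phi> \<longleftrightarrow>
    (\<forall>i\<in>index M'. \<forall>j\<in>index M'.
      let x = \<Phi> (artin_gen M' i); y = \<Phi> (artin_gen M' j); B = braid_lengths (artin_monoid M) x y
      in i \<noteq> j \<and> x \<noteq> y \<and> B \<noteq> {} \<longrightarrow> coeff M' i j = enat (LEAST k. k \<in> B))"


section \<open>Types \<open>A\<^sub>n\<close> and \<open>I\<^sub>2(N)\<close>\<close>

definition type_A :: "nat \<Rightarrow> nat coxeter_matrix" where
  "type_A n = \<lparr>index = {1..n},
     coeff = (\<lambda>i j. if i = j then 1 else if \<bar>int i - int j\<bar> = 1 then 3 else 2)\<rparr>"

definition type_I2 :: "nat \<Rightarrow> nat coxeter_matrix" where
  "type_I2 N = \<lparr>index = {1, 2}, coeff = (\<lambda>i j. if i = j then 1 else enat N)\<rparr>"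

lemma is_coxeter_matrix_type_A: "is_coxeter_matrix (type_A n)"
  by (auto simp: is_coxeter_matrix_def type_A_def)

lemma is_coxeter_matrix_type_I2: "N \<ge> 2 \<Longrightarrow> is_coxeter_matrix (type_I2 N)"
  by (auto simp: is_coxeter_matrix_def type_I2_def numeral_eq_enat)

definition orthogonal :: "'i coxeter_matrix \<Rightarrow> 'i set \<Rightarrow> 'i set \<Rightarrow> bool" where
  "orthogonal M J K \<longleftrightarrow> (\<forall>j\<in>J. \<forall>k\<in>K. coeff M j k = 2)"

definition self_orthogonal :: "'i coxeter_matrix \<Rightarrow> 'i set \<Rightarrow> bool" where
  "self_orthogonal M J \<longleftrightarrow> (\<forall>i\<in>J. \<forall>j\<in>J. coeff M i j \<le> 2)"

definition is_interval_nat :: "nat set \<Rightarrow> bool" where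
  "is_interval_nat C \<longleftrightarrow> (\<exists>a b. a \<le> b \<and> C = {a..b})"

definition conn_components :: "nat set \<Rightarrow> nat set set" where
  "conn_components J = {C. is_interval_nat C \<and> C \<subseteq> J \<and>
      (\<forall>D. is_interval_nat D \<and> C \<subseteq> D \<and> D \<subseteq> J \<longrightarrow> D = C)}"

definition big_components :: "nat set \<Rightarrow> nat set set" where
  "big_components J = {C \<in> conn_components J. card C > 1}"

text \<open>The sets \<open>I'\<close> and \<open>I''\<close> partition \<open>[1,n] - K\<close>; \<open>I'\<close> may be empty.\<close>

definition orth_partition :: "nat \<Rightarrow> nat set \<Rightarrow> nat set \<Rightarrow> nat set \<Rightarrow> bool" where
  "orth_partition n K I' I'' \<longleftrightarrow>
    I' \<union> I'' = {1..n} - K \<and> I' \<inter> I'' = {} \<and>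
    self_orthogonal (type_A n) I' \<and> self_orthogonal (type_A n) I'' \<and>
    orthogonal (type_A n) I' K"

definition flip :: "nat \<Rightarrow> nat \<Rightarrow> nat" where
  "flip n i = n + 1 - i"

text \<open>For an interval \<open>K \<subseteq> [1,n]\<close> with \<open>\<sigma>(K) = K\<close> the number \<open>n - |K|\<close> is even, so the
  division is exact.\<close>

definition m_of :: "nat \<Rightarrow> nat set \<Rightarrow> nat" where
  "m_of n K = (if flip n ` K = K then (n - card K) div 2 + 1 else n - card K + 2)"

end

theory Submission
  imports Defs
begin

text \<open>Identify \<open>Br\<^sup>+(A\<^sub>n)\<close> with the positive braids on the positions \<open>1, \<dots>, n + 1\<close>. Let
  \<open>J \<squnion> L = [1, n]\<close> be the supports and let \<open>K\<^sub>1, \<dots>, K\<^sub>s\<close> be their components from left to right;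
  they alternate between \<open>J\<close> and \<open>L\<close>, and \<open>K\<^sub>r\<close> reverses the positions it touches. The \<open>s + 1\<close>
  common end points of these blocks (the nodes) are permuted as in type \<open>A\<^sub>s\<close>, while a strand strictly
  inside a block never leaves it. If two alternating products of \<open>k\<close> factors agree, then
  every generator divides the common value on the left, and by Garside's theorem any two strands
  cross in it. This rules out two blocks with interior strands, and tracing the first node leaves only
  \<open>k = s + 1\<close> below \<open>k = 2 (s + 1)\<close>. If \<open>K\<close> is not centred, then some node never
  crosses the interior of \<open>K\<close> during one of the two products of \<open>s + 1\<close> factors, so \<open>k \<noteq> s + 1\<close>.

  Conversely, split off the longest element \<open>\<Delta>\<close> of the interior of \<open>K\<close>, which commutes with everything
  in sight. If \<open>K\<close> is centred or a single letter, then both remaining products of \<open>s + 1\<close> factors times \<open>\<Delta>\<close>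
  reverse all strands with the minimal number of crossings, hence agree by Matsumoto's theorem.
  Otherwise one shows that the \<open>(s + 1)\<close>-st power of a linear Coxeter product is
  central and conjugates it to the bipartite one.\<close>

section \<open>Garside's theorem for positive braids\<close>

text \<open>The constants come from one count. For \<open>K = [a, b]\<close> there are
  \<open>s = n - (b - a)\<close> runs, so \<open>s + 1 = n - |K| + 2\<close>; this is
  \<open>2 m(K)\<close> if \<open>K\<close> is centred and \<open>m(K)\<close> otherwise. The walk
  of a node has period \<open>2 (s + 1)\<close>, and half a period reflects the nodes among
  themselves, which is a reversal of positions only if \<open>K\<close> is centred or a single
  letter.

  The obstacle is the doubled length. There strands cross more than once, the words are not reduced,
  and equal permutations no longer give equal braids. Hence the detour through the linear Coxeter
  product, which can be treated by shifting letters: \<open>T_1 ... T_n\<close> shifts them by one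
  modulo \<open>n + 1\<close>, so its power \<open>s + 1\<close> shifts by \<open>-(b - a)\<close>,
  and the factors collected from the thick run shift back by \<open>b - a\<close>. Cancellation, a
  consequence of Garside's theorem, turns the conjugations involved into equalities.

  Letters range over all natural numbers, so that \<open>n\<close> enters only through the
  supports.\<close>

definition far :: "nat \<Rightarrow> nat \<Rightarrow> bool" where
  "far i j \<longleftrightarrow> i + 1 < j \<or> j + 1 < i"

definition adj :: "nat \<Rightarrow> nat \<Rightarrow> bool" where
  "adj i j \<longleftrightarrow> j = i + 1 \<or> i = j + 1"

lemma far_sym: "far i j \<Longrightarrow> far j i"
  by (auto simp: far_def)

lemma adj_sym: "adj i j \<Longrightarrow> adj j i"
  by (auto simp: adj_def)

lemma far_adj_cases: "i = j \<or> far i j \<or> adj i j"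
  by (auto simp: far_def adj_def)

lemma adj_adj_far: "adj i m \<Longrightarrow> adj m j \<Longrightarrow> i \<noteq> j \<Longrightarrow> far i j"
  by (auto simp: far_def adj_def)

lemma adj_not_far: "adj i j \<Longrightarrow> \<not> far i j"
  by (auto simp: far_def adj_def)

lemma far_irrefl: "\<not> far i i"
  by (auto simp: far_def)

lemma adj_irrefl: "\<not> adj i i"
  by (auto simp: adj_def)

section \<open>Positive braid words up to braid moves\<close>

inductive braid_step :: "nat list \<Rightarrow> nat list \<Rightarrow> bool" where
  far: "far i j \<Longrightarrow> braid_step (x @ [i, j] @ y) (x @ [j, i] @ y)"
| adj: "adj i j \<Longrightarrow> braid_step (x @ [i, j, i] @ y) (x @ [j, i, j] @ y)"

abbreviation braid_eq :: "nat list \<Rightarrow> nat list \<Rightarrow> bool"  (infix "\<approx>" 50) where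
  "u \<approx> v \<equiv> braid_step\<^sup>*\<^sup>* u v"

lemma braid_step_sym: "braid_step u v \<Longrightarrow> braid_step v u"
  by (induction rule: braid_step.induct) (auto intro: braid_step.intros far_sym adj_sym simp del: append_Cons append_Nil)

lemma braid_eq_sym: "u \<approx> v \<Longrightarrow> v \<approx> u"
  by (induction rule: rtranclp_induct) (auto intro: braid_step_sym converse_rtranclp_into_rtranclp)

lemma braid_eq_trans [trans]: "u \<approx> v \<Longrightarrow> v \<approx> w \<Longrightarrow> u \<approx> w"
  by (rule rtranclp_trans)

lemma braid_step_context: "braid_step u v \<Longrightarrow> braid_step (x @ u @ y) (x @ v @ y)"
proof (induction rule: braid_step.induct)
  case (far i j x' y')
  then show ?case using braid_step.far[of i j "x @ x'" "y' @ y"] by simp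
next
  case (adj i j x' y')
  then show ?case using braid_step.adj[of i j "x @ x'" "y' @ y"] by simp
qed

lemma braid_eq_context: "u \<approx> v \<Longrightarrow> x @ u @ y \<approx> x @ v @ y"
  by (induction rule: rtranclp_induct) (auto intro: braid_step_context rtranclp.rtrancl_into_rtrancl)

lemma braid_eq_append: "u \<approx> u' \<Longrightarrow> v \<approx> v' \<Longrightarrow> u @ v \<approx> u' @ v'"
  using braid_eq_context[of u u' "[]" v] braid_eq_context[of v v' u' "[]"] by auto

lemma braid_eq_Cons: "u \<approx> v \<Longrightarrow> i # u \<approx> i # v"
  using braid_eq_context[of u v "[i]" "[]"] by simp

lemma braid_eq_far: "far i j \<Longrightarrow> i # j # y \<approx> j # i # y"
  using braid_step.far[of i j "[]" y] by auto

lemma braid_eq_adj: "adj i j \<Longrightarrow> i # j # i # y \<approx> j # i # j # y"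
  using braid_step.adj[of i j "[]" y] by auto

lemma braid_step_invariants: "braid_step u v \<Longrightarrow> length u = length v \<and> set u = set v"
  by (induction rule: braid_step.induct) auto

lemma braid_eq_length: "u \<approx> v \<Longrightarrow> length u = length v"
  by (induction rule: rtranclp_induct) (auto dest: braid_step_invariants)

lemma braid_eq_set: "u \<approx> v \<Longrightarrow> set u = set v"
  by (induction rule: rtranclp_induct) (auto dest: braid_step_invariants)

lemma braid_step_rev: "braid_step u v \<Longrightarrow> braid_step (rev u) (rev v)"
proof (induction rule: braid_step.induct)
  case (far i j x y)
  then show ?case using braid_step.far[of j i "rev y" "rev x"] by (auto intro: far_sym)
next
  case (adj i j x y)
  then show ?case using braid_step.adj[of i j "rev y" "rev x"] by auto
qed

lemma braid_eq_rev: "u \<approx> v \<Longrightarrow> rev u \<approx> rev v"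
  by (induction rule: rtranclp_induct) (auto intro: braid_step_rev rtranclp.rtrancl_into_rtrancl)

text \<open>The conclusion of Garside's theorem for \<open>i # u\<close> and \<open>j # v\<close>:
  their common value is a multiple of the least common multiple of the two letters, namely
  \<open>i\<close>, \<open>i j\<close> or \<open>i j i\<close>, and \<open>z\<close> is the
  remaining factor. For \<open>i = j\<close> this is cancellation.\<close>

definition left_lcm :: "nat \<Rightarrow> nat list \<Rightarrow> nat \<Rightarrow> nat list \<Rightarrow> bool" where
  "left_lcm i u j v \<longleftrightarrow> (i = j \<longrightarrow> u \<approx> v) \<and>
    (far i j \<longrightarrow> (\<exists>z. u \<approx> j # z \<and> v \<approx> i # z)) \<and>
    (adj i j \<longrightarrow> (\<exists>z. u \<approx> j # i # z \<and> v \<approx> i # j # z))"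

lemma left_lcm_sym: "left_lcm i u j v \<Longrightarrow> left_lcm j v i u"
  unfolding left_lcm_def by (meson adj_sym far_sym braid_eq_sym)

lemma left_lcm_cong: "left_lcm i u j v \<Longrightarrow> u \<approx> u' \<Longrightarrow> v \<approx> v' \<Longrightarrow> left_lcm i u' j v'"
  unfolding left_lcm_def by (meson braid_eq_sym braid_eq_trans)

text \<open>The assumption \<open>H\<close> is Garside's theorem for words shorter than \<open>i # u\<close>, and \<open>m\<close> is the first
  letter of an intermediate word in a chain of braid moves from \<open>i # u\<close> to \<open>j # v\<close>.\<close>

context
  fixes L :: nat
  assumes H: "\<And>i u j v. i # u \<approx> j # v \<Longrightarrow> length u < L \<Longrightarrow> left_lcm i u j v"
begin

lemma short_cancel: "i # u \<approx> i # v \<Longrightarrow> length u < L \<Longrightarrow> u \<approx> v"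
  using H[of i u i v] by (simp add: left_lcm_def)

lemma short_far: "i # u \<approx> j # v \<Longrightarrow> far i j \<Longrightarrow> length u < L \<Longrightarrow> \<exists>z. u \<approx> j # z \<and> v \<approx> i # z"
  using H[of i u j v] by (simp add: left_lcm_def)

lemma short_adj: "i # u \<approx> j # v \<Longrightarrow> adj i j \<Longrightarrow> length u < L \<Longrightarrow> \<exists>z. u \<approx> j # i # z \<and> v \<approx> i # j # z"
  using H[of i u j v] by (simp add: left_lcm_def)

text \<open>The tail \<open>w\<close> of the intermediate word \<open>m # w\<close> has two
  factorizations, beginning with \<open>i\<close> and with \<open>j\<close>. Comparing them involves
  words of length at most \<open>L\<close> only, whose tails are short enough for
  \<open>H\<close>.\<close>

lemma left_lcm_trans_far_adj:
  assumes w1: "w \<approx> i # z1" and u: "u \<approx> m # z1" and w2: "w \<approx> j # m # z2" and v: "v \<approx> m # j # z2"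
    and im: "far i m" and mj: "adj m j" and L: "length w = L"
  shows "left_lcm i u j v"
proof -
  have ne: "i \<noteq> j" using im mj adj_not_far[of m j] far_sym by blast
  have e: "i # z1 \<approx> j # m # z2" by (rule braid_eq_trans[OF braid_eq_sym[OF w1] w2])
  have l1: "Suc (length z1) = L" using braid_eq_length[OF w1] L by simp
  have l2: "Suc (Suc (length z2)) = L" using braid_eq_length[OF w2] L by simp
  consider "far i j" | "adj i j" using ne far_adj_cases by blast
  then show ?thesis
  proof cases
    case 1
    obtain y where y: "z1 \<approx> j # y" "m # z2 \<approx> i # y"
      using short_far[OF e 1] l1 by auto
    obtain y' where y': "z2 \<approx> i # y'" "y \<approx> m # y'"
      using short_far[OF y(2) far_sym[OF im]] l2 by auto
    have "u \<approx> m # z1" by (rule u)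
    also have "\<dots> \<approx> m # j # y" using y(1) by (rule braid_eq_Cons)
    also have "\<dots> \<approx> m # j # m # y'" using y'(2) by (intro braid_eq_Cons)
    also have "\<dots> \<approx> j # m # j # y'" using mj by (rule braid_eq_adj)
    finally have U: "u \<approx> j # m # j # y'" .
    have "v \<approx> m # j # z2" by (rule v)
    also have "\<dots> \<approx> m # j # i # y'" using y'(1) by (intro braid_eq_Cons)
    also have "\<dots> \<approx> m # i # j # y'" by (intro braid_eq_Cons braid_eq_far far_sym[OF 1])
    also have "\<dots> \<approx> i # m # j # y'" by (intro braid_eq_far far_sym[OF im])
    finally have V: "v \<approx> i # m # j # y'" .
    show ?thesis using U V 1 adj_not_far[of i j] ne by (auto simp: left_lcm_def)
  next
    \<comment> \<open>Now \<open>i\<close>, \<open>j\<close>, \<open>m\<close> is a path, and the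
      longest element on four strands splits off: \<open>i # u\<close> becomes
      \<open>i j i m j i x\<close>.\<close>
    case 2
    obtain y where y: "z1 \<approx> j # i # y" "m # z2 \<approx> i # j # y"
      using short_adj[OF e 2] l1 by auto
    obtain y' where y': "z2 \<approx> i # y'" "j # y \<approx> m # y'"
      using short_far[OF y(2) far_sym[OF im]] l2 by auto
    have ly: "length y < L" using braid_eq_length[OF y(1)] l1 by simp
    obtain x where x: "y \<approx> m # j # x" "y' \<approx> j # m # x"
      using short_adj[OF y'(2) adj_sym[OF mj] ly] by auto
    have "u \<approx> m # z1" by (rule u)
    also have "\<dots> \<approx> m # j # i # y" using y(1) by (rule braid_eq_Cons)
    also have "\<dots> \<approx> m # j # i # m # j # x" using x(1) by (intro braid_eq_Cons)
    also have "\<dots> \<approx> m # j # m # i # j # x" by (intro braid_eq_Cons braid_eq_far im)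
    also have "\<dots> \<approx> j # m # j # i # j # x" by (intro braid_eq_adj mj)
    also have "\<dots> \<approx> j # m # i # j # i # x" by (intro braid_eq_Cons braid_eq_adj adj_sym[OF 2])
    also have "\<dots> \<approx> j # i # m # j # i # x" by (intro braid_eq_Cons braid_eq_far far_sym[OF im])
    finally have U: "u \<approx> j # i # m # j # i # x" .
    have "v \<approx> m # j # z2" by (rule v)
    also have "\<dots> \<approx> m # j # i # y'" using y'(1) by (intro braid_eq_Cons)
    also have "\<dots> \<approx> m # j # i # j # m # x" using x(2) by (intro braid_eq_Cons)
    also have "\<dots> \<approx> m # i # j # i # m # x" by (intro braid_eq_Cons braid_eq_adj adj_sym[OF 2])
    also have "\<dots> \<approx> i # m # j # i # m # x" by (intro braid_eq_far far_sym[OF im])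
    also have "\<dots> \<approx> i # m # j # m # i # x" by (intro braid_eq_Cons braid_eq_far im)
    also have "\<dots> \<approx> i # j # m # j # i # x" by (intro braid_eq_Cons braid_eq_adj mj)
    finally have V: "v \<approx> i # j # m # j # i # x" .
    show ?thesis using U V 2 adj_not_far[of i j] ne by (auto simp: left_lcm_def)
  qed
qed

lemma left_lcm_trans_far_far:
  assumes w1: "w \<approx> i # z1" and u: "u \<approx> m # z1" and w2: "w \<approx> j # z2" and v: "v \<approx> m # z2"
    and im: "far i m" and mj: "far m j" and L: "length w = L"
  shows "left_lcm i u j v"
proof -
  have e: "i # z1 \<approx> j # z2" by (rule braid_eq_trans[OF braid_eq_sym[OF w1] w2])
  have l1: "Suc (length z1) = L" using braid_eq_length[OF w1] L by simp
  consider "i = j" | "far i j" | "adj i j" using far_adj_cases by blast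
  then show ?thesis
  proof cases
    case 1
    have "z1 \<approx> z2" using short_cancel[of i z1 z2] e 1 l1 by simp
    then have "m # z1 \<approx> m # z2" by (rule braid_eq_Cons)
    then have "u \<approx> v" using u v braid_eq_sym braid_eq_trans by blast
    then show ?thesis using 1 far_irrefl adj_irrefl by (auto simp: left_lcm_def)
  next
    case 2
    obtain y where y: "z1 \<approx> j # y" "z2 \<approx> i # y"
      using short_far[OF e 2] l1 by auto
    have "u \<approx> m # j # y" by (rule braid_eq_trans[OF u braid_eq_Cons[OF y(1)]])
    also have "\<dots> \<approx> j # m # y" using mj by (rule braid_eq_far)
    finally have U: "u \<approx> j # m # y" .
    have "v \<approx> m # i # y" by (rule braid_eq_trans[OF v braid_eq_Cons[OF y(2)]])
    also have "\<dots> \<approx> i # m # y" by (rule braid_eq_far[OF far_sym[OF im]])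
    finally have V: "v \<approx> i # m # y" .
    show ?thesis using U V 2 adj_not_far[of i j] far_irrefl by (auto simp: left_lcm_def)
  next
    case 3
    obtain y where y: "z1 \<approx> j # i # y" "z2 \<approx> i # j # y"
      using short_adj[OF e 3] l1 by auto
    have "u \<approx> m # j # i # y" by (rule braid_eq_trans[OF u braid_eq_Cons[OF y(1)]])
    also have "\<dots> \<approx> j # m # i # y" using mj by (rule braid_eq_far)
    also have "\<dots> \<approx> j # i # m # y" by (intro braid_eq_Cons braid_eq_far far_sym[OF im])
    finally have U: "u \<approx> j # i # m # y" .
    have "v \<approx> m # i # j # y" by (rule braid_eq_trans[OF v braid_eq_Cons[OF y(2)]])
    also have "\<dots> \<approx> i # m # j # y" by (rule braid_eq_far[OF far_sym[OF im]])
    also have "\<dots> \<approx> i # j # m # y" by (intro braid_eq_Cons braid_eq_far mj)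
    finally have V: "v \<approx> i # j # m # y" .
    show ?thesis using U V 3 adj_not_far[of i j] adj_irrefl by (auto simp: left_lcm_def)
  qed
qed

lemma left_lcm_trans_adj_adj:
  assumes w1: "w \<approx> i # m # z1" and u: "u \<approx> m # i # z1" and w2: "w \<approx> j # m # z2" and v: "v \<approx> m # j # z2"
    and im: "adj i m" and mj: "adj m j" and L: "length w = L"
  shows "left_lcm i u j v"
proof -
  have e: "i # m # z1 \<approx> j # m # z2" by (rule braid_eq_trans[OF braid_eq_sym[OF w1] w2])
  have l1: "Suc (Suc (length z1)) = L" using braid_eq_length[OF w1] L by simp
  have l2: "Suc (Suc (length z2)) = L" using braid_eq_length[OF w2] L by simp
  show ?thesis
  proof (cases "i = j")
    case True
    have "m # z1 \<approx> m # z2" using short_cancel[of i] e True l1 by simp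
    then have "z1 \<approx> z2" using short_cancel[of m z1 z2] l1 by simp
    then have "m # i # z1 \<approx> m # i # z2" by (intro braid_eq_Cons)
    then have "u \<approx> v" using u v True braid_eq_sym braid_eq_trans by blast
    then show ?thesis using True far_irrefl adj_irrefl by (auto simp: left_lcm_def)
  next
    \<comment> \<open>Here \<open>m\<close> is the middle of the path \<open>i\<close>,
      \<open>m\<close>, \<open>j\<close>, and again the longest element on four strands splits
      off.\<close>
    case False
    have ij: "far i j" using adj_adj_far im mj False by blast
    obtain y where y: "m # z1 \<approx> j # y" "m # z2 \<approx> i # y"
      using short_far[OF e ij] l1 by auto
    obtain y1 where y1: "z1 \<approx> j # m # y1" "y \<approx> m # j # y1"
      using short_adj[OF y(1) mj] l1 by auto
    obtain y2 where y2: "z2 \<approx> i # m # y2" "y \<approx> m # i # y2"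
      using short_adj[OF y(2) adj_sym[OF im]] l2 by auto
    have "m # j # y1 \<approx> m # i # y2" using y1 y2 braid_eq_sym braid_eq_trans by blast
    then have "j # y1 \<approx> i # y2"
      using short_cancel[of m "j # y1" "i # y2"] braid_eq_length[OF y1(1)] l1 by simp
    then obtain x where x: "y1 \<approx> i # x" "y2 \<approx> j # x"
      using short_far[of j y1 i y2] far_sym[OF ij] braid_eq_length[OF y1(1)] l1 by auto
    have "u \<approx> m # i # z1" by (rule u)
    also have "\<dots> \<approx> m # i # j # m # y1" using y1(1) by (intro braid_eq_Cons)
    also have "\<dots> \<approx> m # i # j # m # i # x" using x(1) by (intro braid_eq_Cons)
    also have "\<dots> \<approx> m # j # i # m # i # x" by (intro braid_eq_Cons braid_eq_far ij)
    also have "\<dots> \<approx> m # j # m # i # m # x" by (intro braid_eq_Cons braid_eq_adj im)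
    also have "\<dots> \<approx> j # m # j # i # m # x" by (intro braid_eq_adj mj)
    finally have U: "u \<approx> j # m # j # i # m # x" .
    have "v \<approx> m # j # z2" by (rule v)
    also have "\<dots> \<approx> m # j # i # m # y2" using y2(1) by (intro braid_eq_Cons)
    also have "\<dots> \<approx> m # j # i # m # j # x" using x(2) by (intro braid_eq_Cons)
    also have "\<dots> \<approx> m # i # j # m # j # x" by (intro braid_eq_Cons braid_eq_far far_sym[OF ij])
    also have "\<dots> \<approx> m # i # m # j # m # x" by (intro braid_eq_Cons braid_eq_adj adj_sym[OF mj])
    also have "\<dots> \<approx> i # m # i # j # m # x" by (intro braid_eq_adj adj_sym[OF im])
    also have "\<dots> \<approx> i # m # j # i # m # x" by (intro braid_eq_Cons braid_eq_far ij)
    finally have V: "v \<approx> i # m # j # i # m # x" .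
    show ?thesis using U V ij adj_not_far[of i j] False by (auto simp: left_lcm_def)
  qed
qed

lemma left_lcm_trans:
  assumes 1: "left_lcm i u m w" and 2: "left_lcm m w j v" and L: "length w = L"
  shows "left_lcm i u j v"
proof -
  consider "i = m" | "m = j" | "far i m" "far m j" | "far i m" "adj m j" | "adj i m" "far m j" | "adj i m" "adj m j"
    using far_adj_cases by blast
  then show ?thesis
  proof cases
    case 1
    then have "w \<approx> u" using assms(1) braid_eq_sym by (auto simp: left_lcm_def)
    then show ?thesis using assms(2) left_lcm_cong[of m w j v u v] 1 by blast
  next
    case 2
    then have "w \<approx> v" using assms(2) by (auto simp: left_lcm_def)
    then show ?thesis using assms(1) left_lcm_cong[of i u m w u v] 2 by blast
  next
    case 3
    then obtain z1 z2 where "u \<approx> m # z1" "w \<approx> i # z1" "w \<approx> j # z2" "v \<approx> m # z2"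
      using 1 2 unfolding left_lcm_def by blast
    then show ?thesis using left_lcm_trans_far_far 3 L by blast
  next
    case 4
    then obtain z1 z2 where "u \<approx> m # z1" "w \<approx> i # z1" "w \<approx> j # m # z2" "v \<approx> m # j # z2"
      using 1 2 unfolding left_lcm_def by blast
    then show ?thesis using left_lcm_trans_far_adj 4 L by blast
  next
    case 5
    then obtain z1 z2 where "u \<approx> m # i # z1" "w \<approx> i # m # z1" "w \<approx> j # z2" "v \<approx> m # z2"
      using 1 2 unfolding left_lcm_def by blast
    \<comment> \<open>Reading the chain backwards turns this into the previous case.\<close>
    then have "left_lcm j v i u"
      using left_lcm_trans_far_adj[of w j z2 v m i z1 u] 5 L far_sym adj_sym by blast
    then show ?thesis by (rule left_lcm_sym)
  next
    case 6
    then obtain z1 z2 where "u \<approx> m # i # z1" "w \<approx> i # m # z1" "w \<approx> j # m # z2" "v \<approx> m # j # z2"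
      using 1 2 unfolding left_lcm_def by blast
    then show ?thesis using left_lcm_trans_adj_adj 6 L by blast
  qed
qed

end

text \<open>A move at the front is the relation between \<open>i\<close> and \<open>m\<close>
  itself; any other move keeps the first letter and acts on the tail.\<close>

lemma left_lcm_step:
  assumes "braid_step (i # u) (m # w)"
  shows "left_lcm i u m w"
  using assms
proof (cases rule: braid_step.cases)
  case (far i' j' x y)
  show ?thesis
  proof (cases x)
    case Nil
    then show ?thesis using far far_irrefl adj_not_far by (auto simp: left_lcm_def)
  next
    case (Cons a x')
    then have "braid_step u w" "i = m" using far braid_step.far[of i' j' x' y] by auto
    then show ?thesis using far_irrefl adj_irrefl by (auto simp: left_lcm_def)
  qed
next
  case (adj i' j' x y)
  show ?thesis
  proof (cases x)
    case Nil
    then show ?thesis using adj adj_irrefl adj_not_far by (auto simp: left_lcm_def)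
  next
    case (Cons a x')
    then have "braid_step u w" "i = m" using adj braid_step.adj[of i' j' x' y] by auto
    then show ?thesis using far_irrefl adj_irrefl by (auto simp: left_lcm_def)
  qed
qed

lemma garside: "i # u \<approx> j # v \<Longrightarrow> left_lcm i u j v"
proof (induction "length u" arbitrary: i u j v rule: less_induct)
  case less
  have H: "\<And>i' u' j' v'. i' # u' \<approx> j' # v' \<Longrightarrow> length u' < length u \<Longrightarrow> left_lcm i' u' j' v'"
    using less.hyps by blast
  \<comment> \<open>An inner induction along the chain of moves; \<open>hd w\<close> is the first
    letter of the word reached so far.\<close>
  have "left_lcm i u (hd w) (tl w)" if "i # u \<approx> w" for w
    using that
  proof (induction rule: rtranclp_induct)
    case base
    then show ?case using far_irrefl adj_irrefl by (simp add: left_lcm_def)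
  next
    case (step y z)
    have "length y = Suc (length u)" "length z = Suc (length u)"
      using braid_eq_length[OF step(1)] braid_step_invariants[OF step(2)] by auto
    then obtain m y' m' z' where yz: "y = m # y'" "z = m' # z'" by (metis length_Suc_conv)
    have "left_lcm m y' m' z'" using step(2) yz left_lcm_step by simp
    then show ?case
      using left_lcm_trans[of "length u" i u m y' m' z', OF H] step.IH yz \<open>length y = Suc (length u)\<close> by simp
  qed
  from this[OF less.prems] show ?case by simp
qed

lemma braid_eq_left_cancel: "x @ u \<approx> x @ v \<Longrightarrow> u \<approx> v"
  by (induction x) (auto dest!: garside simp: left_lcm_def)

lemma braid_eq_right_cancel: "u @ x \<approx> v @ x \<Longrightarrow> u \<approx> v"
  using braid_eq_left_cancel[of "rev x" "rev u" "rev v"] braid_eq_rev[of "u @ x" "v @ x"]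
    braid_eq_rev[of "rev u" "rev v"] by simp

section \<open>Strands, inversions and Matsumoto's theorem\<close>

definition sw :: "nat \<Rightarrow> nat \<Rightarrow> nat" where
  "sw i x = (if x = i then Suc i else if x = Suc i then i else x)"

text \<open>Letters of a word are read from left to right: \<open>act u x\<close> is the final position of the
  strand that starts at position \<open>x\<close>.\<close>

fun act :: "nat list \<Rightarrow> nat \<Rightarrow> nat" where
  "act [] x = x"
| "act (i # u) x = act u (sw i x)"

text \<open>Unlike an inversion of \<open>act u\<close>, a crossing is not undone when the two
  strands cross back, so this stays informative for words that are not reduced.\<close>

fun cross :: "nat list \<Rightarrow> nat \<Rightarrow> nat \<Rightarrow> bool" where
  "cross [] x y = False"
| "cross (i # u) x y \<longleftrightarrow> {x, y} = {i, Suc i} \<or> cross u (sw i x) (sw i y)"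

lemma sw_sw [simp]: "sw i (sw i x) = x"
  by (auto simp: sw_def)

lemma sw_eq_iff [simp]: "sw i x = sw i y \<longleftrightarrow> x = y"
  by (auto simp: sw_def)

lemma sw_simps [simp]: "sw i i = Suc i" "sw i (Suc i) = i"
  by (auto simp: sw_def)

lemma sw_braid: "adj i j \<Longrightarrow> sw i (sw j (sw i x)) = sw j (sw i (sw j x))"
  by (auto simp: adj_def sw_def)

lemma act_append [simp]: "act (u @ v) x = act v (act u x)"
  by (induction u arbitrary: x) auto

lemma cross_append: "cross (u @ v) x y \<longleftrightarrow> cross u x y \<or> cross v (act u x) (act u y)"
  by (induction u arbitrary: x y) auto

lemma act_eq_iff [simp]: "act u x = act u y \<longleftrightarrow> x = y"
  by (induction u arbitrary: x y) auto

lemma act_rev [simp]: "act (rev u) (act u x) = x" "act u (act (rev u) x) = x"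
  by (induction u arbitrary: x) auto

lemma act_braid_step: "braid_step u v \<Longrightarrow> act u = act v"
proof (induction rule: braid_step.induct)
  case (far i j x y)
  have "act [i, j] z = act [j, i] z" for z
    using far by (auto simp: far_def sw_def)
  then show ?case by (auto simp: fun_eq_iff)
next
  case (adj i j x y)
  have "act [i, j, i] z = act [j, i, j] z" for z
    using adj by (auto simp: adj_def sw_def)
  then show ?case by (auto simp: fun_eq_iff)
qed

lemma act_braid_eq: "u \<approx> v \<Longrightarrow> act u = act v"
  by (induction rule: rtranclp_induct) (auto dest: act_braid_step)

lemma cross_braid_step: "braid_step u v \<Longrightarrow> cross u = cross v"
proof (induction rule: braid_step.induct)
  case (far i j x y)
  have "act [i, j] z = act [j, i] z" for z
    using far by (auto simp: far_def sw_def)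
  moreover have "cross [i, j] z z' = cross [j, i] z z'" for z z'
    using far by (auto simp: far_def sw_def doubleton_eq_iff split: if_splits)
  ultimately show ?case by (simp only: fun_eq_iff cross_append act_append) simp
next
  case (adj i j x y)
  have "act [i, j, i] z = act [j, i, j] z" for z
    using adj by (auto simp: adj_def sw_def)
  moreover have "cross [i, j, i] z z' = cross [j, i, j] z z'" for z z'
    using adj by (auto simp: adj_def sw_def doubleton_eq_iff split: if_splits)
  ultimately show ?case by (simp only: fun_eq_iff cross_append act_append) simp
qed

lemma cross_braid_eq: "u \<approx> v \<Longrightarrow> cross u = cross v"
  by (induction rule: rtranclp_induct) (auto dest: cross_braid_step)

text \<open>Dividing by \<open>x\<close> moves strand \<open>x\<close> to \<open>x + 1\<close>, and by Garside's theorem the quotient is still divisible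
  by \<open>x + 1, \<dots>, y - 1\<close>.\<close>

lemma cross_of_left_divisors:
  assumes "x < y" "\<And>i. x \<le> i \<Longrightarrow> i < y \<Longrightarrow> \<exists>v. u \<approx> i # v"
  shows "cross u x y"
  using assms
proof (induction "y - x" arbitrary: x u)
  case 0
  then show ?case by simp
next
  case (Suc d)
  obtain v where v: "u \<approx> x # v" using Suc.prems by blast
  show ?case
  proof (cases "y = Suc x")
    case True
    then show ?thesis using cross_braid_eq[OF v] by simp
  next
    case False
    have "cross v (Suc x) y"
    proof (rule Suc.hyps(1))
      show "d = y - Suc x" "Suc x < y" using Suc.hyps(2) Suc.prems(1) False by auto
      fix i assume i: "Suc x \<le> i" "i < y"
      then obtain v' where "u \<approx> i # v'" using Suc.prems(2)[of i] by auto
      then have "x # v \<approx> i # v'" using braid_eq_sym[OF v] braid_eq_trans by blast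
      then have "left_lcm x v i v'" by (rule garside)
      moreover have "far x i \<or> adj x i" using i by (auto simp: far_def adj_def)
      ultimately show "\<exists>z. v \<approx> i # z" unfolding left_lcm_def by blast
    qed
    moreover have "sw x y = y" using Suc.prems(1) False by (auto simp: sw_def)
    ultimately have "cross (x # v) x y" by simp
    then show ?thesis using cross_braid_eq[OF v] by simp
  qed
qed

text \<open>Only the letter \<open>l\<close> moves a strand across the gap between the positions
  \<open>l\<close> and \<open>l + 1\<close>.\<close>

lemma act_separated:
  assumes "l \<notin> set u"
  shows "x \<le> l \<Longrightarrow> act u x \<le> l" "l < x \<Longrightarrow> l < act u x"
proof -
  have "(x \<le> l \<longrightarrow> act u x \<le> l) \<and> (l < x \<longrightarrow> l < act u x)"
    using assms
  proof (induction u arbitrary: x)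
    case (Cons i u)
    then have "i \<noteq> l" "l \<notin> set u" by auto
    then have "x \<le> l \<longleftrightarrow> sw i x \<le> l" by (auto simp: sw_def)
    then show ?case using Cons.IH[of "sw i x"] \<open>l \<notin> set u\<close> by auto
  qed auto
  then show "x \<le> l \<Longrightarrow> act u x \<le> l" "l < x \<Longrightarrow> l < act u x" by auto
qed

lemma act_fixed:
  assumes "x \<notin> set u" "x = 0 \<or> x - 1 \<notin> set u"
  shows "act u x = x"
  using act_separated(1)[OF assms(1), of x] act_separated(2)[of "x - 1" u x] assms(2) by (cases "x = 0") auto

lemma not_cross_separated:
  assumes "l \<notin> set u" "x \<le> l" "l < y"
  shows "\<not> cross u x y"
  using assms
proof (induction u arbitrary: x y)
  case (Cons i u)
  then have "sw i x \<le> l" "l < sw i y" "{x, y} \<noteq> {i, Suc i}"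
    by (auto simp: sw_def doubleton_eq_iff)
  then show ?case using Cons by auto
qed auto

lemma cross_sym: "cross u x y = cross u y x"
  by (induction u arbitrary: x y) (auto simp: insert_commute)

section \<open>Inversions and reduced words\<close>

definition invs :: "(nat \<Rightarrow> nat) \<Rightarrow> (nat \<times> nat) set" where
  "invs f = {(x, y). x < y \<and> f y < f x}"

definition ninv :: "nat list \<Rightarrow> nat" where
  "ninv u = card (invs (act u))"

definition reduced :: "nat list \<Rightarrow> bool" where
  "reduced u \<longleftrightarrow> ninv u = length u"

text \<open>\<open>card\<close> is \<open>0\<close> on infinite sets, so counting inversions among
  all natural positions needs this. No strand passes a gap beyond the largest letter.\<close>

lemma finite_invs_act: "finite (invs (act u))"
proof -
  define l where "l = Suc (Max (insert 0 (set u)))"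
  have l: "l' \<notin> set u" if "l \<le> l'" for l'
  proof
    assume "l' \<in> set u"
    then have "l' \<le> Max (insert 0 (set u))" by (intro Max_ge) auto
    then show False using that by (simp add: l_def)
  qed
  have "y \<le> l" if "x < y" "act u y < act u x" for x y
  proof (rule ccontr)
    assume y: "\<not> y \<le> l"
    then have "act u x \<le> y - 1" "y - 1 < act u y"
      using that act_separated[OF l[of "y - 1"]] by auto
    then show False using that by simp
  qed
  then have "invs (act u) \<subseteq> {..l} \<times> {..l}" by (fastforce simp: invs_def)
  then show ?thesis by (rule finite_subset) simp
qed

text \<open>The extra first crossing relabels the strands by \<open>sw i\<close>, which keeps the
  order of every pair except \<open>i\<close>, \<open>i + 1\<close>; that pair is the new
  inversion.\<close>

lemma invs_Cons_ascent:
  assumes "act u i < act u (Suc i)"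
  shows "invs (act (i # u)) = insert (i, Suc i) ((\<lambda>(x, y). (sw i x, sw i y)) ` invs (act u))" (is "?A = ?B")
proof (intro Set.set_eqI iffI)
  fix p assume p: "p \<in> ?A"
  obtain x y where xy: "p = (x, y)" by fastforce
  show "p \<in> ?B"
  proof (cases "p = (i, Suc i)")
    case False
    then have "sw i x < sw i y" using p xy by (auto simp: invs_def sw_def)
    then have "(sw i x, sw i y) \<in> invs (act u)" using p xy by (auto simp: invs_def)
    then have "(sw i (sw i x), sw i (sw i y)) \<in> (\<lambda>(x, y). (sw i x, sw i y)) ` invs (act u)"
      by (rule rev_image_eqI) simp
    then show ?thesis using xy by simp
  qed simp
next
  fix p assume p: "p \<in> ?B"
  then show "p \<in> ?A"
  proof
    assume "p = (i, Suc i)"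
    then show ?thesis using assms by (auto simp: invs_def)
  next
    assume "p \<in> (\<lambda>(x, y). (sw i x, sw i y)) ` invs (act u)"
    then obtain x y where xy: "x < y" "act u y < act u x" "p = (sw i x, sw i y)"
      by (auto simp: invs_def)
    then have "(x, y) \<noteq> (i, Suc i)" using assms by auto
    then have "sw i x < sw i y" using xy by (auto simp: sw_def)
    then show ?thesis using xy by (auto simp: invs_def)
  qed
qed

lemma ninv_Cons_ascent:
  assumes "act u i < act u (Suc i)"
  shows "ninv (i # u) = Suc (ninv u)"
proof -
  have "(i, Suc i) \<notin> (\<lambda>(x, y). (sw i x, sw i y)) ` invs (act u)"
    by (auto simp: invs_def sw_def split: if_splits)
  moreover have "inj_on (\<lambda>(x, y). (sw i x, sw i y)) (invs (act u))"
    by (auto simp: inj_on_def)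
  ultimately show ?thesis
    unfolding ninv_def invs_Cons_ascent[OF assms]
    by (simp add: finite_invs_act card_image)
qed

lemma act_Cons_Cons [simp]: "act (i # i # u) = act u"
  by (simp add: fun_eq_iff)

lemma ninv_Cons_descent:
  assumes "act u (Suc i) < act u i"
  shows "ninv u = Suc (ninv (i # u))"
proof -
  \<comment> \<open>As \<open>i # i # u\<close> acts like \<open>u\<close>, a descent of
    \<open>u\<close> at \<open>i\<close> is an ascent of \<open>i # u\<close>.\<close>
  have "ninv (i # i # u) = Suc (ninv (i # u))"
    using assms by (intro ninv_Cons_ascent) simp
  then show ?thesis by (simp add: ninv_def)
qed

lemma act_neq_Suc: "act u i < act u (Suc i) \<or> act u (Suc i) < act u i"
  using act_eq_iff[of u i "Suc i"] by linarith

lemma ninv_Nil [simp]: "ninv [] = 0"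
proof -
  have "invs (act []) = {}" by (auto simp: invs_def)
  then show ?thesis by (simp add: ninv_def)
qed

lemma ninv_le_length: "ninv u \<le> length u"
proof (induction u)
  case Nil
  then show ?case by simp
next
  case (Cons i u)
  then show ?case using act_neq_Suc[of u i] ninv_Cons_ascent[of u i] ninv_Cons_descent[of u i] by auto
qed

lemma reduced_Cons: "reduced (i # u) \<longleftrightarrow> reduced u \<and> act u i < act u (Suc i)"
  using act_neq_Suc[of u i] ninv_Cons_ascent[of u i] ninv_Cons_descent[of u i] ninv_le_length[of u]
  by (auto simp: reduced_def)

lemma reduced_Nil [simp]: "reduced []"
  by (simp add: reduced_def)

text \<open>A strictly increasing map of the naturals moves nothing down. This applies to
  \<open>act u\<close> and to its inverse \<open>act (rev u)\<close>.\<close>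

lemma act_id_of_no_descent:
  assumes "\<And>i. act u i < act u (Suc i)"
  shows "act u = id"
proof -
  have m: "strict_mono (act u)" using assms by (auto simp: strict_mono_Suc_iff)
  have "strict_mono (act (rev u))"
    by (rule strict_monoI, rule ccontr)
      (metis act_rev(2) linorder_neqE_nat m not_less_iff_gr_or_eq strict_monoD)
  then have "act u x \<le> x" for x
    using strict_mono_imp_increasing[of "act (rev u)" "act u x"] by simp
  moreover have "x \<le> act u x" for x using m by (rule strict_mono_imp_increasing)
  ultimately show ?thesis by (auto simp: fun_eq_iff intro: antisym)
qed

text \<open>Sorting: each descent is removed by prepending its letter. No new letter is needed,
  since by \<open>act_separated\<close> a descent at \<open>i\<close> forces \<open>i\<close> to
  occur in the word.\<close>

lemma ex_reduced: "\<exists>v. set v \<subseteq> set u \<and> act v = act u \<and> reduced v"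
proof -
  have "\<exists>v. set v \<subseteq> S \<and> act v = act u \<and> reduced v" if "set u \<subseteq> S" for S
    using that
  proof (induction "ninv u" arbitrary: u rule: less_induct)
    case less
    show ?case
    proof (cases "\<exists>i. act u (Suc i) < act u i")
      case True
      then obtain i where i: "act u (Suc i) < act u i" by blast
      have iS: "i \<in> S"
      proof (rule ccontr)
        assume "i \<notin> S"
        then have "i \<notin> set u" using less.prems by auto
        then show False using act_separated[of i u i] act_separated[of i u "Suc i"] i by simp
      qed
      have n: "ninv u = Suc (ninv (i # u))" using i by (rule ninv_Cons_descent)
      then obtain v where v: "set v \<subseteq> S" "act v = act (i # u)" "reduced v"
        using less.hyps[of "i # u"] less.prems iS by auto
      have a: "act (i # v) = act u" using v(2) by (auto simp: fun_eq_iff)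
      then have "reduced (i # v)" using v n by (simp add: reduced_def ninv_def)
      then show ?thesis using a v iS by (intro exI[of _ "i # v"]) auto
    next
      case False
      then have "act u = id" using act_neq_Suc act_id_of_no_descent by metis
      then show ?thesis by (intro exI[of _ "[]"]) (auto simp: fun_eq_iff)
    qed
  qed
  then show ?thesis by blast
qed

lemma reduced_of_act_eq: "reduced u \<Longrightarrow> act v = act u \<Longrightarrow> length v = length u \<Longrightarrow> reduced v"
  by (simp add: reduced_def ninv_def)

text \<open>If the first letters \<open>i\<close> and \<open>j\<close> differ, the common
  permutation descends at both. It then has a reduced word beginning with their least common
  multiple, which can be written to begin with either letter, and the induction hypothesis compares
  its tails with those of \<open>u\<close> and \<open>v\<close>.\<close>

theorem matsumoto:
  assumes "reduced u" "reduced v" "act u = act v"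
  shows "u \<approx> v"
  using assms
proof (induction "length u" arbitrary: u v rule: less_induct)
  case less
  have len: "length u = length v" using less.prems by (simp add: reduced_def ninv_def)
  show ?case
  proof (cases u)
    case Nil
    then show ?thesis using len by simp
  next
    case (Cons i u')
    then obtain j v' where v: "v = j # v'" using len by (cases v) auto
    note u = Cons
    let ?f = "act u"
    have ru: "reduced u'" "act u' i < act u' (Suc i)" using less.prems(1) u reduced_Cons by auto
    have rv: "reduced v'" "act v' j < act v' (Suc j)" using less.prems(2) v reduced_Cons by auto
    have fu: "act u' = (\<lambda>x. ?f (sw i x))" using u by auto
    have fv: "act v' = (\<lambda>x. ?f (sw j x))" using v less.prems(3) by auto
    have di: "?f (Suc i) < ?f i" using ru u by simp
    have dj: "?f (Suc j) < ?f j" using rv v less.prems(3) by simp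
    have IH: "w \<approx> w'" if "length w < length u" "reduced w" "reduced w'" "act w = act w'" for w w'
      using less.hyps that by blast
    have lu: "length u' < length u" "length v' < length u" "length u' = length v'"
      using u v len by auto
    consider "i = j" | "far i j" | "adj i j" using far_adj_cases by blast
    then show ?thesis
    proof cases
      case 1
      then have "u' \<approx> v'" using IH[OF lu(1)] ru rv fu fv by simp
      then show ?thesis using u v 1 braid_eq_Cons by simp
    next
      case 2
      obtain z where z: "act z = act (j # u')" "reduced z" using ex_reduced by blast
      have "act u' (Suc j) < act u' j" using fu dj 2 by (auto simp: far_def sw_def)
      then have n: "ninv u' = Suc (ninv (j # u'))" by (rule ninv_Cons_descent)
      have lz: "length z + 1 = length u'" using n z ru(1) by (simp add: reduced_def ninv_def)
      have a1: "act (j # z) = act u'" using z(1) by (simp add: fun_eq_iff)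
      have a2: "act (i # z) = act v'" using z(1) fu fv 2 by (auto simp: fun_eq_iff far_def sw_def)
      have "u' \<approx> j # z" using IH[OF lu(1) ru(1) reduced_of_act_eq[OF ru(1) a1]] a1 lz by simp
      moreover have "v' \<approx> i # z" using IH[OF lu(2) rv(1) reduced_of_act_eq[OF rv(1) a2]] a2 lz lu by simp
      ultimately have "u \<approx> i # j # z" "v \<approx> j # i # z" using u v braid_eq_Cons by auto
      then show ?thesis using braid_eq_far[OF 2, of z] braid_eq_sym braid_eq_trans by blast
    next
      case 3
      \<comment> \<open>\<open>z\<close> is what remains of the permutation after removal of
        \<open>i j i\<close>.\<close>
      obtain z where z: "act z = act (i # j # u')" "reduced z" using ex_reduced by blast
      have "act u' (Suc j) < act u' j" using fu di dj 3 by (auto simp: adj_def sw_def)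
      then have n1: "ninv u' = Suc (ninv (j # u'))" by (rule ninv_Cons_descent)
      have "act (j # u') (Suc i) < act (j # u') i" using fu di dj 3 by (auto simp: adj_def sw_def)
      then have n2: "ninv (j # u') = Suc (ninv (i # j # u'))" by (rule ninv_Cons_descent)
      have lz: "length z + 2 = length u'" using n1 n2 z ru(1) by (simp add: reduced_def ninv_def)
      have a1: "act (j # i # z) = act u'" using z(1) by (simp add: fun_eq_iff)
      have a2: "act (i # j # z) = act v'" by (simp add: z(1) fu fv fun_eq_iff sw_braid[OF 3])
      have "u' \<approx> j # i # z" using IH[OF lu(1) ru(1) reduced_of_act_eq[OF ru(1) a1]] a1 lz by simp
      moreover have "v' \<approx> i # j # z" using IH[OF lu(2) rv(1) reduced_of_act_eq[OF rv(1) a2]] a2 lz lu by simp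
      ultimately have "u \<approx> i # j # i # z" "v \<approx> j # i # j # z" using u v braid_eq_Cons by auto
      then show ?thesis using braid_eq_adj[OF 3, of z] braid_eq_sym braid_eq_trans by blast
    qed
  qed
qed

text \<open>Longest elements are described by descents instead of maximal length, so that words
  built by hand can be recognised; \<open>longest_elt_type_A\<close> links the two
  descriptions.\<close>

definition longest_word :: "nat set \<Rightarrow> nat list \<Rightarrow> bool" where
  "longest_word J u \<longleftrightarrow> set u \<subseteq> J \<and> reduced u \<and> (\<forall>j\<in>J. act u (Suc j) < act u j)"

lemma act_decreasing_block:
  assumes "\<And>j. x \<le> j \<Longrightarrow> j < y \<Longrightarrow> act u (Suc j) < act u j" "x < y"
  shows "act u y < act u x"
  using assms(2,1)
proof (induction y)
  case (Suc y)
  show ?case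
  proof (cases "x = y")
    case False
    then have "act u y < act u x" using Suc by auto
    then show ?thesis using Suc.prems(2)[of y] Suc.prems(1) by (meson dual_order.strict_trans lessI less_Suc_eq_le)
  qed (use Suc in auto)
qed simp

text \<open>A letter outside \<open>J\<close> keeps the strands on its two sides in order; within a
  block of \<open>J\<close> consecutive descents compose.\<close>

lemma invs_longest_word:
  assumes "longest_word J u"
  shows "invs (act u) = {(x, y). x < y \<and> {x..<y} \<subseteq> J}"
proof -
  have "{x..<y} \<subseteq> J" if "x < y" "act u y < act u x" for x y
  proof (rule ccontr)
    assume "\<not> {x..<y} \<subseteq> J"
    then obtain l where "l \<in> {x..<y}" and l: "l \<notin> J" by blast
    then have l: "x \<le> l" "l < y" "l \<notin> J" by auto
    then have "l \<notin> set u" using assms by (auto simp: longest_word_def)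
    then show False using act_separated[of l u x] act_separated[of l u y] l that by auto
  qed
  moreover have "act u y < act u x" if "x < y" "{x..<y} \<subseteq> J" for x y
  proof (rule act_decreasing_block[OF _ that(1)])
    fix j assume "x \<le> j" "j < y"
    then have "j \<in> J" using that(2) by auto
    then show "act u (Suc j) < act u j" using assms by (simp add: longest_word_def)
  qed
  ultimately show ?thesis by (auto simp: invs_def)
qed

text \<open>Positions count from \<open>0\<close>, so the end of a strand is the number of strands
  that end below it, and the inversions tell which ones these are. Hence they determine the
  permutation.\<close>

lemma act_eq_card:
  "act u x = card ({y. y < x \<and> (y, x) \<notin> invs (act u)} \<union> {y. x < y \<and> (x, y) \<in> invs (act u)})" (is "_ = card ?S")
proof -
  have "?S = act (rev u) ` {..<act u x}"
  proof (intro Set.set_eqI iffI)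
    fix y assume "y \<in> ?S"
    then have "act u y < act u x"
      using act_eq_iff[of u x y] by (auto simp: invs_def simp del: act_eq_iff)
    then show "y \<in> act (rev u) ` {..<act u x}" by (intro rev_image_eqI[of "act u y"]) auto
  next
    fix y assume "y \<in> act (rev u) ` {..<act u x}"
    then obtain z where "y = act (rev u) z" "z < act u x" by blast
    then have "act u y < act u x" by simp
    then show "y \<in> ?S" by (cases x y rule: linorder_cases) (auto simp: invs_def)
  qed
  then show ?thesis by (simp add: card_image inj_on_def)
qed

lemma longest_word_unique:
  assumes "longest_word J u" "longest_word J v"
  shows "u \<approx> v"
proof (rule matsumoto)
  show "act u = act v"
    using invs_longest_word[OF assms(1)] invs_longest_word[OF assms(2)] act_eq_card[of u] act_eq_card[of v]
    by (simp add: fun_eq_iff)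
qed (use assms in \<open>auto simp: longest_word_def\<close>)

text \<open>The letters \<open>a, ..., b - 1\<close> move the positions \<open>a, ..., b\<close>.
  Below strand \<open>x\<close> end the \<open>a\<close> strands below the block and the
  \<open>b - x\<close> strands above \<open>x\<close> inside it.\<close>

lemma act_longest_word:
  assumes "longest_word J u" "{a..<b} \<subseteq> J" "a = 0 \<or> a - 1 \<notin> J" "b \<notin> J" "a \<le> x" "x \<le> b"
  shows "act u x = a + b - x"
proof -
  have "{y. y < x \<and> (y, x) \<notin> invs (act u)} = {..<a}"
  proof (intro Set.set_eqI iffI)
    fix y assume "y \<in> {y. y < x \<and> (y, x) \<notin> invs (act u)}"
    then have "\<not> {y..<x} \<subseteq> J" using invs_longest_word[OF assms(1)] by auto
    then obtain l where l: "l \<in> {y..<x}" "l \<notin> J" by blast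
    then have "l \<notin> {a..<b}" using assms(2) by blast
    then show "y \<in> {..<a}" using l assms(6) by auto
  next
    fix y assume "y \<in> {..<a}"
    then have "y < x" "a - 1 \<in> {y..<x}" "a - 1 \<notin> J" using assms by auto
    then show "y \<in> {y. y < x \<and> (y, x) \<notin> invs (act u)}" using invs_longest_word[OF assms(1)] by auto
  qed
  moreover have "{y. x < y \<and> (x, y) \<in> invs (act u)} = {x<..b}"
  proof (intro Set.set_eqI iffI)
    fix y assume "y \<in> {y. x < y \<and> (x, y) \<in> invs (act u)}"
    then have "x < y" "{x..<y} \<subseteq> J" using invs_longest_word[OF assms(1)] by auto
    then have "y \<le> b" using assms(4,6) by (metis atLeastLessThan_iff not_less subsetD)
    then show "y \<in> {x<..b}" using \<open>x < y\<close> by auto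
  next
    fix y assume "y \<in> {x<..b}"
    then show "y \<in> {y. x < y \<and> (x, y) \<in> invs (act u)}"
      using assms(2,5) invs_longest_word[OF assms(1)] by (auto simp: subset_iff)
  qed
  ultimately have "act u x = card ({..<a} \<union> {x<..b})" by (subst act_eq_card) simp
  also have "\<dots> = a + b - x" using assms(5,6) by (subst card_Un_disjoint) auto
  finally show ?thesis .
qed

lemma set_longest_word:
  assumes "longest_word J u"
  shows "set u = J"
proof
  show "set u \<subseteq> J" using assms by (simp add: longest_word_def)
  show "J \<subseteq> set u"
  proof (rule subsetI, rule ccontr)
    fix j assume j: "j \<in> J" "j \<notin> set u"
    then show False
      using assms act_separated[of j u j] act_separated[of j u "Suc j"] by (force simp: longest_word_def)
  qed
qed

section \<open>Presented monoids, Artin monoids and Coxeter groups of type A\<close>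

declare One_nat_def [simp del] in_listsI [rule del] in_listsD [rule del]

section \<open>Presented monoids and their universal property\<close>

abbreviation word_class :: "'a set \<Rightarrow> ('a list \<times> 'a list) set \<Rightarrow> 'a list \<Rightarrow> 'a list set" where
  "word_class I R u \<equiv> pres_cong I R `` {u}"

lemma pres_cong_lists: "(x, y) \<in> pres_cong I R \<Longrightarrow> x \<in> lists I \<and> y \<in> lists I"
  by (induction rule: pres_cong.induct) auto

lemma equiv_pres_cong: "equiv (lists I) (pres_cong I R)"
proof (rule equivI)
  show "refl_on (lists I) (pres_cong I R)"
    by (auto simp: refl_on_def intro: pres_cong.refl)
  show "sym (pres_cong I R)" by (auto simp: sym_def intro: pres_cong.sym)
  show "trans (pres_cong I R)" by (auto simp: trans_def intro: pres_cong.trans)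
  show "pres_cong I R \<subseteq> lists I \<times> lists I" by (auto dest: pres_cong_lists)
qed

lemma pres_cong_context:
  "(u, v) \<in> pres_cong I R \<Longrightarrow> x \<in> lists I \<Longrightarrow> y \<in> lists I \<Longrightarrow> (x @ u @ y, x @ v @ y) \<in> pres_cong I R"
proof (induction rule: pres_cong.induct)
  case (rel u v x' y')
  then show ?case using pres_cong.rel[of u v R I "x @ x'" "y' @ y"] by simp
next
  case (refl z)
  then show ?case by (intro pres_cong.refl) auto
qed (blast intro: pres_cong.sym pres_cong.trans)+

lemma pres_cong_append:
  assumes "(u, u') \<in> pres_cong I R" "(v, v') \<in> pres_cong I R"
  shows "(u @ v, u' @ v') \<in> pres_cong I R"
  using pres_cong_context[OF assms(1), of "[]" v] pres_cong_context[OF assms(2), of u' "[]"]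
    assms[THEN pres_cong_lists] by (auto intro: pres_cong.trans)

lemma word_class_eq_iff:
  "u \<in> lists I \<Longrightarrow> v \<in> lists I \<Longrightarrow> word_class I R u = word_class I R v \<longleftrightarrow> (u, v) \<in> pres_cong I R"
  by (rule eq_equiv_class_iff[OF equiv_pres_cong])

lemma carrier_pres_monoid: "carrier (pres_monoid I R) = word_class I R ` lists I"
  by (auto simp: pres_monoid_def quotient_def)

lemma one_pres_monoid: "\<one>\<^bsub>pres_monoid I R\<^esub> = word_class I R []"
  by (simp add: pres_monoid_def)

lemma mult_pres_monoid:
  assumes "u \<in> lists I" "v \<in> lists I"
  shows "word_class I R u \<otimes>\<^bsub>pres_monoid I R\<^esub> word_class I R v = word_class I R (u @ v)"
proof -
  have "word_class I R (x @ y) = word_class I R (u @ v)"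
    if "(u, x) \<in> pres_cong I R" "(v, y) \<in> pres_cong I R" for x y
    using pres_cong_append[OF that] by (intro equiv_class_eq[OF equiv_pres_cong]) (rule pres_cong.sym)
  then have "(\<Union>x\<in>word_class I R u. \<Union>y\<in>word_class I R v. word_class I R (x @ y)) = word_class I R (u @ v)"
    using assms by (auto intro: pres_cong.refl)
  then show ?thesis by (simp add: pres_monoid_def)
qed

lemma monoid_pres_monoid: "monoid (pres_monoid I R)"
  by unfold_locales
    (auto simp: carrier_pres_monoid one_pres_monoid mult_pres_monoid)

lemma concat_in_lists: "set us \<subseteq> lists I \<Longrightarrow> concat us \<in> lists I"
  by (induction us) auto

lemma prod_in_pres_monoid:
  "set us \<subseteq> lists I \<Longrightarrow> prod_in (pres_monoid I R) (map (word_class I R) us) = word_class I R (concat us)"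
  by (induction us) (auto simp: prod_in_def one_pres_monoid mult_pres_monoid concat_in_lists)

lemma concat_map_singleton: "concat (map (\<lambda>i. [i]) u) = u"
  by (induction u) auto

lemma prod_in_gens:
  assumes "u \<in> lists I"
  shows "prod_in (pres_monoid I R) (map (pres_gen I R) u) = word_class I R u"
proof -
  have "set (map (\<lambda>i. [i]) u) \<subseteq> lists I" using assms by (auto simp: in_lists_conv_set)
  then have "prod_in (pres_monoid I R) (map (word_class I R) (map (\<lambda>i. [i]) u)) = word_class I R u"
    by (simp only: prod_in_pres_monoid concat_map_singleton)
  then show ?thesis by (simp add: pres_gen_def[abs_def] comp_def)
qed

lemma map_alternating: "map f (alternating k x y) = alternating k (f x) (f y)"
  by (induction k arbitrary: x y) auto

lemma set_alternating: "set (alternating k x y) \<subseteq> {x, y}"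
  by (induction k arbitrary: x y) force+

lemma prod_in_alternating:
  assumes "u \<in> lists I" "v \<in> lists I"
  shows "prod_in (pres_monoid I R) (alternating k (word_class I R u) (word_class I R v))
    = word_class I R (concat (alternating k u v))"
  using prod_in_pres_monoid[of "alternating k u v" I R] set_alternating[of k u v] assms
  by (auto simp: map_alternating)

text \<open>Taking the union over all representatives avoids a choice; by
  \<open>pres_lift_class\<close> it is a single class if \<open>f\<close> respects the
  relations.\<close>

definition pres_lift :: "'b set \<Rightarrow> ('b list \<times> 'b list) set \<Rightarrow> ('a \<Rightarrow> 'b list) \<Rightarrow> 'a list set \<Rightarrow> 'b list set" where
  "pres_lift I R f A = (\<Union>u\<in>A. word_class I R (concat (map f u)))"

lemma concat_map_lists: "(\<And>i. i \<in> I \<Longrightarrow> f i \<in> lists I') \<Longrightarrow> u \<in> lists I \<Longrightarrow> concat (map f u) \<in> lists I'"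
  by (induction u) auto

lemma pres_lift_class:
  assumes f: "\<And>i. i \<in> I \<Longrightarrow> f i \<in> lists I'"
    and R: "\<And>u v. (u, v) \<in> R \<Longrightarrow> u \<in> lists I \<Longrightarrow> v \<in> lists I \<Longrightarrow>
      (concat (map f u), concat (map f v)) \<in> pres_cong I' R'"
    and u: "u \<in> lists I"
  shows "pres_lift I' R' f (word_class I R u) = word_class I' R' (concat (map f u))"
proof -
  have "(concat (map f x), concat (map f y)) \<in> pres_cong I' R'" if "(x, y) \<in> pres_cong I R" for x y
    using that
  proof (induction rule: pres_cong.induct)
    case (rel u v x y)
    then show ?case
      using pres_cong_context[OF R[OF rel(1-3)], of "concat (map f x)" "concat (map f y)"]
        concat_map_lists[of I f I', OF f] by auto
  next
    case (refl x)
    then show ?case using concat_map_lists[of I f I', OF f] by (auto intro: pres_cong.refl)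
  qed (auto intro: pres_cong.sym pres_cong.trans)
  then have "word_class I' R' (concat (map f x)) = word_class I' R' (concat (map f u))"
    if "(u, x) \<in> pres_cong I R" for x
    using that by (intro equiv_class_eq[OF equiv_pres_cong]) (rule pres_cong.sym)
  then show ?thesis
    using u unfolding pres_lift_def by (auto intro: pres_cong.refl)
qed

lemma pres_lift_hom:
  assumes f: "\<And>i. i \<in> I \<Longrightarrow> f i \<in> lists I'"
    and R: "\<And>u v. (u, v) \<in> R \<Longrightarrow> u \<in> lists I \<Longrightarrow> v \<in> lists I \<Longrightarrow>
      (concat (map f u), concat (map f v)) \<in> pres_cong I' R'"
  shows "pres_lift I' R' f \<in> hom (pres_monoid I R) (pres_monoid I' R')"
    and "pres_lift I' R' f \<one>\<^bsub>pres_monoid I R\<^esub> = \<one>\<^bsub>pres_monoid I' R'\<^esub>"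
    and "i \<in> I \<Longrightarrow> pres_lift I' R' f (pres_gen I R i) = word_class I' R' (f i)"
proof -
  have F: "pres_lift I' R' f (word_class I R u) = word_class I' R' (concat (map f u))" if "u \<in> lists I" for u
    using that f R by (intro pres_lift_class) auto
  have G: "concat (map f u) \<in> lists I'" if "u \<in> lists I" for u
    using that f by (intro concat_map_lists) auto
  show "pres_lift I' R' f \<in> hom (pres_monoid I R) (pres_monoid I' R')"
    using F G by (auto simp: hom_def carrier_pres_monoid mult_pres_monoid)
  show "pres_lift I' R' f \<one>\<^bsub>pres_monoid I R\<^esub> = \<one>\<^bsub>pres_monoid I' R'\<^esub>"
    using F[of "[]"] by (simp add: one_pres_monoid)
  show "i \<in> I \<Longrightarrow> pres_lift I' R' f (pres_gen I R i) = word_class I' R' (f i)"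
    using F[of "[i]"] by (simp add: pres_gen_def)
qed

lemma hom_prod_in:
  assumes "\<Phi> \<in> hom G H" "monoid G" "\<Phi> \<one>\<^bsub>G\<^esub> = \<one>\<^bsub>H\<^esub>" "set xs \<subseteq> carrier G"
  shows "\<Phi> (prod_in G xs) = prod_in H (map \<Phi> xs)"
proof -
  have "prod_in G xs \<in> carrier G \<and> \<Phi> (prod_in G xs) = prod_in H (map \<Phi> xs)"
    using assms(4)
  proof (induction xs)
    case Nil
    then show ?case using assms by (simp add: prod_in_def monoid.one_closed)
  next
    case (Cons x xs)
    then have "prod_in G xs \<in> carrier G" "x \<in> carrier G" "\<Phi> (prod_in G xs) = prod_in H (map \<Phi> xs)" by auto
    then show ?case using assms(1,2) hom_mult[OF assms(1)]
      by (simp add: prod_in_def monoid.m_closed)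
  qed
  then show ?thesis ..
qed

section \<open>The word problems of the Artin monoid and the Coxeter group in type A\<close>

abbreviation artin_cong :: "nat \<Rightarrow> (nat list \<times> nat list) set" where
  "artin_cong n \<equiv> pres_cong {1..n} (braid_rels (type_A n))"

abbreviation cox_cong :: "nat \<Rightarrow> (nat list \<times> nat list) set" where
  "cox_cong n \<equiv> pres_cong {1..n} (coxeter_rels (type_A n))"

abbreviation artin_class :: "nat \<Rightarrow> nat list \<Rightarrow> nat list set" where
  "artin_class n \<equiv> word_class {1..n} (braid_rels (type_A n))"

abbreviation cox_class :: "nat \<Rightarrow> nat list \<Rightarrow> nat list set" where
  "cox_class n \<equiv> word_class {1..n} (coxeter_rels (type_A n))"

lemma index_type_A [simp]: "index (type_A n) = {1..n}"
  by (simp add: type_A_def)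

lemma coeff_type_A:
  "i = j \<Longrightarrow> coeff (type_A n) i j = 1"
  "far i j \<Longrightarrow> coeff (type_A n) i j = 2"
  "adj i j \<Longrightarrow> coeff (type_A n) i j = 3"
  by (auto simp: type_A_def far_def adj_def)

lemma coeff_type_A_eq_enat:
  "coeff (type_A n) i j = enat m \<longleftrightarrow> (i = j \<and> m = 1) \<or> (far i j \<and> m = 2) \<or> (adj i j \<and> m = 3)"
proof -
  have "(1 :: enat) = enat 1" "(2 :: enat) = enat 2" "(3 :: enat) = enat 3"
    by (simp_all add: one_enat_def numeral_eq_enat)
  then show ?thesis
    using far_adj_cases[of i j] far_irrefl adj_irrefl adj_not_far[of i j]
    by (metis enat.inject coeff_type_A)
qed

lemma alternating_numeral:
  "alternating 2 i j = [i, j]" "alternating 3 i j = [i, j, i]"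
  by (simp_all add: numeral_2_eq_2 numeral_3_eq_3)

lemma braid_rels_type_A:
  "braid_rels (type_A n) = {([i, j], [j, i]) | i j. i \<in> {1..n} \<and> j \<in> {1..n} \<and> far i j} \<union>
    {([i, j, i], [j, i, j]) | i j. i \<in> {1..n} \<and> j \<in> {1..n} \<and> adj i j}" (is "?A = ?B")
proof
  show "?A \<subseteq> ?B"
    unfolding braid_rels_def by (fastforce simp: coeff_type_A_eq_enat numeral_2_eq_2 numeral_3_eq_3)
  have "([i, j], [j, i]) \<in> ?A" if "i \<in> {1..n}" "j \<in> {1..n}" "far i j" for i j
  proof -
    have "i \<noteq> j" "coeff (type_A n) i j = enat 2" using that far_irrefl by (auto simp: coeff_type_A_eq_enat)
    then show ?thesis unfolding braid_rels_def using that(1,2)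
      by (intro CollectI exI[of _ 2] exI[of _ i] exI[of _ j]) (simp add: alternating_numeral)
  qed
  moreover have "([i, j, i], [j, i, j]) \<in> ?A" if "i \<in> {1..n}" "j \<in> {1..n}" "adj i j" for i j
  proof -
    have "i \<noteq> j" "coeff (type_A n) i j = enat 3" using that adj_irrefl by (auto simp: coeff_type_A_eq_enat)
    then show ?thesis unfolding braid_rels_def using that(1,2)
      by (intro CollectI exI[of _ 3] exI[of _ i] exI[of _ j]) (simp add: alternating_numeral)
  qed
  ultimately show "?B \<subseteq> ?A" by blast
qed

lemma coxeter_rels_type_A:
  "coxeter_rels (type_A n) = {([i, i], []) | i. i \<in> {1..n}} \<union>
    {([i, j, i, j], []) | i j. i \<in> {1..n} \<and> j \<in> {1..n} \<and> far i j} \<union>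
    {([i, j, i, j, i, j], []) | i j. i \<in> {1..n} \<and> j \<in> {1..n} \<and> adj i j}" (is "?A = ?B")
proof
  have rep: "concat (replicate 1 w) = w" "concat (replicate 2 w) = w @ w" "concat (replicate 3 w) = w @ w @ w"
    for w :: "nat list"
    by (simp_all add: One_nat_def numeral_2_eq_2 numeral_3_eq_3)
  show "?A \<subseteq> ?B"
  proof
    fix p assume "p \<in> ?A"
    then obtain m i j where p: "p = (concat (replicate m [i, j]), [])" "i \<in> {1..n}" "j \<in> {1..n}"
      and "coeff (type_A n) i j = enat m"
      unfolding coxeter_rels_def by auto
    then consider "i = j" "m = 1" | "far i j" "m = 2" | "adj i j" "m = 3"
      using coeff_type_A_eq_enat by blast
    then show "p \<in> ?B" using p by cases (auto simp: rep)
  qed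
  have "(concat (replicate m [i, j]), []) \<in> ?A"
    if "i \<in> {1..n}" "j \<in> {1..n}" "coeff (type_A n) i j = enat m" for i j m
    unfolding coxeter_rels_def using that by auto
  note A = this
  have "([i, i], []) \<in> ?A" if "i \<in> {1..n}" for i
    using A[of i i 1] that unfolding coeff_type_A_eq_enat rep by simp
  moreover have "([i, j, i, j], []) \<in> ?A" if "i \<in> {1..n}" "j \<in> {1..n}" "far i j" for i j
    using A[of i j 2] that unfolding coeff_type_A_eq_enat rep by simp
  moreover have "([i, j, i, j, i, j], []) \<in> ?A" if "i \<in> {1..n}" "j \<in> {1..n}" "adj i j" for i j
    using A[of i j 3] that unfolding coeff_type_A_eq_enat rep by simp
  ultimately show "?B \<subseteq> ?A" by blast
qed

text \<open>Braid moves preserve the set of letters, so a chain of moves that starts within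
  \<open>[1, n]\<close> stays there.\<close>

lemma artin_cong_iff: "(u, v) \<in> artin_cong n \<longleftrightarrow> u \<in> lists {1..n} \<and> u \<approx> v"
proof
  assume "(u, v) \<in> artin_cong n"
  then show "u \<in> lists {1..n} \<and> u \<approx> v"
  proof (induction rule: pres_cong.induct)
    case (rel u v x y)
    have "u \<approx> v" using rel(1) unfolding braid_rels_type_A
      by (auto intro: braid_eq_far[of _ _ "[]"] braid_eq_adj[of _ _ "[]"])
    then show ?case using rel by (auto intro: braid_eq_context)
  next
    case (sym x y)
    then show ?case using pres_cong_lists[OF sym(1)] braid_eq_sym by blast
  next
    case (trans x y z)
    then show ?case using braid_eq_trans by blast
  qed auto
next
  assume "u \<in> lists {1..n} \<and> u \<approx> v"
  then have "u \<approx> v" "u \<in> lists {1..n}" by auto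
  then show "(u, v) \<in> artin_cong n"
  proof (induction rule: rtranclp_induct)
    case base
    then show ?case by (rule pres_cong.refl)
  next
    case (step y z)
    have y: "y \<in> lists {1..n}" using braid_eq_set[OF step(1)] step(4) by (simp add: in_lists_conv_set)
    have "(y, z) \<in> artin_cong n"
      using step(2) y
    proof (cases rule: braid_step.cases)
      case (far i j x w)
      have "([i, j], [j, i]) \<in> braid_rels (type_A n)" using far y by (auto simp: braid_rels_type_A)
      then show ?thesis using far y by (auto intro!: pres_cong.rel simp del: append_Cons)
    next
      case (adj i j x w)
      have "([i, j, i], [j, i, j]) \<in> braid_rels (type_A n)" using adj y by (auto simp: braid_rels_type_A)
      then show ?thesis using adj y by (auto intro!: pres_cong.rel simp del: append_Cons)
    qed
    then show ?case using step by (auto intro: pres_cong.trans)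
  qed
qed

lemma artin_class_eq_iff:
  "u \<in> lists {1..n} \<Longrightarrow> v \<in> lists {1..n} \<Longrightarrow> artin_class n u = artin_class n v \<longleftrightarrow> u \<approx> v"
  by (simp add: word_class_eq_iff artin_cong_iff)

lemma cox_cong_square:
  assumes "i \<in> {1..n}" "x \<in> lists {1..n}" "y \<in> lists {1..n}"
  shows "(x @ i # i # y, x @ y) \<in> cox_cong n"
  using pres_cong.rel[of "[i, i]" "[]" "coxeter_rels (type_A n)" "{1..n}" x y] assms
  by (auto simp: coxeter_rels_type_A)

lemma cox_cong_far:
  assumes "far i j" "i \<in> {1..n}" "j \<in> {1..n}"
  shows "([i, j], [j, i]) \<in> cox_cong n"
proof -
  \<comment> \<open>The word \<open>i (i j i j) j\<close> gives \<open>i j\<close> by deleting the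
    bracket and \<open>j i\<close> by cancelling squares.\<close>
  have "([i, i, j, i, j, j], [i, j]) \<in> cox_cong n"
    using pres_cong.rel[of "[i, j, i, j]" "[]" "coxeter_rels (type_A n)" "{1..n}" "[i]" "[j]"] assms
    by (auto simp: coxeter_rels_type_A)
  moreover have "([i, i, j, i, j, j], [j, i]) \<in> cox_cong n"
    using cox_cong_square[of i n "[]" "[j, i, j, j]"] cox_cong_square[of j n "[j, i]" "[]"] assms
    by (auto intro: pres_cong.trans)
  ultimately show ?thesis by (blast intro: pres_cong.trans pres_cong.sym)
qed

lemma cox_cong_adj:
  assumes "adj i j" "i \<in> {1..n}" "j \<in> {1..n}"
  shows "([i, j, i], [j, i, j]) \<in> cox_cong n"
proof -
  \<comment> \<open>Deleting the first six letters leaves \<open>j i j\<close>; cancelling squares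
    from the inside leaves \<open>i j i\<close>.\<close>
  have "([i, j, i, j, i, j, j, i, j], [j, i, j]) \<in> cox_cong n"
    using pres_cong.rel[of "[i, j, i, j, i, j]" "[]" "coxeter_rels (type_A n)" "{1..n}" "[]" "[j, i, j]"] assms
    by (auto simp: coxeter_rels_type_A)
  moreover have "([i, j, i, j, i, j, j, i, j], [i, j, i]) \<in> cox_cong n"
    using cox_cong_square[of j n "[i, j, i, j, i]" "[i, j]"] cox_cong_square[of i n "[i, j, i, j]" "[j]"]
      cox_cong_square[of j n "[i, j, i]" "[]"] assms
    by (auto intro: pres_cong.trans)
  ultimately show ?thesis by (blast intro: pres_cong.trans pres_cong.sym)
qed

lemma cox_cong_of_braid_eq:
  assumes "u \<approx> v" "u \<in> lists {1..n}"
  shows "(u, v) \<in> cox_cong n"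
proof -
  have "(u, v) \<in> artin_cong n" using assms by (simp add: artin_cong_iff)
  then show ?thesis
  proof (induction rule: pres_cong.induct)
    case (rel u v x y)
    have "(u, v) \<in> cox_cong n" using rel(1) unfolding braid_rels_type_A
      by (auto intro: cox_cong_far cox_cong_adj simp del: atLeastAtMost_iff)
    then show ?case using rel by (intro pres_cong_context)
  qed (auto intro: pres_cong.intros)
qed

text \<open>If the reduced word for the tail descends at the new letter \<open>i\<close>,
  Matsumoto's theorem rewrites it to begin with \<open>i\<close>, and the two letters
  \<open>i\<close> cancel.\<close>

lemma cox_cong_reduced: "u \<in> lists {1..n} \<Longrightarrow> \<exists>v. reduced v \<and> (u, v) \<in> cox_cong n"
proof (induction u)
  case Nil
  then show ?case by (intro exI[of _ "[]"]) (auto intro: pres_cong.refl)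
next
  case (Cons i u)
  then have i: "i \<in> {1..n}" and u: "u \<in> lists {1..n}" by auto
  obtain v where v: "reduced v" "(u, v) \<in> cox_cong n" using Cons u by blast
  have vI: "v \<in> lists {1..n}" using v pres_cong_lists by blast
  have iv: "(i # u, i # v) \<in> cox_cong n" using pres_cong_context[OF v(2), of "[i]" "[]"] i by auto
  show ?case
  proof (cases "act v i < act v (Suc i)")
    case True
    then show ?thesis using v iv reduced_Cons by blast
  next
    case False
    then have n: "ninv v = Suc (ninv (i # v))" using act_neq_Suc ninv_Cons_descent by blast
    obtain w where w: "set w \<subseteq> set (i # v)" "act w = act (i # v)" "reduced w" using ex_reduced by blast
    have a: "act (i # w) = act v" using w(2) by (auto simp: fun_eq_iff)
    have "ninv w = ninv (i # v)" unfolding ninv_def w(2) ..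
    then have "length (i # w) = length v" using n w(3) v(1) by (simp add: reduced_def)
    then have "reduced (i # w)" by (rule reduced_of_act_eq[OF v(1) a])
    then have "v \<approx> i # w" by (rule matsumoto[OF v(1) _ a[symmetric]])
    then have "(v, i # w) \<in> cox_cong n" using vI by (rule cox_cong_of_braid_eq)
    then have "(i # v, i # i # w) \<in> cox_cong n" using pres_cong_context[of v "i # w" _ _ "[i]" "[]"] i by auto
    moreover have "(i # i # w, w) \<in> cox_cong n" using cox_cong_square[of i n "[]" w] i w(1) vI
      by (auto simp: in_lists_conv_set)
    ultimately show ?thesis using iv w(3) by (blast intro: pres_cong.trans)
  qed
qed

lemma cox_cong_act: "(u, v) \<in> cox_cong n \<Longrightarrow> act u = act v"
proof (induction rule: pres_cong.induct)
  case (rel u v x y)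
  have "act u z = act v z" for z
    using rel(1) unfolding coxeter_rels_type_A by (auto simp: far_def adj_def sw_def)
  then show ?case by (auto simp: fun_eq_iff)
qed auto

text \<open>Every class contains a reduced word, and Matsumoto's theorem identifies reduced words
  with the same action, so the presented group acts faithfully on the strands.\<close>

lemma cox_cong_iff: "(u, v) \<in> cox_cong n \<longleftrightarrow> u \<in> lists {1..n} \<and> v \<in> lists {1..n} \<and> act u = act v"
proof
  assume uv: "u \<in> lists {1..n} \<and> v \<in> lists {1..n} \<and> act u = act v"
  obtain u' where u': "reduced u'" "(u, u') \<in> cox_cong n" using cox_cong_reduced uv by blast
  obtain v' where v': "reduced v'" "(v, v') \<in> cox_cong n" using cox_cong_reduced uv by blast
  have "act u' = act v'" using cox_cong_act[OF u'(2)] cox_cong_act[OF v'(2)] uv by simp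
  then have "u' \<approx> v'" by (rule matsumoto[OF u'(1) v'(1)])
  then have "(u', v') \<in> cox_cong n" using pres_cong_lists[OF u'(2)] cox_cong_of_braid_eq by blast
  then show "(u, v) \<in> cox_cong n"
    by (rule pres_cong.trans[OF pres_cong.trans[OF u'(2)] pres_cong.sym[OF v'(2)]])
next
  assume "(u, v) \<in> cox_cong n"
  then show "u \<in> lists {1..n} \<and> v \<in> lists {1..n} \<and> act u = act v"
    using pres_cong_lists[of u v] cox_cong_act[of u v n] by blast
qed

lemma cox_length_class:
  assumes "u \<in> lists {1..n}"
  shows "cox_length (cox_class n u) = ninv u"
  unfolding cox_length_def
proof (rule Least_equality)
  obtain v where "reduced v" "(u, v) \<in> cox_cong n" using cox_cong_reduced assms by blast
  then show "\<exists>v\<in>cox_class n u. length v = ninv u"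
    using cox_cong_act[of u v n] by (intro bexI[of _ v]) (auto simp: reduced_def ninv_def)
next
  fix k assume "\<exists>v\<in>cox_class n u. length v = k"
  then obtain v where "(u, v) \<in> cox_cong n" "length v = k" by auto
  then show "ninv u \<le> k" using cox_cong_act[of u v n] ninv_le_length[of v] by (simp add: ninv_def)
qed

lemma reduced_expr_class:
  assumes "u \<in> lists {1..n}"
  shows "reduced_expr v (cox_class n u) \<longleftrightarrow> v \<in> lists {1..n} \<and> act v = act u \<and> reduced v"
  using assms cox_length_class[OF assms]
  by (auto simp: reduced_expr_def cox_cong_iff reduced_def ninv_def)

text \<open>A crude bound, enough for an element of maximal length to exist.\<close>

lemma ninv_bounded:
  assumes "u \<in> lists {1..n}"
  shows "ninv u < Suc ((n + 2) * (n + 2))"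
proof -
  have "y < n + 2" if "x < y" "act u y < act u x" for x y
  proof (rule ccontr)
    assume "\<not> y < n + 2"
    moreover have "y - 1 \<notin> set u" using assms calculation by (force simp: in_lists_conv_set)
    moreover have "x \<le> y - 1" "y - 1 < y" using that by auto
    ultimately show False
      using act_separated(1)[of "y - 1" u x] act_separated(2)[of "y - 1" u y] that by linarith
  qed
  then have "invs (act u) \<subseteq> {..<n + 2} \<times> {..<n + 2}" by (fastforce simp: invs_def)
  then have "card (invs (act u)) \<le> card ({..<n + 2} \<times> {..<n + 2})" by (intro card_mono) auto
  then show ?thesis by (simp add: ninv_def)
qed

section \<open>Parabolic subgroups and their longest elements\<close>

lemma coxeter_group_type_A: "coxeter_group (type_A n) = pres_monoid {1..n} (coxeter_rels (type_A n))"
  by (simp add: coxeter_group_def)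

lemma artin_monoid_type_A: "artin_monoid (type_A n) = pres_monoid {1..n} (braid_rels (type_A n))"
  by (simp add: artin_monoid_def)

text \<open>\<open>generate\<close> also admits inverses of the generators, so these have to be
  found in a group that is presented as a monoid.\<close>

lemma coxeter_group_inv_gen:
  assumes "i \<in> {1..n}"
  shows "inv\<^bsub>coxeter_group (type_A n)\<^esub> (cox_class n [i]) = cox_class n [i]"
proof -
  interpret monoid "coxeter_group (type_A n)"
    unfolding coxeter_group_def by (rule monoid_pres_monoid)
  have "cox_class n [i] \<in> carrier (coxeter_group (type_A n))"
    using assms by (auto simp: coxeter_group_def carrier_pres_monoid)
  moreover have "cox_class n [i] \<otimes>\<^bsub>coxeter_group (type_A n)\<^esub> cox_class n [i] = \<one>\<^bsub>coxeter_group (type_A n)\<^esub>"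
    using assms
    by (simp add: coxeter_group_def mult_pres_monoid one_pres_monoid word_class_eq_iff cox_cong_iff fun_eq_iff)
  ultimately show ?thesis using inv_unique'[of "cox_class n [i]" "cox_class n [i]"] by simp
qed

lemma parabolic_type_A:
  assumes "J \<subseteq> {1..n}"
  shows "parabolic (type_A n) J = cox_class n ` lists J"
proof
  have mult: "cox_class n u \<otimes>\<^bsub>coxeter_group (type_A n)\<^esub> cox_class n v = cox_class n (u @ v)"
    if "u \<in> lists J" "v \<in> lists J" for u v
    using that lists_mono[OF assms] unfolding coxeter_group_type_A by (intro mult_pres_monoid) auto
  show "parabolic (type_A n) J \<subseteq> cox_class n ` lists J"
  proof
    fix w assume "w \<in> parabolic (type_A n) J"
    then show "w \<in> cox_class n ` lists J"
      unfolding parabolic_def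
    proof (induction rule: generate.induct)
      case one
      then show ?case by (auto simp: coxeter_group_def one_pres_monoid)
    next
      case (incl h)
      then show ?case by (auto simp: coxeter_gen_def pres_gen_def)
    next
      case (inv h)
      then obtain j where "j \<in> J" "h = cox_class n [j]" by (auto simp: coxeter_gen_def pres_gen_def)
      then show ?case using coxeter_group_inv_gen[of j n] assms by auto
    next
      case (eng h1 h2)
      then obtain u v where "u \<in> lists J" "v \<in> lists J" "h1 = cox_class n u" "h2 = cox_class n v" by blast
      then show ?case using mult by (auto intro!: image_eqI[of _ _ "u @ v"])
    qed
  qed
  have "cox_class n u \<in> parabolic (type_A n) J" if "u \<in> lists J" for u
    using that
  proof (induction u)
    case Nil
    show ?case using generate.one[of "coxeter_group (type_A n)"]
      by (simp add: parabolic_def coxeter_group_def one_pres_monoid)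
  next
    case (Cons j u)
    have "cox_class n [j] \<in> parabolic (type_A n) J"
      unfolding parabolic_def using Cons by (intro generate.incl) (auto simp: coxeter_gen_def pres_gen_def)
    then have "cox_class n [j] \<otimes>\<^bsub>coxeter_group (type_A n)\<^esub> cox_class n u \<in> parabolic (type_A n) J"
      using Cons unfolding parabolic_def by (intro generate.eng) auto
    then show ?case using mult[of "[j]" u] Cons by simp
  qed
  then show "cox_class n ` lists J \<subseteq> parabolic (type_A n) J" by blast
qed

text \<open>An element of maximal length descends at every \<open>j\<close> in \<open>J\<close>,
  since otherwise prepending \<open>j\<close> would lengthen it.\<close>

lemma longest_elt_type_A:
  assumes "J \<subseteq> {1..n}"
  shows "\<exists>u. longest_word J u \<and> longest_elt (type_A n) J = cox_class n u"
proof -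
  let ?w = "longest_elt (type_A n) J"
  have I: "u \<in> lists {1..n}" if "u \<in> lists J" for u using that lists_mono[OF assms] by auto
  have "?w \<in> parabolic (type_A n) J \<and> (\<forall>y. y \<in> parabolic (type_A n) J \<longrightarrow> cox_length y \<le> cox_length ?w)"
    unfolding longest_elt_def arg_max_on_def
  proof (rule arg_max_nat_lemma)
    show "cox_class n [] \<in> parabolic (type_A n) J" using parabolic_type_A[OF assms] by blast
    show "\<forall>y. y \<in> parabolic (type_A n) J \<longrightarrow> cox_length y < Suc ((n + 2) * (n + 2))"
      using parabolic_type_A[OF assms] I cox_length_class ninv_bounded by auto
  qed
  note w = this
  obtain u0 where u0: "u0 \<in> lists J" "?w = cox_class n u0"
    using w unfolding parabolic_type_A[OF assms] by blast
  have max: "ninv v \<le> ninv u0" if v: "v \<in> lists J" for v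
  proof -
    have "cox_length (cox_class n v) \<le> cox_length ?w"
      using w v unfolding parabolic_type_A[OF assms] by blast
    then show ?thesis using cox_length_class[OF I[OF v]] cox_length_class[OF I[OF u0(1)]] u0(2) by simp
  qed
  obtain u where u: "set u \<subseteq> set u0" "act u = act u0" "reduced u" using ex_reduced by blast
  have uJ: "u \<in> lists J" using u(1) u0(1) by (auto simp: in_lists_conv_set)
  have "cox_class n u = cox_class n u0"
    using u(2) I[OF uJ] I[OF u0(1)] by (simp add: word_class_eq_iff cox_cong_iff)
  moreover have "act u (Suc j) < act u j" if "j \<in> J" for j
  proof (rule ccontr)
    assume "\<not> act u (Suc j) < act u j"
    then have "ninv (j # u) = Suc (ninv u)" using act_neq_Suc ninv_Cons_ascent by blast
    then show False using max[of "j # u"] uJ that u(2) by (simp add: ninv_def)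
  qed
  ultimately show ?thesis using u(3) uJ u0(2)
    by (intro exI[of _ u]) (auto simp: longest_word_def in_lists_conv_set)
qed

lemma ex_longest_word: "J \<subseteq> {1..n} \<Longrightarrow> \<exists>u. longest_word J u"
  using longest_elt_type_A by blast

text \<open>\<open>artin_T\<close> picks some reduced expression; Matsumoto's theorem and the
  uniqueness of longest words remove the choice.\<close>

lemma artin_T_longest_elt:
  assumes "longest_word J u" "J \<subseteq> {1..n}"
  shows "artin_T (type_A n) (longest_elt (type_A n) J) = artin_class n u"
proof -
  have uI: "u \<in> lists {1..n}" using assms by (auto simp: longest_word_def in_lists_conv_set)
  obtain v where v: "longest_word J v" "longest_elt (type_A n) J = cox_class n v"
    using longest_elt_type_A[OF assms(2)] by blast
  have vI: "v \<in> lists {1..n}" using v assms(2) by (auto simp: longest_word_def in_lists_conv_set)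
  define x where "x = (SOME u. reduced_expr u (cox_class n v))"
  have "reduced_expr v (cox_class n v)" using v vI by (auto simp: reduced_expr_class longest_word_def)
  then have "reduced_expr x (cox_class n v)" unfolding x_def by (rule someI)
  then have x: "x \<in> lists {1..n}" "act x = act v" "reduced x" using reduced_expr_class[OF vI] by auto
  have "x \<approx> v" using x v by (intro matsumoto) (auto simp: longest_word_def)
  then have "x \<approx> u" using longest_word_unique[OF v(1) assms(1)] braid_eq_trans by blast
  then have "artin_class n x = artin_class n u" using x uI artin_class_eq_iff by blast
  moreover have "artin_T (type_A n) (longest_elt (type_A n) J) = artin_class n x"
    using prod_in_gens[OF x(1), of "braid_rels (type_A n)"]
    by (simp add: artin_T_def v(2) x_def[symmetric] artin_monoid_def artin_gen_def[abs_def])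
  ultimately show ?thesis by simp
qed

section \<open>Powers of Coxeter products\<close>

declare upt_Suc [simp del]

lemma equivp_braid_eq: "equivp braid_step\<^sup>*\<^sup>*"
  by (intro equivpI reflpI sympI transpI) (auto intro: braid_eq_sym braid_eq_trans)

\<comment> \<open>The quotient provides powers and the laws of \<open>monoid_mult\<close>; with
  unbounded letters one type serves every \<open>n\<close>.\<close>
quotient_type braid = "nat list" / "braid_step\<^sup>*\<^sup>*"
  by (rule equivp_braid_eq)

lift_definition br :: "nat list \<Rightarrow> braid" is "\<lambda>u. u" .

instantiation braid :: monoid_mult
begin

lift_definition one_braid :: braid is "[]" .

lift_definition times_braid :: "braid \<Rightarrow> braid \<Rightarrow> braid" is "(@)"
  by (rule braid_eq_append)

instance
  by standard (transfer; simp)+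

end

lemma br_eq_iff: "br u = br v \<longleftrightarrow> u \<approx> v"
  by transfer simp

lemma br_append: "br (u @ v) = br u * br v"
  by transfer simp

lemma br_Nil: "br [] = 1"
  by transfer simp

lemma br_Cons: "br (i # u) = br [i] * br u"
  using br_append[of "[i]" u] by simp

lemma br_left_cancel: "x * y = x * z \<Longrightarrow> y = (z :: braid)"
  by transfer (rule braid_eq_left_cancel)

lemma br_right_cancel: "y * x = z * x \<Longrightarrow> y = (z :: braid)"
  by transfer (rule braid_eq_right_cancel)

lemma br_comm_far:
  assumes "\<And>i. i \<in> set u \<Longrightarrow> far i j"
  shows "br u * br [j] = br [j] * br u"
  using assms
proof (induction u)
  case (Cons i u)
  have ij: "br [i] * br [j] = br [j] * br [i]"
    using braid_eq_far[of i j "[]"] Cons.prems by (simp add: br_append[symmetric] br_eq_iff)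
  have "br (i # u) * br [j] = br [i] * (br u * br [j])" by (simp add: br_Cons[of i u] mult.assoc)
  also have "\<dots> = (br [i] * br [j]) * br u" using Cons by (simp add: mult.assoc)
  also have "\<dots> = br [j] * br (i # u)" by (simp add: ij br_Cons[of i u] mult.assoc)
  finally show ?case .
qed (simp add: br_Nil)

lemma br_comm_far_words:
  assumes "\<And>i j. i \<in> set u \<Longrightarrow> j \<in> set v \<Longrightarrow> far i j"
  shows "br u * br v = br v * br u"
  using assms
proof (induction v)
  case (Cons j v)
  have "br u * br (j # v) = (br u * br [j]) * br v" by (simp add: br_Cons[of j v] mult.assoc)
  also have "\<dots> = br [j] * (br u * br v)" using Cons.prems by (simp add: br_comm_far mult.assoc)
  also have "\<dots> = br (j # v) * br u" using Cons by (simp add: br_Cons[of j v] mult.assoc)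
  finally show ?case .
qed (simp add: br_Nil)

section \<open>Products of consecutive generators as shifts of letters\<close>

definition asc :: "nat \<Rightarrow> nat \<Rightarrow> nat list" where
  "asc a b = [a..<Suc b]"

text \<open>On its way to the left \<open>j\<close> passes the letters above \<open>j + 1\<close>,
  turns into \<open>j + 1\<close> by the braid relation, and then passes the letters below
  \<open>j\<close>.\<close>

lemma asc_shift_word:
  assumes "a \<le> j" "j < b"
  shows "br (asc a b @ [j]) = br (Suc j # asc a b)"
proof -
  have "asc a b = [a..<j] @ [j, Suc j] @ [Suc (Suc j)..<Suc b]"
    using assms upt_add_eq_append[of a j "Suc b - j"]
    by (simp add: asc_def upt_conv_Cons)
  then have s: "br (asc a b) = br [a..<j] * (br [j] * br [Suc j]) * br [Suc (Suc j)..<Suc b]"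
    by (simp only: br_append br_Cons[of j "[Suc j]"] mult.assoc)
  have adj: "br [j] * br [Suc j] * br [j] = br [Suc j] * br [j] * br [Suc j]"
    using braid_eq_adj[of j "Suc j" "[]"] by (simp add: br_append[symmetric] br_eq_iff adj_def)
  have c1: "br [Suc (Suc j)..<Suc b] * br [j] = br [j] * br [Suc (Suc j)..<Suc b]"
    by (rule br_comm_far) (auto simp: far_def)
  have c2: "br [a..<j] * br [Suc j] = br [Suc j] * br [a..<j]"
    by (rule br_comm_far) (auto simp: far_def)
  have "br (asc a b @ [j]) = br [a..<j] * (br [j] * br [Suc j]) * (br [Suc (Suc j)..<Suc b] * br [j])"
    by (simp add: br_append s mult.assoc)
  also have "\<dots> = br [a..<j] * (br [j] * br [Suc j] * br [j]) * br [Suc (Suc j)..<Suc b]"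
    by (simp add: c1 mult.assoc)
  also have "\<dots> = (br [a..<j] * br [Suc j]) * (br [j] * br [Suc j]) * br [Suc (Suc j)..<Suc b]"
    unfolding adj by (simp only: mult.assoc)
  also have "\<dots> = br [Suc j] * br (asc a b)"
    by (simp add: c2 s mult.assoc)
  finally show ?thesis by (simp add: br_Cons[of "Suc j" "asc a b"])
qed

lemma asc_shift:
  "set w \<subseteq> {a..<b} \<Longrightarrow> br (asc a b) * br w = br (map Suc w) * br (asc a b)"
proof (induction w)
  case (Cons j w)
  have "br (asc a b) * br (j # w) = br (asc a b @ [j]) * br w"
    by (simp add: br_Cons[of j w] br_append mult.assoc)
  also have "\<dots> = br [Suc j] * (br (asc a b) * br w)"
    using Cons.prems by (simp add: asc_shift_word br_Cons[of "Suc j" "asc a b"] mult.assoc)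
  also have "\<dots> = br (map Suc (j # w)) * br (asc a b)"
    using Cons by (simp add: br_Cons[of "Suc j" "map Suc w"] mult.assoc)
  finally show ?case .
qed (simp add: br_Nil)

lemma desc_shift:
  assumes "set w \<subseteq> {a..<b}"
  shows "br (rev (asc a b)) * br (map Suc w) = br w * br (rev (asc a b))"
proof -
  have "asc a b @ rev w \<approx> map Suc (rev w) @ asc a b"
    using asc_shift[of "rev w" a b] assms by (simp add: br_append[symmetric] br_eq_iff)
  then have "rev (map Suc (rev w) @ asc a b) \<approx> rev (asc a b @ rev w)"
    using braid_eq_rev braid_eq_sym by blast
  then show ?thesis by (simp add: br_append[symmetric] br_eq_iff rev_map)
qed

text \<open>The letter \<open>b\<close> cannot be shifted further, but a second factor makes it wrap
  around to \<open>a\<close>: split the second \<open>asc a b\<close> before its last letter; its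
  first part passes the other factor as \<open>asc (a + 1) b\<close>, which \<open>a\<close>
  completes to \<open>asc a b\<close>.\<close>

lemma asc_shift_twice:
  assumes "a < b"
  shows "br (asc a b) * br (asc a b) * br [b] = br [a] * br (asc a b) * br (asc a b)"
proof -
  have b: "asc a b = asc a (b - 1) @ [b]" using assms by (simp add: asc_def upt_Suc_append)
  have a: "asc a b = a # asc (Suc a) b" using assms by (simp add: asc_def upt_conv_Cons)
  have m: "map Suc (asc a (b - 1)) = asc (Suc a) b" using assms by (simp add: asc_def map_Suc_upt)
  have "br [a] * br (asc a b) * br (asc a b) = br [a] * (br (asc a b) * br (asc a (b - 1))) * br [b]"
    by (subst (2) b) (simp add: br_append mult.assoc)
  also have "br (asc a b) * br (asc a (b - 1)) = br (asc (Suc a) b) * br (asc a b)"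
    unfolding m[symmetric] using assms by (intro asc_shift) (auto simp: asc_def)
  also have "br [a] * (br (asc (Suc a) b) * br (asc a b)) * br [b] = br (a # asc (Suc a) b) * br (asc a b) * br [b]"
    by (simp add: br_Cons[of a "asc (Suc a) b"] mult.assoc)
  finally show ?thesis using a by simp
qed

primrec lin_prod :: "(nat \<Rightarrow> 'a) \<Rightarrow> nat \<Rightarrow> 'a::monoid_mult" where
  "lin_prod R 0 = 1"
| "lin_prod R (Suc j) = lin_prod R j * R (Suc j)"

text \<open>\<open>q = 1\<close> selects the odd indices and \<open>q = 0\<close> the even ones, the
  two halves of the bipartite Coxeter product.\<close>

primrec par_prod :: "nat \<Rightarrow> (nat \<Rightarrow> 'a) \<Rightarrow> nat \<Rightarrow> 'a::monoid_mult" where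
  "par_prod q R 0 = 1"
| "par_prod q R (Suc j) = (if even (Suc j + q) then par_prod q R j * R (Suc j) else par_prod q R j)"

lemma comm_mult:
  assumes "g * x = x * g" "g * y = y * (g :: 'a::monoid_mult)"
  shows "g * (x * y) = (x * y) * g"
proof -
  have "g * (x * y) = (g * x) * y" by (simp only: mult.assoc)
  also have "\<dots> = x * (g * y)" unfolding assms(1) by (simp only: mult.assoc)
  also have "\<dots> = (x * y) * g" unfolding assms(2) by (simp only: mult.assoc)
  finally show ?thesis .
qed

lemma par_prod_comm:
  "(\<And>i. 1 \<le> i \<Longrightarrow> i \<le> j \<Longrightarrow> even (i + q) \<Longrightarrow> g * R i = R i * g) \<Longrightarrow> g * par_prod q R j = par_prod q R j * g"
proof (induction j)
  case (Suc j)
  have IH: "g * par_prod q R j = par_prod q R j * g" using Suc by auto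
  show ?case
  proof (cases "even (Suc j + q)")
    case True
    then have r: "g * R (Suc j) = R (Suc j) * g" using Suc.prems[of "Suc j"] by simp
    then show ?thesis using True comm_mult[OF IH r] by simp
  qed (use IH in simp)
qed simp

text \<open>As \<open>R\<^sub>j\<^sub>+\<^sub>1\<close> commutes with \<open>R\<^sub>1, \<dots>, R\<^sub>j\<^sub>-\<^sub>1\<close>, it can be rotated past the bipartite product of
  \<open>R\<^sub>1, \<dots>, R\<^sub>j\<close>; the second conjunct stands for \<open>u\<close> being a product of
  \<open>R\<^sub>1, \<dots>, R\<^sub>j\<^sub>-\<^sub>1\<close>.\<close>

lemma lin_prod_conj:
  fixes R :: "nat \<Rightarrow> 'a::monoid_mult"
  assumes R: "\<And>i j. 1 \<le> i \<Longrightarrow> i + 1 < j \<Longrightarrow> j \<le> s \<Longrightarrow> R i * R j = R j * R i" and "j \<le> s"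
  shows "\<exists>u. lin_prod R j * u = u * (par_prod 1 R j * par_prod 0 R j) \<and>
    (\<forall>g. (\<forall>i. 1 \<le> i \<and> i < j \<longrightarrow> g * R i = R i * g) \<longrightarrow> g * u = u * g)"
  using assms(2)
proof (induction j)
  case 0
  then show ?case by (intro exI[of _ 1]) auto
next
  case (Suc j)
  let ?R = "R (Suc j)" and ?o = "par_prod 1 R j" and ?e = "par_prod 0 R j"
  obtain u where u: "lin_prod R j * u = u * (?o * ?e)"
    and cu: "\<And>g. (\<forall>i. 1 \<le> i \<and> i < j \<longrightarrow> g * R i = R i * g) \<Longrightarrow> g * u = u * g"
    using Suc by auto
  have Ru: "?R * u = u * ?R" using R[of _ "Suc j"] Suc.prems by (intro cu) auto
  have L: "lin_prod R (Suc j) * u = u * (?o * ?e) * ?R"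
  proof -
    have "lin_prod R (Suc j) * u = lin_prod R j * (?R * u)" by (simp add: mult.assoc)
    also have "\<dots> = (lin_prod R j * u) * ?R" by (simp add: Ru mult.assoc)
    finally show ?thesis by (simp add: u)
  qed
  show ?case
  proof (cases "even (Suc j)")
    case True
    \<comment> \<open>The new factor already stands at the right end, where it joins the even
      half.\<close>
    have "lin_prod R (Suc j) * u = u * (par_prod 1 R (Suc j) * par_prod 0 R (Suc j))"
      using L True by (simp add: mult.assoc)
    then show ?thesis using cu by (intro exI[of _ u]) auto
  next
    case False
    have Ro: "?R * ?o = ?o * ?R"
    proof (rule par_prod_comm)
      fix i assume i: "1 \<le> i" "i \<le> j" "even (i + 1)"
      then have "i \<noteq> j" using False by auto
      then show "?R * R i = R i * ?R" using R[of i "Suc j"] i Suc.prems by simp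
    qed
    \<comment> \<open>Conjugation by \<open>?o * ?e\<close> carries the new factor from the right
      end to the left one; there it passes \<open>?o\<close> and joins the odd half.\<close>
    let ?u = "u * (?o * ?e)"
    have "lin_prod R (Suc j) * ?u = (lin_prod R (Suc j) * u) * (?o * ?e)" by (simp add: mult.assoc)
    also have "\<dots> = ?u * ((?R * ?o) * ?e)" by (simp only: L mult.assoc)
    also have "\<dots> = ?u * (par_prod 1 R (Suc j) * par_prod 0 R (Suc j))"
      unfolding Ro using False by simp
    finally have 1: "lin_prod R (Suc j) * ?u = ?u * (par_prod 1 R (Suc j) * par_prod 0 R (Suc j))" .
    have 2: "g * ?u = ?u * g" if g: "\<forall>i. 1 \<le> i \<and> i < Suc j \<longrightarrow> g * R i = R i * g" for g
    proof -
      have "g * u = u * g" using g by (intro cu) auto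
      moreover have "g * ?o = ?o * g" using g by (intro par_prod_comm) auto
      moreover have "g * ?e = ?e * g" using g by (intro par_prod_comm) auto
      ultimately show ?thesis by (intro comm_mult)
    qed
    show ?thesis using 1 2 by blast
  qed
qed

lemma conj_power: "x * u = u * y \<Longrightarrow> x ^ k * u = u * (y ^ k :: 'a::monoid_mult)"
proof (induction k)
  case (Suc k)
  have "x ^ Suc k * u = x ^ k * (x * u)" by (simp only: power_Suc2 mult.assoc)
  also have "\<dots> = (x ^ k * u) * y" unfolding Suc.prems by (simp only: mult.assoc)
  also have "\<dots> = u * y ^ Suc k" unfolding Suc.IH[OF Suc.prems] by (simp only: power_Suc2 mult.assoc)
  finally show ?case .
qed simp

lemma comm_power: "x * g = g * x \<Longrightarrow> x ^ k * g = g * (x ^ k :: 'a::monoid_mult)"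
  by (rule conj_power)

text \<open>The power of the linear product commutes with the conjugator \<open>u\<close> of
  \<open>lin_prod_conj\<close>, so cancelling \<open>u\<close> makes it equal to the power of
  \<open>?o * ?e\<close>. As it also commutes with \<open>?o\<close>, a second cancellation
  exchanges the two halves.\<close>

lemma bipartite_power_comm:
  fixes R :: "nat \<Rightarrow> braid"
  assumes R: "\<And>i j. 1 \<le> i \<Longrightarrow> i + 1 < j \<Longrightarrow> j \<le> s \<Longrightarrow> R i * R j = R j * R i"
    and C: "\<And>i. 1 \<le> i \<Longrightarrow> i \<le> s \<Longrightarrow> lin_prod R s ^ p * R i = R i * lin_prod R s ^ p"
  shows "(par_prod 1 R s * par_prod 0 R s) ^ p = (par_prod 0 R s * par_prod 1 R s) ^ p"
proof -
  let ?C = "lin_prod R s ^ p" and ?o = "par_prod 1 R s" and ?e = "par_prod 0 R s"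
  obtain u where u: "lin_prod R s * u = u * (?o * ?e)"
    and cu: "\<And>g. (\<forall>i. 1 \<le> i \<and> i < s \<longrightarrow> g * R i = R i * g) \<Longrightarrow> g * u = u * g"
    using lin_prod_conj[of s R s] R by auto
  have "u * (?o * ?e) ^ p = ?C * u" using conj_power[OF u] by simp
  also have "\<dots> = u * ?C" using C by (intro cu) auto
  finally have 1: "(?o * ?e) ^ p = ?C" by (rule br_left_cancel)
  have "?C * ?o = ?o * ?C" using C by (intro par_prod_comm) auto
  then have "?o * (?o * ?e) ^ p = (?o * ?e) ^ p * ?o" using 1 by simp
  also have "\<dots> = ?o * (?e * ?o) ^ p" by (rule conj_power) (simp add: mult.assoc)
  finally show ?thesis by (rule br_left_cancel)
qed

text \<open>The runs are the letters outside \<open>[a, b]\<close> and, in place of \<open>[a, b]\<close>, the braid which exchanges the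
  strands \<open>a\<close> and \<open>b + 1\<close> across the interior ones, i.e. the longest element of \<open>[a, b]\<close>
  without that of \<open>[a + 1, b - 1]\<close>.\<close>

definition run :: "nat \<Rightarrow> nat \<Rightarrow> nat \<Rightarrow> nat list" where
  "run a b i = (if i < a then [i] else if i = a then asc a b @ rev [a..<b] else [i + (b - a)])"

text \<open>The product of all runs is \<open>\<delta> v a\<close>, where \<open>\<delta> = T\<^sub>1 \<cdots> T\<^sub>n\<close> satisfies \<open>\<delta> T\<^sub>i = T\<^sub>i\<^sub>+\<^sub>1 \<delta>\<close> and hence
  \<open>\<delta> v j = v (j + 1) \<delta>\<close>. This gives its powers, and reduces them to the case
  \<open>a = 1\<close>.\<close>

locale linear_coxeter =
  fixes n a b m s :: nat
  assumes n: "2 \<le> n" and a: "1 \<le> a" and b: "b = a + m" "b \<le> n" and s: "s = n - m"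
begin

abbreviation \<delta> :: braid where "\<delta> \<equiv> br (asc 1 n)"

abbreviation v :: "nat \<Rightarrow> braid" where "v j \<equiv> br (rev [j..<j + m])"

lemma delta_power_shift: "set w \<subseteq> {1..n} \<Longrightarrow> \<forall>x\<in>set w. x + r \<le> n \<Longrightarrow> \<delta> ^ r * br w = br (map (\<lambda>x. x + r) w) * \<delta> ^ r"
proof (induction r arbitrary: w)
  case (Suc r)
  have "\<delta> ^ Suc r * br w = \<delta> ^ r * (\<delta> * br w)" by (simp add: power_Suc2 mult.assoc del: power_Suc)
  also have "\<delta> * br w = br (map Suc w) * \<delta>" using Suc.prems by (intro asc_shift) fastforce
  also have "\<delta> ^ r * (br (map Suc w) * \<delta>) = (\<delta> ^ r * br (map Suc w)) * \<delta>" by (simp add: mult.assoc)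
  also have "\<delta> ^ r * br (map Suc w) = br (map (\<lambda>x. x + r) (map Suc w)) * \<delta> ^ r"
    using Suc.prems by (intro Suc.IH) fastforce+
  finally show ?case by (simp add: power_Suc2 mult.assoc comp_def del: power_Suc)
qed simp

text \<open>The letter \<open>x\<close> climbs to \<open>n\<close> in \<open>n - x\<close> steps,
  wraps around to \<open>1\<close> in two, and climbs to \<open>y\<close> in \<open>y - 1\<close>:
  powers of \<open>\<delta>\<close> shift letters modulo \<open>n + 1\<close>.\<close>

lemma delta_power_wrap:
  assumes "1 \<le> x" "x \<le> n" "n < y + n" "y + n + 1 = r + x" "y \<le> n"
  shows "\<delta> ^ r * br [x] = br [y] * \<delta> ^ r"
proof -
  have r: "r = (y - 1) + (2 + (n - x))" using assms by simp
  have 1: "\<delta> ^ (n - x) * br [x] = br [n] * \<delta> ^ (n - x)"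
    using delta_power_shift[of "[x]" "n - x"] assms by simp
  have 2: "\<delta> ^ 2 * br [n] = br [1] * \<delta> ^ 2"
    using asc_shift_twice[of 1 n] n by (simp add: power2_eq_square mult.assoc)
  have 3: "\<delta> ^ (y - 1) * br [1] = br [y] * \<delta> ^ (y - 1)"
    using delta_power_shift[of "[1]" "y - 1"] assms by simp
  have "\<delta> ^ r * br [x] = \<delta> ^ (y - 1) * (\<delta> ^ 2 * (\<delta> ^ (n - x) * br [x]))"
    unfolding r by (simp only: power_add mult.assoc)
  also have "\<dots> = \<delta> ^ (y - 1) * ((\<delta> ^ 2 * br [n]) * \<delta> ^ (n - x))" by (simp only: 1 mult.assoc)
  also have "\<dots> = (\<delta> ^ (y - 1) * br [1]) * \<delta> ^ 2 * \<delta> ^ (n - x)" by (simp only: 2 mult.assoc)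
  also have "\<dots> = br [y] * \<delta> ^ r" unfolding r by (simp only: 3 power_add mult.assoc)
  finally show ?thesis .
qed

lemma delta_power_v:
  assumes "j + m \<le> Suc n" "1 \<le> j" "j + m + r \<le> Suc n"
  shows "\<delta> ^ r * v j = v (j + r) * \<delta> ^ r"
proof -
  have "map (\<lambda>x. x + r) (rev [j..<j + m]) = rev [j + r..<j + r + m]"
    by (auto simp: rev_map[symmetric] add.commute add.left_commute intro: nth_equalityI)
  moreover have "\<delta> ^ r * v j = br (map (\<lambda>x. x + r) (rev [j..<j + m])) * \<delta> ^ r"
    using assms by (intro delta_power_shift) auto
  ultimately show ?thesis by simp
qed

text \<open>The descending word \<open>w = T_(i+m) ... T_i\<close> is both
  \<open>T_(i+m) v i\<close> and \<open>v (i + 1) T_i\<close>, and \<open>desc_shift\<close> gives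
  \<open>w v (i + 1) = v i w\<close>.\<close>

lemma v_shift: "v i * v (Suc i) * br [i] = br [i + m] * v i * v (Suc i)"
proof -
  have w: "br (rev (asc i (i + m))) = br [i + m] * v i"
    by (simp add: asc_def upt_Suc_append br_Cons[of "i + m" "rev [i..<i + m]"])
  have w': "br (rev (asc i (i + m))) = v (Suc i) * br [i]"
    by (simp add: asc_def upt_conv_Cons br_append)
  have "map Suc (rev [i..<i + m]) = rev [Suc i..<Suc i + m]"
    by (simp add: rev_map[symmetric] map_Suc_upt)
  then have "br (rev (asc i (i + m))) * v (Suc i) = v i * br (rev (asc i (i + m)))"
    using desc_shift[of "rev [i..<i + m]" i "i + m"] by auto
  then show ?thesis using w w' by (simp add: mult.assoc)
qed

primrec V :: "nat \<Rightarrow> braid" where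
  "V 0 = 1"
| "V (Suc j) = V j * v (Suc j)"

lemma V_left: "j < i \<Longrightarrow> V j * br [i + m] = br [i + m] * V j"
proof (induction j)
  case (Suc j)
  have "v (Suc j) * br [i + m] = br [i + m] * v (Suc j)"
    using Suc.prems by (intro br_comm_far) (auto simp: far_def)
  then have "V (Suc j) * br [i + m] = (V j * br [i + m]) * v (Suc j)" by (simp add: mult.assoc)
  then show ?case using Suc by (simp add: mult.assoc)
qed simp

text \<open>Moving left, \<open>i\<close> passes the factors after \<open>v (i + 1)\<close>, becomes
  \<open>i + m\<close> at \<open>v i v (i + 1)\<close> by \<open>v_shift\<close>, and passes the
  remaining factors by \<open>V_left\<close>.\<close>

lemma V_shift: "1 \<le> i \<Longrightarrow> i < j \<Longrightarrow> V j * br [i] = br [i + m] * V j"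
proof (induction j)
  case (Suc j)
  show ?case
  proof (cases "i = j")
    case True
    then obtain j' where j': "j = Suc j'" using Suc.prems by (cases j) auto
    have "V (Suc j) * br [i] = V j' * (v i * v (Suc i) * br [i])" using True j' by (simp add: mult.assoc)
    also have "v i * v (Suc i) * br [i] = br [i + m] * (v i * v (Suc i))" unfolding v_shift by (simp only: mult.assoc)
    also have "V j' * (br [i + m] * (v i * v (Suc i))) = (V j' * br [i + m]) * (v i * v (Suc i))" by (simp only: mult.assoc)
    also have "\<dots> = br [i + m] * V (Suc j)" using V_left[of j' i] True j' by (simp add: mult.assoc)
    finally show ?thesis .
  next
    case False
    then have "v (Suc j) * br [i] = br [i] * v (Suc j)"
      using Suc.prems by (intro br_comm_far) (auto simp: far_def)
    then have "V (Suc j) * br [i] = (V j * br [i]) * v (Suc j)" by (simp add: mult.assoc)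
    then show ?thesis using Suc False by (simp add: mult.assoc)
  qed
qed simp

text \<open>Collecting the factors \<open>\<delta>\<close> on the right shifts the successive copies
  of \<open>v 1\<close> to \<open>v 1, ..., v p\<close>. The bound on \<open>p\<close> keeps the
  letters of \<open>v p\<close> within \<open>[1, n]\<close>.\<close>

lemma v_delta_power: "p \<le> Suc s \<Longrightarrow> (v 1 * \<delta>) ^ p = V p * \<delta> ^ p"
proof (induction p)
  case (Suc p)
  have "(v 1 * \<delta>) ^ Suc p = (v 1 * \<delta>) ^ p * (v 1 * \<delta>)" by (simp add: power_Suc2 del: power_Suc)
  also have "\<dots> = V p * (\<delta> ^ p * v 1) * \<delta>" using Suc by (simp add: mult.assoc)
  also have "\<delta> ^ p * v 1 = v (Suc p) * \<delta> ^ p" using delta_power_v[of 1 p] Suc.prems s b by (simp only: plus_1_eq_Suc)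
  finally show ?case by (simp add: power_Suc2 mult.assoc del: power_Suc)
qed simp

text \<open>The power \<open>s + 1\<close> of \<open>\<delta>\<close> shifts \<open>i\<close> by
  \<open>s + 1\<close>, which is \<open>-m\<close> modulo \<open>n + 1\<close>, and
  \<open>V (s + 1)\<close> shifts it back by \<open>m\<close>.\<close>

lemma v_delta_power_comm:
  assumes "m < i" "i \<le> n"
  shows "(v 1 * \<delta>) ^ Suc s * br [i] = br [i] * (v 1 * \<delta>) ^ Suc s"
proof -
  have 1: "\<delta> ^ Suc s * br [i] = br [i - m] * \<delta> ^ Suc s"
    using assms s b by (intro delta_power_wrap) auto
  have 2: "V (Suc s) * br [i - m] = br [i] * V (Suc s)"
    using V_shift[of "i - m" "Suc s"] assms s b by simp
  have "(v 1 * \<delta>) ^ Suc s * br [i] = V (Suc s) * (\<delta> ^ Suc s * br [i])"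
    by (simp only: v_delta_power[OF order_refl] mult.assoc)
  also have "\<dots> = (V (Suc s) * br [i - m]) * \<delta> ^ Suc s" by (simp only: 1 mult.assoc)
  also have "\<dots> = br [i] * (v 1 * \<delta>) ^ Suc s"
    by (simp only: 2 v_delta_power[OF order_refl] mult.assoc)
  finally show ?thesis .
qed

abbreviation c :: braid where "c \<equiv> \<delta> * v a"

lemma c_conj: "c ^ p * \<delta> ^ a = \<delta> ^ a * (v 1 * \<delta>) ^ p"
proof (rule conj_power)
  have 1: "\<delta> ^ a * v 1 = v (Suc a) * \<delta> ^ a" using delta_power_v[of 1 a] b a by (simp only: plus_1_eq_Suc)
  have 2: "\<delta> * v a = v (Suc a) * \<delta>" using delta_power_v[of a 1] b a by (simp only: power_one_right Suc_eq_plus1)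
  have "\<delta> * v a * \<delta> ^ a = v (Suc a) * (\<delta> * \<delta> ^ a)" by (simp only: 2 mult.assoc)
  also have "\<dots> = (v (Suc a) * \<delta> ^ a) * \<delta>" by (simp add: power_commutes[symmetric] mult.assoc)
  finally show "\<delta> * v a * \<delta> ^ a = \<delta> ^ a * (v 1 * \<delta>)" by (simp only: 1[symmetric] mult.assoc)
qed

lemma c_power_comm_thin:
  assumes "1 \<le> i" "i \<le> n" "i < a \<or> b < i"
  shows "c ^ Suc s * br [i] = br [i] * c ^ Suc s"
proof -
  \<comment> \<open>\<open>x\<close> is the letter that \<open>\<delta> ^ a\<close> carries to
    \<open>i\<close>, with a wrap if \<open>i < a\<close>. For \<open>i\<close> outside
    \<open>[a, b]\<close> it exceeds \<open>m\<close>, as \<open>v_delta_power_comm\<close>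
    requires.\<close>
  obtain x where x: "m < x" "x \<le> n" "\<delta> ^ a * br [x] = br [i] * \<delta> ^ a"
  proof (cases "b < i")
    case True
    then have "1 \<le> i - a" "i - a + a = i" "i - a \<le> n" using assms b by auto
    then have "\<delta> ^ a * br [i - a] = br [i] * \<delta> ^ a"
      using delta_power_shift[of "[i - a]" a] assms by simp
    then show ?thesis using that[of "i - a"] True assms b by auto
  next
    case False
    then have "\<delta> ^ a * br [n - a + i + 1] = br [i] * \<delta> ^ a"
      using assms b a by (intro delta_power_wrap) auto
    then show ?thesis using that[of "n - a + i + 1"] False assms b a by auto
  qed
  let ?E = "(v 1 * \<delta>) ^ Suc s"
  have "(c ^ Suc s * br [i]) * \<delta> ^ a = c ^ Suc s * (\<delta> ^ a * br [x])" by (simp only: x(3) mult.assoc)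
  also have "\<dots> = \<delta> ^ a * (?E * br [x])" by (simp only: c_conj mult.assoc[symmetric])
  also have "\<dots> = (\<delta> ^ a * br [x]) * ?E" by (simp only: v_delta_power_comm[OF x(1,2)] mult.assoc)
  also have "\<dots> = br [i] * (\<delta> ^ a * ?E)" by (simp only: x(3) mult.assoc)
  also have "\<dots> = (br [i] * c ^ Suc s) * \<delta> ^ a" by (simp only: c_conj[symmetric] mult.assoc)
  finally show ?thesis by (rule br_right_cancel)
qed

lemma lin_prod_run_below: "j < a \<Longrightarrow> lin_prod (\<lambda>i. br (run a b i)) j = br [1..<Suc j]"
proof (induction j)
  case 0
  then show ?case by (simp add: br_Nil)
next
  case (Suc j)
  then show ?case by (simp add: run_def br_append upt_Suc_append)
qed

lemma lin_prod_run_above: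
  "j \<le> s - a \<Longrightarrow> lin_prod (\<lambda>i. br (run a b i)) (a + j) = br [1..<a] * br (run a b a) * br [Suc b..<Suc (b + j)]"
proof (induction j)
  case 0
  have "lin_prod (\<lambda>i. br (run a b i)) a = lin_prod (\<lambda>i. br (run a b i)) (a - 1) * br (run a b a)" using a by (cases a) auto
  also have "lin_prod (\<lambda>i. br (run a b i)) (a - 1) = br [1..<a]" using lin_prod_run_below[of "a - 1"] a by simp
  finally show ?case by (simp add: br_Nil)
next
  case (Suc j)
  have "lin_prod (\<lambda>i. br (run a b i)) (a + Suc j) = lin_prod (\<lambda>i. br (run a b i)) (a + j) * br [Suc (b + j)]"
    using b by (simp add: run_def add.commute add.left_commute)
  also have "\<dots> = br [1..<a] * br (run a b a) * (br [Suc b..<Suc (b + j)] * br [Suc (b + j)])"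
    using Suc by (simp add: mult.assoc)
  finally show ?case by (simp add: br_append upt_Suc_append)
qed

lemma lin_prod_run: "lin_prod (\<lambda>i. br (run a b i)) s = c"
proof -
  have "asc 1 n = [1..<a] @ asc a b @ [Suc b..<Suc n]"
    using a b upt_add_eq_append[of 1 a "Suc n - a"] upt_add_eq_append[of a "Suc b" "Suc n - Suc b"]
    by (simp add: asc_def)
  then have d: "\<delta> = br [1..<a] * br (asc a b) * br [Suc b..<Suc n]" by (simp only: br_append mult.assoc)
  \<comment> \<open>\<open>v a\<close> has only letters below \<open>b\<close>, so it passes those
    above \<open>b\<close>.\<close>
  have vc: "br [Suc b..<Suc n] * v a = v a * br [Suc b..<Suc n]"
    using b by (intro br_comm_far_words) (auto simp: far_def)
  have "lin_prod (\<lambda>i. br (run a b i)) s = br [1..<a] * br (run a b a) * br [Suc b..<Suc n]"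
    using lin_prod_run_above[of "s - a"] b s by simp
  also have "\<dots> = br [1..<a] * br (asc a b) * (v a * br [Suc b..<Suc n])"
    using b by (simp add: run_def br_append mult.assoc)
  also have "\<dots> = c" by (simp only: vc[symmetric] d mult.assoc)
  finally show ?thesis .
qed

lemma c_power_comm_word:
  "\<forall>i\<in>set w. 1 \<le> i \<and> i \<le> n \<and> (i < a \<or> b < i) \<Longrightarrow> c ^ Suc s * br w = br w * c ^ Suc s"
proof (induction w)
  case (Cons i w)
  have "c ^ Suc s * br (i # w) = (c ^ Suc s * br [i]) * br w" by (simp only: br_Cons[of i w] mult.assoc)
  also have "\<dots> = br [i] * (c ^ Suc s * br w)" using Cons.prems by (subst c_power_comm_thin) (auto simp: mult.assoc)
  also have "\<dots> = br (i # w) * c ^ Suc s" using Cons by (simp only: br_Cons[of i w] mult.assoc list.set_intros) simp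
  finally show ?case .
qed (simp add: br_Nil)

text \<open>For the thick run, write \<open>c\<close> as this run between products of single letters
  outside \<open>[a, b]\<close>. The power commutes with \<open>c\<close> and with those letters,
  and cancellation leaves the run.\<close>

lemma c_power_comm_run:
  assumes "1 \<le> i" "i \<le> s"
  shows "c ^ Suc s * br (run a b i) = br (run a b i) * c ^ Suc s"
proof (cases "i = a")
  case False
  then show ?thesis using assms b s by (intro c_power_comm_word) (auto simp: run_def)
next
  case True
  let ?C = "c ^ Suc s" and ?L = "br [1..<a]" and ?U = "br [Suc b..<Suc n]" and ?Z = "br (run a b a)"
  have c: "c = ?L * ?Z * ?U"
    using lin_prod_run lin_prod_run_above[of "s - a"] b s by simp
  have L: "?C * ?L = ?L * ?C" using b by (intro c_power_comm_word) auto
  have U: "?C * ?U = ?U * ?C" using b a by (intro c_power_comm_word) auto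
  have "?C * (?L * ?Z * ?U) = (?L * ?Z * ?U) * ?C" unfolding c[symmetric] by (rule comm_power) simp
  also have "\<dots> = (?L * ?Z * ?C) * ?U" by (simp only: U mult.assoc)
  finally have "(?C * ?L * ?Z) * ?U = (?L * ?Z * ?C) * ?U" by (simp only: mult.assoc)
  then have "?C * ?L * ?Z = ?L * ?Z * ?C" by (rule br_right_cancel)
  then have "?L * (?C * ?Z) = ?L * (?Z * ?C)" by (simp only: L mult.assoc)
  then have "?C * ?Z = ?Z * ?C" by (rule br_left_cancel)
  then show ?thesis using True by simp
qed

lemma run_far:
  assumes "1 \<le> i" "i + 1 < j" "x \<in> set (run a b i)" "y \<in> set (run a b j)"
  shows "far x y"
  using assms b by (auto simp: run_def asc_def far_def split: if_splits)

lemma bipartite_run_power: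
  "(par_prod 1 (\<lambda>i. br (run a b i)) s * par_prod 0 (\<lambda>i. br (run a b i)) s) ^ Suc s = (par_prod 0 (\<lambda>i. br (run a b i)) s * par_prod 1 (\<lambda>i. br (run a b i)) s) ^ Suc s"
proof (rule bipartite_power_comm)
  fix i j assume "1 \<le> i" "i + 1 < j" "j \<le> s"
  then show "br (run a b i) * br (run a b j) = br (run a b j) * br (run a b i)"
    using run_far by (auto intro!: br_comm_far_words)
next
  fix i assume "1 \<le> i" "i \<le> s"
  then show "lin_prod (\<lambda>i. br (run a b i)) s ^ Suc s * br (run a b i) = br (run a b i) * lin_prod (\<lambda>i. br (run a b i)) s ^ Suc s"
    unfolding lin_prod_run using c_power_comm_run by simp
qed

end

section \<open>Longest words and the motion of the nodes\<close>

lemma longest_word_braid_eq: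
  assumes "longest_word J u" "u \<approx> v"
  shows "longest_word J v"
  using assms braid_eq_set[OF assms(2)] act_braid_eq[OF assms(2)] braid_eq_length[OF assms(2)]
  by (simp add: longest_word_def reduced_def ninv_def)

text \<open>The word \<open>u\<close> moves strands only within the blocks of its own letters, and
  \<open>v\<close> is increasing on each block, so no ascent met while \<open>u\<close> is built up
  letter by letter is destroyed by \<open>v\<close>.\<close>

lemma reduced_append:
  assumes "reduced u" "reduced v" "\<And>i. i \<in> set u \<Longrightarrow> act v i < act v (Suc i)"
  shows "reduced (u @ v)"
proof -
  let ?J = "set u"
  have "reduced (w @ v)" if "reduced w" "set w \<subseteq> ?J" for w
    using that
  proof (induction w)
    case (Cons i w)
    then have w: "reduced w" "act w i < act w (Suc i)" by (auto simp: reduced_Cons)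
    \<comment> \<open>\<open>w\<close> moves no strand across a gap outside \<open>?J\<close>, so
      such a gap between the two strands would be the gap \<open>i\<close> itself.\<close>
    have block: "{act w i..<act w (Suc i)} \<subseteq> ?J"
    proof (rule subsetI, rule ccontr)
      fix l assume l: "l \<in> {act w i..<act w (Suc i)}" "l \<notin> ?J"
      then have lw: "l \<notin> set w" using Cons.prems(2) by auto
      have "i \<le> l" using act_separated(2)[OF lw, of i] l(1) by (meson atLeastLessThan_iff not_le)
      moreover have "l < Suc i" using act_separated(1)[OF lw, of "Suc i"] l(1) by (meson atLeastLessThan_iff not_le)
      ultimately have "l = i" by simp
      then show False using l(2) Cons.prems(2) by simp
    qed
    have "act v x < act v y" if "x < y" "{x..<y} \<subseteq> ?J" for x y
      using that
    proof (induction y)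
      case (Suc y)
      then have "y \<in> {x..<Suc y}" by simp
      then have y: "act v y < act v (Suc y)" using Suc.prems(2) assms(3) by blast
      show ?case
      proof (cases "x = y")
        case False
        then have "x < y" "{x..<y} \<subseteq> ?J" using Suc.prems by auto
        then show ?thesis using Suc.IH y by simp
      qed (use y in simp)
    qed simp
    then have "act (w @ v) i < act (w @ v) (Suc i)" using w(2) block by simp
    then show ?case using Cons w(1) by (auto simp: reduced_Cons)
  qed (use assms(2) in simp)
  then show ?thesis using assms(1) by blast
qed

lemma longest_word_union:
  assumes u: "longest_word J u" and v: "longest_word J' v" and far: "\<And>i j. i \<in> J \<Longrightarrow> j \<in> J' \<Longrightarrow> far i j"
  shows "longest_word (J \<union> J') (u @ v)"
proof -
  \<comment> \<open>Far letters move disjoint sets of positions.\<close>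
  have fix_J: "act u j = j \<and> act u (Suc j) = Suc j" if "j \<in> J'" for j
  proof -
    have "j \<notin> J" "j - 1 \<notin> J" "Suc j \<notin> J" using far[of j j] far[of "j - 1" j] far[of "Suc j" j] that
      by (auto simp: far_def)
    then show ?thesis using u by (auto simp: longest_word_def intro!: act_fixed)
  qed
  have up: "act v i < act v (Suc i)" if "i \<in> J" for i
  proof -
    have "i \<notin> set v" using far[OF that] v far_irrefl by (auto simp: longest_word_def)
    then show ?thesis using act_separated(1)[of i v i] act_separated(2)[of i v "Suc i"] by simp
  qed
  have "reduced (u @ v)" using u v up by (intro reduced_append) (auto simp: longest_word_def)
  moreover have "act (u @ v) (Suc j) < act (u @ v) j" if "j \<in> J" for j
  proof (rule ccontr)
    let ?y = "act u (Suc j)" and ?x = "act u j"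
    assume "\<not> act (u @ v) (Suc j) < act (u @ v) j"
    moreover have "?y < ?x" using u that by (simp add: longest_word_def)
    ultimately have "(?y, ?x) \<in> invs (act v)"
      using act_neq_Suc[of "u @ v" j] by (auto simp: invs_def)
    then have "?y \<in> J'" using invs_longest_word[OF v] by auto
    then have "act u ?y = ?y" using fix_J by simp
    then have "Suc j = ?y" by simp
    then have "Suc j \<in> J'" using \<open>?y \<in> J'\<close> by simp
    then show False using far[OF that, of "Suc j"] by (auto simp: far_def)
  qed
  moreover have "act (u @ v) (Suc j) < act (u @ v) j" if "j \<in> J'" for j
    using fix_J[OF that] v that by (simp add: longest_word_def)
  ultimately show ?thesis using u v by (auto simp: longest_word_def)
qed

lemma longest_word_Nil: "longest_word {} []"
  by (simp add: longest_word_def)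

lemma longest_word_singleton: "longest_word {i} [i]"
  by (simp add: longest_word_def reduced_Cons)

lemma longest_word_filter:
  assumes "\<And>i j. P i \<Longrightarrow> P j \<Longrightarrow> i \<noteq> j \<Longrightarrow> far i j"
  shows "longest_word {i. a \<le> i \<and> i < b \<and> P i} (filter P [a..<b])"
proof (induction b)
  case 0
  then show ?case using longest_word_Nil by simp
next
  case (Suc b)
  show ?case
  proof (cases "a \<le> b \<and> P b")
    case True
    have "longest_word ({i. a \<le> i \<and> i < b \<and> P i} \<union> {b}) (filter P [a..<b] @ [b])"
      using True assms by (intro longest_word_union[OF Suc longest_word_singleton]) auto
    moreover have "{i. a \<le> i \<and> i < b \<and> P i} \<union> {b} = {i. a \<le> i \<and> i < Suc b \<and> P i}"
      using True by auto
    ultimately show ?thesis using True by (simp add: upt_Suc_append)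
  next
    case False
    then have "{i. a \<le> i \<and> i < b \<and> P i} = {i. a \<le> i \<and> i < Suc b \<and> P i}"
      by (auto simp: less_Suc_eq)
    moreover have "filter P [a..<b] = filter P [a..<Suc b]"
      using False by (cases "a \<le> b") (auto simp: upt_Suc_append upt_Suc)
    ultimately show ?thesis using Suc by simp
  qed
qed

section \<open>Strands under runs and under the reversal of an interval\<close>

lemma act_asc: "a \<le> b \<Longrightarrow> act (asc a b) x = (if x = a then Suc b else if a < x \<and> x \<le> Suc b then x - 1 else x)"
proof (induction "b - a" arbitrary: a x)
  case 0
  then show ?case by (auto simp: asc_def upt_conv_Cons sw_def)
next
  case (Suc d)
  then have "asc a b = a # asc (Suc a) b" by (simp add: asc_def upt_conv_Cons)
  then show ?case using Suc(1)[of "Suc a" "sw a x"] Suc(2,3) by (auto simp: sw_def)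
qed

lemma act_rev_upt: "a \<le> b \<Longrightarrow> act (rev [a..<b]) x = (if x = b then a else if a \<le> x \<and> x < b then Suc x else x)"
proof (induction b arbitrary: x)
  case (Suc b)
  show ?case
  proof (cases "a = Suc b")
    case False
    then have "rev [a..<Suc b] = b # rev [a..<b]" using Suc.prems by (simp add: upt_Suc_append)
    then show ?thesis using Suc.IH[of "sw b x"] Suc.prems False by (auto simp: sw_def)
  qed auto
qed auto

lemma act_run_mid: "a \<le> b \<Longrightarrow> act (run a b a) x = (if x = a then Suc b else if x = Suc b then a else x)"
  by (auto simp: run_def act_asc act_rev_upt)

lemma reduced_rev_upt: "reduced (rev [a..<b])"
proof (induction b)
  case (Suc b)
  show ?case
  proof (cases "a \<le> b")
    case True
    then show ?thesis using Suc by (simp add: upt_Suc_append reduced_Cons act_rev_upt)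
  qed (simp add: upt_Suc)
qed simp

lemma reduced_run_mid:
  assumes "a \<le> b"
  shows "reduced (run a b a)"
proof -
  have "reduced (asc l b @ rev [a..<b])" if "a \<le> l" "l \<le> b" for l
    using that
  proof (induction "b - l" arbitrary: l)
    case 0
    then show ?case using reduced_rev_upt by (simp add: asc_def upt_conv_Cons reduced_Cons act_rev_upt)
  next
    case (Suc d)
    then have "asc l b = l # asc (Suc l) b" by (simp add: asc_def upt_conv_Cons)
    then show ?case using Suc(1)[of "Suc l"] Suc(2-) by (simp add: reduced_Cons act_asc act_rev_upt)
  qed
  then show ?thesis using assms by (simp add: run_def)
qed

text \<open>The longest word of \<open>[a, b]\<close>, peeled off from the outside: reversing \<open>a, \<dots>, b + 1\<close> means
  reversing the interior strands and exchanging the two outer ones.\<close>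

function rev_word :: "nat \<Rightarrow> nat \<Rightarrow> nat list" where
  "rev_word a b = (if b < a then [] else rev_word (Suc a) (b - 1) @ run a b a)"
  by auto
termination by (relation "measure (\<lambda>(a, b). Suc b - a)") auto

declare rev_word.simps [simp del]

lemma rev_word_empty: "b < a \<Longrightarrow> rev_word a b = []"
  by (simp add: rev_word.simps)

lemma rev_word_step: "a \<le> b \<Longrightarrow> rev_word a b = rev_word (Suc a) (b - 1) @ run a b a"
  by (subst rev_word.simps) simp

lemma longest_word_rev_word: "1 \<le> a \<Longrightarrow> longest_word {a..b} (rev_word a b)"
proof (induction a b rule: rev_word.induct)
  case (1 a b)
  show ?case
  proof (cases "b < a")
    case True
    then show ?thesis using longest_word_Nil by (simp add: rev_word_empty)
  next
    case False
    then have ab: "a \<le> b" by simp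
    let ?d = "rev_word (Suc a) (b - 1)"
    have d: "longest_word {Suc a..b - 1} ?d" using 1 False by simp
    have actd: "act ?d x = (if Suc a \<le> x \<and> x \<le> b then a + Suc b - x else x)" for x
    proof (cases "Suc a \<le> x \<and> x \<le> b")
      case True
      have "act ?d x = Suc a + b - x"
        using True by (intro act_longest_word[OF d]) auto
      then show ?thesis using True by simp
    next
      case False
      then have "x \<notin> set ?d" "x = 0 \<or> x - 1 \<notin> set ?d" unfolding set_longest_word[OF d] using ab by auto
      then have "act ?d x = x" by (rule act_fixed)
      then show ?thesis unfolding if_not_P[OF False] .
    qed
    \<comment> \<open>The run fixes the positions \<open>a + 1, ..., b\<close>, hence ascends at
      every letter of \<open>?d\<close>.\<close>
    have "reduced (?d @ run a b a)"
    proof (rule reduced_append)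
      show "reduced ?d" using d by (simp add: longest_word_def)
      show "reduced (run a b a)" using ab by (rule reduced_run_mid)
      fix i assume "i \<in> set ?d"
      then have "Suc a \<le> i" "i \<le> b - 1" using set_longest_word[OF d] by auto
      then show "act (run a b a) i < act (run a b a) (Suc i)" using ab by (auto simp: act_run_mid)
    qed
    moreover have "act (?d @ run a b a) (Suc j) < act (?d @ run a b a) j" if "j \<in> {a..b}" for j
      using that ab by (auto simp: actd act_run_mid)
    moreover have "set (?d @ run a b a) \<subseteq> {a..b}"
      using set_longest_word[OF d] ab by (auto simp: run_def asc_def)
    ultimately show ?thesis using ab by (simp add: longest_word_def rev_word_step)
  qed
qed

lemma length_run_mid: "a \<le> b \<Longrightarrow> length (run a b a) = 2 * (b - a) + 1"
  by (simp add: run_def asc_def)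

text \<open>Doubled, to keep the triangular number free of division.\<close>

lemma length_rev_word: "1 \<le> a \<Longrightarrow> 2 * length (rev_word a b) = (Suc b - a) * (Suc (Suc b) - a)"
proof (induction a b rule: rev_word.induct)
  case (1 a b)
  show ?case
  proof (cases "b < a")
    case True
    then show ?thesis by (cases "Suc b = a") (auto simp: rev_word_empty)
  next
    case False
    then obtain d where d: "b = a + d" using le_Suc_ex not_less by blast
    have l: "2 * length (rev_word (Suc a) (b - 1)) = (Suc (b - 1) - Suc a) * (Suc (Suc (b - 1)) - Suc a)"
      using 1 False by simp
    have "2 * length (rev_word (Suc a) (b - 1)) = (d - 1) * d"
      using l 1(2) d by (cases d) (auto simp: Suc_diff_le)
    then have "2 * length (rev_word a b) = (d - 1) * d + 2 * (2 * d + 1)"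
      using False d length_run_mid[of a b] by (simp add: rev_word_step)
    also have "\<dots> = (Suc b - a) * (Suc (Suc b) - a)" using d by (cases d) (auto simp: algebra_simps)
    finally show ?thesis .
  qed
qed

primrec par_word :: "nat \<Rightarrow> nat \<Rightarrow> nat \<Rightarrow> nat \<Rightarrow> nat list" where
  "par_word q a b 0 = []"
| "par_word q a b (Suc j) = (if even (Suc j + q) then par_word q a b j @ run a b (Suc j) else par_word q a b j)"

lemma br_par_word: "br (par_word q a b j) = par_prod q (\<lambda>i. br (run a b i)) j"
  by (induction j) (auto simp: br_append br_Nil)

lemma par_word_cong: "even (q + q') \<Longrightarrow> par_word q a b j = par_word q' a b j"
  by (induction j) auto

lemma par_word_below: "j < a \<Longrightarrow> par_word q a b j = filter (\<lambda>i. even (i + q)) [1..<Suc j]"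
  by (induction j) (auto simp: run_def upt_Suc_append)

text \<open>The letter \<open>i > b\<close> is the run with index \<open>i - (b - a)\<close>; this
  explains the parity of \<open>i + a + b + q\<close>.\<close>

lemma par_word_above:
  assumes "1 \<le> a" "a \<le> b"
  shows "par_word q a b (a + j) = filter (\<lambda>i. even (i + q)) [1..<a] @ (if even (a + q) then run a b a else []) @
    filter (\<lambda>i. even (i + a + b + q)) [Suc b..<Suc (b + j)]"
proof (induction j)
  case 0
  obtain a' where a': "a = Suc a'" using assms by (cases a) auto
  then show ?case using par_word_below[of a' a q b] by auto
next
  case (Suc j)
  have r: "run a b (Suc (a + j)) = [Suc (b + j)]" using assms by (simp add: run_def)
  define P where "P = (\<lambda>i. even (i + a + b + q))"
  have P: "even (Suc (a + j) + q) \<longleftrightarrow> P (Suc (b + j))" unfolding P_def by presburger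
  have "[Suc b..<Suc (b + Suc j)] = [Suc b..<Suc (b + j)] @ [Suc (b + j)]" by (simp add: upt_Suc_append)
  then show ?case
    using Suc by (cases "P (Suc (b + j))") (simp_all only: add_Suc_right par_word.simps P r P_def[symmetric] filter_append filter.simps if_True if_False append_assoc append_Nil2)
qed

lemma far_of_parity: "even (i + j) \<Longrightarrow> i \<noteq> j \<Longrightarrow> far i j"
  unfolding far_def by presburger

lemma far_below: "even (i + a) \<Longrightarrow> i < a \<Longrightarrow> a \<le> j \<Longrightarrow> far j i"
  unfolding far_def by presburger

lemma far_above: "even (j + b) \<Longrightarrow> b < j \<Longrightarrow> i \<le> b \<Longrightarrow> far i j"
  unfolding far_def by presburger

lemma set_run_mid: "a \<le> b \<Longrightarrow> set (run a b a) = {a..b}"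
  by (auto simp: run_def asc_def)

text \<open>The thick run belongs to the factor with \<open>q + a\<close> even; there the reversal
  of the interior completes it to the longest element of \<open>[a, b]\<close>.\<close>

definition full_word :: "nat \<Rightarrow> nat \<Rightarrow> nat \<Rightarrow> nat \<Rightarrow> nat list" where
  "full_word q a b s = (if even (q + a) then rev_word (Suc a) (b - 1) else []) @ par_word q a b s"

text \<open>For \<open>K = [a, b]\<close> this is the union of \<open>K\<close> and
  \<open>I'(K)\<close>, and \<open>odd_side\<close> is \<open>I''(K)\<close>; see
  \<open>orth_partition_iff\<close>.\<close>

definition even_side :: "nat \<Rightarrow> nat \<Rightarrow> nat \<Rightarrow> nat set" where
  "even_side n a b = {a..b} \<union> {i. 1 \<le> i \<and> i < a \<and> even (i + a)} \<union> {i. Suc b \<le> i \<and> i < Suc n \<and> even (i + b)}"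

definition odd_side :: "nat \<Rightarrow> nat \<Rightarrow> nat \<Rightarrow> nat set" where
  "odd_side n a b = {i. 1 \<le> i \<and> i < a \<and> odd (i + a)} \<union> {i. Suc b \<le> i \<and> i < Suc n \<and> odd (i + b)}"

lemma longest_word_even_side:
  assumes "1 \<le> a" "a \<le> b" "b \<le> n"
  shows "longest_word (even_side n a b) (full_word a a b (n - (b - a)))"
proof -
  let ?d = "rev_word (Suc a) (b - 1)" and ?f = "filter (\<lambda>i. even (i + a)) [1..<a]"
    and ?g = "filter (\<lambda>i. even (i + b)) [Suc b..<Suc n]" and ?z = "run a b a"
  have s: "n - (b - a) = a + (n - b)" using assms by simp
  have "filter (\<lambda>i. even (i + a + b + a)) [Suc b..<Suc n] = ?g" by (rule filter_cong) auto
  then have w: "full_word a a b (n - (b - a)) = ?d @ ?f @ ?z @ ?g"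
    unfolding s using par_word_above[OF assms(1,2), of a "n - b"] assms by (simp add: full_word_def del: even_add)
  let ?A = "{i. 1 \<le> i \<and> i < a \<and> even (i + a)}" and ?B = "{i. Suc b \<le> i \<and> i < Suc n \<and> even (i + b)}"
  have "longest_word (?A \<union> ?B) (?f @ ?g)"
  proof (intro longest_word_union longest_word_filter)
    fix i j assume "i \<in> ?A" "j \<in> ?B"
    then show "far i j" using assms by (auto simp: far_def)
  qed (auto intro: far_of_parity)
  then have "longest_word ({a..b} \<union> (?A \<union> ?B)) (rev_word a b @ ?f @ ?g)"
    using assms far_below[of _ a] far_above[of _ b]
    by (intro longest_word_union[of "{a..b}"] longest_word_rev_word) auto
  then have 1: "longest_word (even_side n a b) (rev_word a b @ ?f @ ?g)" by (simp add: even_side_def Un_assoc)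
  \<comment> \<open>\<open>full_word\<close> lists the letters below \<open>a\<close> between the
    two parts of \<open>rev_word a b\<close>; they commute with the run.\<close>
  have "br ?z * br ?f = br ?f * br ?z"
    using assms far_below[of _ a] by (intro br_comm_far_words) (auto simp: set_run_mid)
  then have "?z @ ?f \<approx> ?f @ ?z" by (simp add: br_append[symmetric] br_eq_iff)
  then have "?d @ (?z @ ?f) @ ?g \<approx> ?d @ (?f @ ?z) @ ?g" by (rule braid_eq_context)
  then have "rev_word a b @ ?f @ ?g \<approx> full_word a a b (n - (b - a))"
    unfolding w by (simp only: rev_word_step[OF assms(2)] append_assoc)
  then show ?thesis using 1 longest_word_braid_eq by blast
qed

lemma longest_word_odd_side:
  assumes "1 \<le> a" "a \<le> b" "b \<le> n"
  shows "longest_word (odd_side n a b) (full_word (Suc a) a b (n - (b - a)))"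
proof -
  let ?f = "filter (\<lambda>i. odd (i + a)) [1..<a]" and ?g = "filter (\<lambda>i. odd (i + b)) [Suc b..<Suc n]"
  have s: "n - (b - a) = a + (n - b)" using assms by simp
  have "filter (\<lambda>i. even (i + a + b + Suc a)) [Suc b..<Suc n] = ?g"
    "filter (\<lambda>i. even (i + Suc a)) [1..<a] = ?f" by (rule filter_cong, auto)+
  then have w: "full_word (Suc a) a b (n - (b - a)) = ?f @ ?g"
    unfolding s using par_word_above[OF assms(1,2), of "Suc a" "n - b"] assms
    by (simp add: full_word_def del: even_add even_Suc add_Suc_right) simp
  show ?thesis
    unfolding w odd_side_def
  proof (intro longest_word_union longest_word_filter)
    fix i j assume "i \<in> {i. 1 \<le> i \<and> i < a \<and> odd (i + a)}" "j \<in> {i. Suc b \<le> i \<and> i < Suc n \<and> odd (i + b)}"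
    then show "far i j" using assms by (auto simp: far_def)
  qed (auto intro: far_of_parity)
qed

text \<open>The end points of the runs, i.e. the positions outside the interior \<open>a + 1, \<dots>, b\<close>.\<close>

definition node :: "nat \<Rightarrow> nat \<Rightarrow> nat \<Rightarrow> nat" where
  "node a b i = (if i < a then Suc i else Suc i + (b - a))"

lemma node_eq_iff [simp]: "node a b i = node a b j \<longleftrightarrow> i = j"
  by (auto simp: node_def)

text \<open>Nodes count from \<open>0\<close> and runs from \<open>1\<close>, so the run
  \<open>r + 1\<close> joins the nodes \<open>r\<close> and \<open>r + 1\<close>.\<close>

lemma act_run_node: "1 \<le> a \<Longrightarrow> a \<le> b \<Longrightarrow> act (run a b (Suc r)) (node a b i) = node a b (sw r i)"
proof (cases "Suc r = a")
  case True
  assume "a \<le> b"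
  then have "act (run a b (Suc r)) x = (if x = a then Suc b else if x = Suc b then a else x)" for x
    using act_run_mid[of a b x] True by simp
  then show ?thesis using True \<open>a \<le> b\<close> by (auto simp: node_def sw_def)
next
  case False
  then have "act (run a b (Suc r)) x = sw (if Suc r < a then Suc r else Suc r + (b - a)) x" for x
    by (simp add: run_def)
  then show ?thesis using False by (auto simp: node_def sw_def)
qed

lemma act_run_inner: "a \<le> b \<Longrightarrow> 1 \<le> r \<Longrightarrow> a < x \<Longrightarrow> x \<le> b \<Longrightarrow> act (run a b r) x = x"
proof (cases "r = a")
  case True
  then show "a \<le> b \<Longrightarrow> a < x \<Longrightarrow> x \<le> b \<Longrightarrow> act (run a b r) x = x" by (simp add: act_run_mid)
qed (auto simp: sw_def run_def)

text \<open>With \<open>i + q\<close> odd the factor contains the run to the right of node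
  \<open>i\<close>, otherwise the one to its left. The inner conditional makes the strand pause at
  \<open>s\<close>, truncated subtraction at \<open>0\<close>.\<close>

definition move :: "nat \<Rightarrow> nat \<Rightarrow> nat \<Rightarrow> nat" where
  "move q s i = (if odd (i + q) then (if i < s then Suc i else i) else i - 1)"

lemma act_par_word_node:
  "1 \<le> a \<Longrightarrow> a \<le> b \<Longrightarrow> act (par_word q a b j) (node a b i) =
    node a b (if odd (i + q) then (if i < j then Suc i else i) else if i \<le> j then i - 1 else i)"
proof (induction j)
  case (Suc j)
  let ?F = "\<lambda>j. if odd (i + q) then (if i < j then Suc i else i) else if i \<le> j then i - 1 else i"
  have IH: "act (par_word q a b j) (node a b i) = node a b (?F j)" using Suc by simp
  show ?case
  proof (cases "even (Suc j + q)")
    case True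
    have "sw j (?F j) = ?F (Suc j)"
      unfolding sw_def using True
      by (cases "odd (i + q)"; cases "i < j"; cases "i = j"; cases "i = Suc j") (simp_all, presburger+)
    moreover have "act (par_word q a b (Suc j)) (node a b i) = node a b (sw j (?F j))"
      using True IH act_run_node[OF Suc.prems, of j] by (simp only: par_word.simps if_True act_append)
    ultimately show ?thesis by simp
  next
    case False
    then have "?F j = ?F (Suc j)"
      by (cases "odd (i + q)"; cases "i < j"; cases "i = j"; cases "i = Suc j") simp_all
    then show ?thesis using IH False by (simp only: par_word.simps if_False)
  qed
qed simp

lemma act_par_word_inner:
  "a \<le> b \<Longrightarrow> a < x \<Longrightarrow> x \<le> b \<Longrightarrow> act (par_word q a b j) x = x"
  by (induction j) (auto simp: act_run_inner)

lemma act_rev_word_node: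
  assumes "1 \<le> a"
  shows "act (rev_word (Suc a) (b - 1)) (node a b i) = node a b i"
proof -
  let ?u = "rev_word (Suc a) (b - 1)"
  have S: "set ?u = {Suc a..b - 1}" using longest_word_rev_word[of "Suc a" "b - 1"] set_longest_word by simp
  show ?thesis by (rule act_fixed) (auto simp: S node_def)
qed

lemma act_rev_word_inner:
  assumes "a < x" "x \<le> b"
  shows "a < act (rev_word (Suc a) (b - 1)) x \<and> act (rev_word (Suc a) (b - 1)) x \<le> b"
proof -
  let ?u = "rev_word (Suc a) (b - 1)"
  have S: "set ?u = {Suc a..b - 1}" using longest_word_rev_word[of "Suc a" "b - 1"] set_longest_word by simp
  have "a \<notin> set ?u" "b \<notin> set ?u" using assms unfolding S by auto
  then show ?thesis using act_separated(2)[of a ?u x] act_separated(1)[of b ?u x] assms by simp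
qed

lemma act_full_word_node:
  "1 \<le> a \<Longrightarrow> a \<le> b \<Longrightarrow> i \<le> s \<Longrightarrow> act (full_word q a b s) (node a b i) = node a b (move q s i)"
  by (auto simp: full_word_def act_rev_word_node act_par_word_node move_def)

lemma act_full_word_inner:
  "a \<le> b \<Longrightarrow> a < x \<Longrightarrow> x \<le> b \<Longrightarrow> a < act (full_word q a b s) x \<and> act (full_word q a b s) x \<le> b"
  using act_rev_word_inner[of a x b] by (auto simp: full_word_def act_par_word_inner)

definition alt_word :: "nat \<Rightarrow> nat list \<Rightarrow> nat list \<Rightarrow> nat list" where
  "alt_word k u v = concat (alternating k u v)"

lemma alt_word_simps [simp]:
  "alt_word 0 u v = []" "alt_word (Suc k) u v = u @ alt_word k v u"
  by (simp_all add: alt_word_def)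

text \<open>A strand starting at node \<open>i\<close> walks along \<open>0, \<dots>, s\<close>, pausing for one step at either end;
  \<open>bounce s t\<close> is its position after \<open>t\<close> steps if it starts at \<open>0\<close> and walks right.\<close>

definition bounce :: "nat \<Rightarrow> nat \<Rightarrow> nat" where
  "bounce s t = (if t \<le> s then t else 2 * s + 1 - t)"

text \<open>Each step changes \<open>q\<close> by one and, away from the ends, also the node, so the
  parity of \<open>i + q\<close> and with it the direction persists; a pause flips the parity and
  turns the strand round. A strand walking right is in phase \<open>i\<close> of the walk of period
  \<open>2 * s + 2\<close>; one walking left enters at phase \<open>0\<close> after
  \<open>i + 1\<close> steps.\<close>

lemma act_alt_word_node:
  assumes W: "\<And>q i. i \<le> s \<Longrightarrow> act (W q) (p i) = p (move q s i)" and WW: "\<And>q. W (Suc (Suc q)) = W q"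
  shows "k \<le> 2 * s + 1 \<Longrightarrow> i \<le> s \<Longrightarrow> act (alt_word k (W q) (W (Suc q))) (p i) =
    p (if odd (i + q) then (if i + k \<le> 2 * s + 1 then bounce s (i + k) else bounce s (i + k - (2 * s + 2)))
       else (if k \<le> i then i - k else bounce s (k - i - 1)))"
proof (induction k arbitrary: i q)
  case 0
  then show ?case by (auto simp: bounce_def)
next
  case (Suc k)
  have "act (alt_word (Suc k) (W q) (W (Suc q))) (p i) = act (alt_word k (W (Suc q)) (W (Suc (Suc q)))) (p (move q s i))"
    using W Suc.prems by (simp add: WW)
  also have "\<dots> = p (if odd (i + q) then (if i + Suc k \<le> 2 * s + 1 then bounce s (i + Suc k) else bounce s (i + Suc k - (2 * s + 2)))
       else (if Suc k \<le> i then i - Suc k else bounce s (Suc k - i - 1)))"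
  proof (cases "odd (i + q)")
    case True
    show ?thesis
    proof (cases "i < s")
      case True
      then show ?thesis using Suc.IH[of "Suc i" "Suc q"] \<open>odd (i + q)\<close> Suc.prems by (simp add: move_def)
    next
      case False
      then have "i = s" using Suc.prems by simp
      then show ?thesis using Suc.IH[of i "Suc q"] \<open>odd (i + q)\<close> Suc.prems
        by (auto simp: move_def bounce_def Suc_eq_plus1[symmetric] simp del: Suc_eq_plus1)
    qed
  next
    case False
    show ?thesis
    proof (cases "i = 0")
      case True
      then show ?thesis using Suc.IH[of i "Suc q"] False Suc.prems by (auto simp: move_def plus_1_eq_Suc)
    next
      case False
      then show ?thesis using Suc.IH[of "i - 1" "Suc q"] \<open>\<not> odd (i + q)\<close> Suc.prems
        by (auto simp: move_def plus_1_eq_Suc)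
    qed
  qed
  finally show ?case .
qed

section \<open>Coincidences of alternating products\<close>

lemma ex_left_divisor:
  assumes "reduced u" "act u (Suc i) < act u i"
  shows "\<exists>z. u \<approx> i # z"
proof -
  obtain z where z: "act z = act (i # u)" "reduced z" using ex_reduced by blast
  have n: "ninv u = Suc (ninv (i # u))" using assms(2) by (rule ninv_Cons_descent)
  have "ninv z = ninv (i # u)" unfolding ninv_def z(1) ..
  then have l: "length (i # z) = length u" using n z(2) assms(1) by (simp add: reduced_def)
  have a: "act (i # z) = act u" using z(1) by (simp add: fun_eq_iff)
  have "u \<approx> i # z" by (rule matsumoto[OF assms(1) reduced_of_act_eq[OF assms(1) a l] a[symmetric]])
  then show ?thesis ..
qed

text \<open>Letters of \<open>J\<close> divide the product that begins with \<open>u\<close>, those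
  of \<open>L\<close> the one that begins with \<open>v\<close>, and the two products agree.\<close>

lemma alt_word_left_divisor:
  assumes u: "longest_word J u" and v: "longest_word L v" and eq: "alt_word k u v \<approx> alt_word k v u"
    and k: "0 < k" and i: "i \<in> J \<union> L"
  shows "\<exists>z. alt_word k u v \<approx> i # z"
proof -
  obtain k' where k': "k = Suc k'" using k by (cases k) auto
  have div: "\<exists>z. alt_word k w w' \<approx> i # z" if "longest_word S w" "i \<in> S" for S w w'
  proof -
    have "reduced w" "act w (Suc i) < act w i" using that by (auto simp: longest_word_def)
    then obtain z where "w \<approx> i # z" using ex_left_divisor by blast
    then have "w @ alt_word k' w' w \<approx> (i # z) @ alt_word k' w' w" by (intro braid_eq_append) auto
    then show ?thesis using k' by auto
  qed
  from i show ?thesis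
  proof
    assume "i \<in> J"
    then show ?thesis by (rule div[OF u])
  next
    assume "i \<in> L"
    then obtain z where "alt_word k v u \<approx> i # z" using div[OF v] by blast
    then show ?thesis using eq braid_eq_trans by blast
  qed
qed

definition component :: "nat set \<Rightarrow> nat \<Rightarrow> nat \<Rightarrow> bool" where
  "component S a b \<longleftrightarrow> 1 \<le> a \<and> a \<le> b \<and> {a..b} \<subseteq> S \<and> a - 1 \<notin> S \<and> Suc b \<notin> S"

text \<open>The interior strands of two components never leave them and hence never meet, whereas all
  strands cross in a braid which every generator divides.\<close>

lemma at_most_one_big_component:
  assumes u: "longest_word J u" and v: "longest_word L v" and eq: "alt_word k u v \<approx> alt_word k v u"
    and k: "0 < k" and JL: "J \<union> L = {1..n}" "J \<inter> L = {}"
    and c1: "component J a\<^sub>1 b\<^sub>1 \<or> component L a\<^sub>1 b\<^sub>1" "a\<^sub>1 < b\<^sub>1"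
    and c2: "component J a\<^sub>2 b\<^sub>2 \<or> component L a\<^sub>2 b\<^sub>2" "a\<^sub>2 < b\<^sub>2"
    and less: "b\<^sub>1 < a\<^sub>2"
  shows False
proof -
  have inner: "a < act w x \<and> act w x \<le> b"
    if w: "longest_word S w" and S: "S = J \<or> S = L" and c: "component J a b \<or> component L a b"
      and x: "a < x" "x \<le> b" for S w a b x
  proof (cases "component S a b")
    case True
    then have "act w x = a + Suc b - x"
      using x by (intro act_longest_word[OF w]) (auto simp: component_def)
    then show ?thesis using x by auto
  next
    case False
    then have "{a..b} \<inter> S = {}" using c S JL(2) by (auto simp: component_def)
    moreover have "x \<in> {a..b}" "x - 1 \<in> {a..b}" using x by auto
    ultimately have "x \<notin> set w" "x - 1 \<notin> set w" using set_longest_word[OF w] by blast+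
    then show ?thesis using x by (simp add: act_fixed)
  qed
  have apart: "\<not> cross w x y"
    if w: "longest_word S w" and S: "S = J \<or> S = L" and x: "a\<^sub>1 < x" "x \<le> b\<^sub>1" and y: "a\<^sub>2 < y" "y \<le> b\<^sub>2"
    for S w x y
  proof (cases "component S a\<^sub>1 b\<^sub>1")
    case True
    then have "Suc b\<^sub>1 \<notin> set w" using set_longest_word[OF w] by (simp add: component_def)
    then show ?thesis using x y less by (intro not_cross_separated[of "Suc b\<^sub>1"]) auto
  next
    case False
    then have "{a\<^sub>1..b\<^sub>1} \<inter> S = {}" using c1 S JL(2) by (auto simp: component_def)
    moreover have "x \<in> {a\<^sub>1..b\<^sub>1}" using x by auto
    ultimately have "x \<notin> set w" using set_longest_word[OF w] by blast
    then show ?thesis using x y less by (intro not_cross_separated[of x]) auto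
  qed
  have "\<not> cross (alt_word j w w') x y"
    if "longest_word S w" "S = J \<or> S = L" "longest_word S' w'" "S' = J \<or> S' = L"
      "a\<^sub>1 < x" "x \<le> b\<^sub>1" "a\<^sub>2 < y" "y \<le> b\<^sub>2" for j S w S' w' x y
    using that
  proof (induction j arbitrary: S S' w w' x y)
    case (Suc j)
    have "\<not> cross (alt_word j w' w) (act w x) (act w y)"
      using inner[OF Suc.prems(1,2) c1(1)] inner[OF Suc.prems(1,2) c2(1)] Suc.prems
      by (intro Suc.IH[OF Suc.prems(3,4,1,2)]) auto
    then show ?case using apart[OF Suc.prems(1,2)] Suc.prems by (simp add: cross_append)
  qed simp
  then have "\<not> cross (alt_word k u v) b\<^sub>1 b\<^sub>2" using u v c1 c2 by blast
  \<comment> \<open>The last interior strand of each block serves as witness.\<close>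
  moreover have "cross (alt_word k u v) b\<^sub>1 b\<^sub>2"
  proof (rule cross_of_left_divisors)
    show "b\<^sub>1 < b\<^sub>2" using less c2 by simp
    fix i assume i: "b\<^sub>1 \<le> i" "i < b\<^sub>2"
    have "{a\<^sub>2..b\<^sub>2} \<subseteq> {1..n}" using c2(1) unfolding JL(1)[symmetric] component_def by blast
    then have "b\<^sub>2 \<le> n" using c2(2) by auto
    moreover have "1 \<le> b\<^sub>1" using c1 by (auto simp: component_def)
    ultimately have "i \<in> J \<union> L" using i JL(1) by auto
    then show "\<exists>z. alt_word k u v \<approx> i # z" by (rule alt_word_left_divisor[OF u v eq k])
  qed
  ultimately show False by simp
qed

text \<open>At each of the \<open>k\<close> places one product has \<open>u\<close> and the other
  \<open>v\<close>.\<close>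

lemma length_alt_word: "length (alt_word k u v) + length (alt_word k v u) = k * (length u + length v)"
  by (induction k arbitrary: u v) (auto simp: algebra_simps)

lemma set_alt_word: "set (alt_word k u v) \<subseteq> set u \<union> set v"
  by (induction k arbitrary: u v) fastforce+

primrec alt_prod :: "nat \<Rightarrow> 'a \<Rightarrow> 'a \<Rightarrow> 'a::monoid_mult" where
  "alt_prod 0 x y = 1"
| "alt_prod (Suc k) x y = x * alt_prod k y x"

lemma br_alt_word: "br (alt_word k u v) = alt_prod k (br u) (br v)"
  by (induction k arbitrary: u v) (auto simp: br_append br_Nil)

lemma alt_prod_even: "alt_prod (2 * p) x y = (x * y) ^ p"
  by (induction p) (simp_all add: mult.assoc)

lemma power_mult_comm:
  assumes "d * g = g * (d :: 'a::monoid_mult)"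
  shows "(d * g) ^ p = d ^ p * g ^ p"
proof (induction p)
  case (Suc p)
  have "(d * g) ^ Suc p = d * (g * d ^ p) * g ^ p" by (simp add: Suc mult.assoc)
  also have "g * d ^ p = d ^ p * g" using comm_power[OF assms, of p] by simp
  finally show ?case by (simp add: mult.assoc)
qed simp

text \<open>\<open>s\<close> is the number of runs, the letters of \<open>[a, b]\<close> counting as
  one. \<open>P\<close> and \<open>F\<close> are the factors without and with the interior reversal
  \<open>D\<close>.\<close>

locale runs =
  fixes n a b s :: nat
  assumes n: "2 \<le> n" and ab: "1 \<le> a" "a \<le> b" "b \<le> n" and s: "s = n - (b - a)"
begin

abbreviation P :: "nat \<Rightarrow> nat list" where "P q \<equiv> par_word q a b s"
abbreviation F :: "nat \<Rightarrow> nat list" where "F q \<equiv> full_word q a b s"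
abbreviation D :: "nat list" where "D \<equiv> rev_word (Suc a) (b - 1)"
abbreviation p :: "nat \<Rightarrow> nat" where "p i \<equiv> node a b i"

lemma F_Suc_Suc: "F (Suc (Suc q)) = F q"
  using par_word_cong[of "Suc (Suc q)" q] by (simp add: full_word_def)

lemma P_Suc_Suc: "P (Suc (Suc q)) = P q"
  using par_word_cong[of "Suc (Suc q)" q] by simp

lemma F_cong: "even (q + q') \<Longrightarrow> F q = F q'"
  using par_word_cong[of q q'] by (auto simp: full_word_def)

lemma longest_F: "longest_word (even_side n a b) (F a)" "longest_word (odd_side n a b) (F (Suc a))"
  using longest_word_even_side longest_word_odd_side ab by (simp_all add: s)

lemma set_F: "set (F q) = (if even (q + a) then even_side n a b else odd_side n a b)"
proof (cases "even (q + a)")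
  case True
  then show ?thesis using F_cong[of q a] set_longest_word[OF longest_F(1)] by simp
next
  case False
  then show ?thesis using F_cong[of q "Suc a"] set_longest_word[OF longest_F(2)] by simp
qed

lemma sides: "even_side n a b \<union> odd_side n a b = {1..n}" "even_side n a b \<inter> odd_side n a b = {}"
  using ab by (auto simp: even_side_def odd_side_def)

lemma set_P: "set (P q) \<subseteq> {1..n}"
proof -
  have "set (P q) \<subseteq> set (F q)" by (auto simp: full_word_def)
  then show ?thesis using set_F[of q] sides by (auto split: if_splits)
qed

lemma set_D: "set D = {Suc a..b - 1}"
  using set_longest_word[OF longest_word_rev_word] by simp

lemma act_P_node: "i \<le> s \<Longrightarrow> act (P q) (p i) = p (move q s i)"
  using act_par_word_node[OF ab(1,2)] by (auto simp: move_def)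

lemma act_F_node: "i \<le> s \<Longrightarrow> act (F q) (p i) = p (move q s i)"
  using act_full_word_node ab by simp

text \<open>Half a period of the walk reflects the nodes.\<close>

lemma act_alt_P_node:
  assumes "i \<le> s"
  shows "act (alt_word (Suc s) (P q) (P (Suc q))) (p i) = p (s - i)"
proof -
  have "act (alt_word (Suc s) (P q) (P (Suc q))) (p i) =
    p (if odd (i + q) then (if i + Suc s \<le> 2 * s + 1 then bounce s (i + Suc s) else bounce s (i + Suc s - (2 * s + 2)))
       else (if Suc s \<le> i then i - Suc s else bounce s (Suc s - i - 1)))"
    using assms by (intro act_alt_word_node[where W = P]) (auto simp: act_P_node P_Suc_Suc)
  also have "\<dots> = p (s - i)" using assms by (auto simp: bounce_def)
  finally show ?thesis .
qed

lemma act_alt_P_inner: "a < x \<Longrightarrow> x \<le> b \<Longrightarrow> act (alt_word k (P q) (P q')) x = x"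
  by (induction k arbitrary: q q') (auto simp: act_par_word_inner[OF ab(2)])

lemma node_cases:
  assumes "1 \<le> x" "x \<le> Suc n"
  obtains i where "i \<le> s" "x = p i" | "a < x" "x \<le> b"
proof (cases "a < x \<and> x \<le> b")
  case False
  then consider "x \<le> a" | "b < x" by linarith
  then show ?thesis
  proof cases
    case 1
    then have "x = p (x - 1)" "x - 1 \<le> s" using assms s ab by (auto simp: node_def)
    then show ?thesis using that by blast
  next
    case 2
    then have "x = p (x - 1 - (b - a))" "x - 1 - (b - a) \<le> s" using assms s ab by (auto simp: node_def)
    then show ?thesis using that by blast
  qed
qed (use that in blast)

text \<open>The alternating product reflects the nodes among themselves, and \<open>D\<close>
  reflects the interior. By \<open>sym\<close> the interior is empty or centred, so both combine to
  one reflection of all positions.\<close>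

lemma act_alt_P_D:
  assumes sym: "a = b \<or> a + b = n + 1" and x: "1 \<le> x" "x \<le> Suc n"
  shows "act (alt_word (Suc s) (P q) (P (Suc q)) @ D) x = n + 2 - x"
  using x
proof (cases rule: node_cases)
  case (1 i)
  then have "act (alt_word (Suc s) (P q) (P (Suc q)) @ D) x = p (s - i)"
    using act_alt_P_node[OF 1(1)] act_rev_word_node[OF ab(1)] by simp
  also have "\<dots> = n + 2 - x" using sym 1 s ab by (auto simp: node_def)
  finally show ?thesis .
next
  case 2
  have "act D x = Suc a + b - x"
    using 2 by (intro act_longest_word[OF longest_word_rev_word]) auto
  moreover have "act (alt_word (Suc s) (P q) (P (Suc q))) x = x" by (rule act_alt_P_inner[OF 2])
  ultimately show ?thesis using sym 2 by (auto simp del: alt_word_simps)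
qed

text \<open>Every run belongs to exactly one of the two factors, and the thick one has
  \<open>2 * (b - a) + 1\<close> letters.\<close>

lemma length_P: "length (par_word q a b j) + length (par_word (Suc q) a b j) = (if j < a then j else j + 2 * (b - a))"
proof (induction j)
  case 0
  then show ?case using ab by simp
next
  case (Suc j)
  have "length (par_word q a b (Suc j)) + length (par_word (Suc q) a b (Suc j)) =
    length (par_word q a b j) + length (par_word (Suc q) a b j) + length (run a b (Suc j))"
    by simp
  also have "\<dots> = (if Suc j < a then Suc j else Suc j + 2 * (b - a))"
    unfolding Suc using length_run_mid[OF ab(2)] by (cases "Suc j = a") (auto simp: run_def)
  finally show ?case .
qed

text \<open>Both words followed by \<open>D\<close> reverse all strands, and together they have exactly twice as many letters
  as the reversal has inversions, so both are reduced.\<close>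

lemma alt_P_eq_sym:
  assumes sym: "a = b \<or> a + b = n + 1"
  shows "alt_word (Suc s) (P q) (P (Suc q)) \<approx> alt_word (Suc s) (P (Suc q)) (P q)"
proof -
  let ?w = "\<lambda>q. alt_word (Suc s) (P q) (P (Suc q)) @ D" and ?u = "rev_word 1 n"
  have u: "longest_word {1..n} ?u" by (rule longest_word_rev_word) simp
  have wI: "set (?w q) \<subseteq> {1..n}" for q
    using set_alt_word[of "Suc s" "P q" "P (Suc q)"] set_P[of q] set_P[of "Suc q"] set_D ab by auto
  have act_w: "act (?w q) = act ?u" for q
  proof
    fix x
    show "act (?w q) x = act ?u x"
    proof (cases "1 \<le> x \<and> x \<le> Suc n")
      case True
      have "act ?u x = 1 + Suc n - x" using True by (intro act_longest_word[OF u]) auto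
      then show ?thesis using act_alt_P_D[OF sym, of x q] True by simp
    next
      case False
      then have "x \<notin> {1..n}" "x = 0 \<or> x - 1 \<notin> {1..n}" by auto
      then have "act w x = x" if "set w \<subseteq> {1..n}" for w
        using that by (intro act_fixed) blast+
      then show ?thesis using wI u by (simp add: longest_word_def)
    qed
  qed
  obtain m where m: "b = a + m" using ab le_Suc_ex by blast
  have "2 * ninv ?u = n * (n + 1)"
    using u length_rev_word[of 1 n] by (simp add: longest_word_def reduced_def algebra_simps)
  moreover have "ninv (?w q) = ninv ?u" for q unfolding ninv_def act_w ..
  ultimately have ninv_w: "2 * ninv (?w q) = n * (n + 1)" for q by simp
  have lD: "2 * length D = (m - 1) * m"
    using length_rev_word[of "Suc a" "b - 1"] m ab by (cases m) (auto simp: Suc_diff_le)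
  have "length (P q) + length (P (Suc q)) = s + 2 * m"
    using length_P[of q s] m ab s by simp
  then have "length (alt_word (Suc s) (P q) (P (Suc q))) + length (alt_word (Suc s) (P (Suc q)) (P q)) = Suc s * (s + 2 * m)"
    by (simp only: length_alt_word)
  then have "length (?w q) + length (?w (Suc q)) = Suc s * (s + 2 * m) + (m - 1) * m"
    using lD by (simp only: P_Suc_Suc length_append)
  also have "\<dots> = n * (n + 1)"
  proof -
    have "n = s + m" using s m ab by simp
    then show ?thesis by (cases m) (auto simp: algebra_simps)
  qed
  finally have "length (?w q) + length (?w (Suc q)) = n * (n + 1)" .
  then have "reduced (?w q)" "reduced (?w (Suc q))"
    using ninv_w[of q] ninv_w[of "Suc q"] ninv_le_length[of "?w q"] ninv_le_length[of "?w (Suc q)"]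
    unfolding reduced_def by linarith+
  then have "?w q \<approx> ?w (Suc q)" by (rule matsumoto) (simp only: act_w)
  then show ?thesis using braid_eq_right_cancel by (simp only: P_Suc_Suc)
qed

lemma D_comm_run: "1 \<le> i \<Longrightarrow> br D * br (run a b i) = br (run a b i) * br D"
proof (cases "i = a")
  case False
  assume "1 \<le> i"
  show ?thesis
  proof (rule br_comm_far_words)
    fix x y assume "x \<in> set D" "y \<in> set (run a b i)"
    then show "far x y" using False ab set_D by (auto simp: run_def far_def split: if_splits)
  qed
next
  case True
  \<comment> \<open>In the thick run the descending half lowers the letters of \<open>D\<close> by
    one and the ascending half raises them again; \<open>w\<close> is the lowered form.\<close>
  define w where "w = map (\<lambda>x. x - 1) D"
  have w: "map Suc w = D"
    unfolding w_def map_map comp_def using set_D by (intro map_idI) auto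
  have "set w \<subseteq> {a..<b - 1}" using set_D by (auto simp: w_def)
  moreover have "{a..<b - 1} \<subseteq> {a..<b}" by auto
  ultimately have w1: "set w \<subseteq> {a..<b - 1}" "set w \<subseteq> {a..<b}" by blast+
  have z: "br (run a b i) = br (asc a b) * br (rev (asc a (b - 1)))"
    using True ab by (simp add: run_def br_append asc_def)
  have "br (run a b i) * br D = br (asc a b) * (br (rev (asc a (b - 1))) * br (map Suc w))"
    by (simp only: z w mult.assoc)
  also have "\<dots> = (br (asc a b) * br w) * br (rev (asc a (b - 1)))"
    unfolding desc_shift[OF w1(1)] by (simp only: mult.assoc)
  also have "\<dots> = br D * br (run a b i)"
    unfolding asc_shift[OF w1(2)] w by (simp only: z mult.assoc)
  finally show ?thesis ..
qed

lemma D_comm_P: "br D * br (P q) = br (P q) * br D"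
  unfolding br_par_word by (rule par_prod_comm) (rule D_comm_run)

text \<open>Both products of length \<open>2 * r\<close> contain \<open>D\<close> exactly
  \<open>r\<close> times, and \<open>D\<close> commutes with the other factors, so its power splits
  off on both sides. An odd length would leave one \<open>D\<close> more on one side.\<close>

lemma alt_F_even:
  assumes "(br (P a) * br (P (Suc a))) ^ r = (br (P (Suc a)) * br (P a)) ^ r"
  shows "alt_word (2 * r) (F a) (F (Suc a)) \<approx> alt_word (2 * r) (F (Suc a)) (F a)"
proof -
  let ?x = "br (P a)" and ?y = "br (P (Suc a))" and ?d = "br D"
  have F: "br (F a) = ?d * ?x" "br (F (Suc a)) = ?y" by (simp_all add: full_word_def br_append)
  have 1: "?d * (?x * ?y) = (?x * ?y) * ?d" "?d * (?y * ?x) = (?y * ?x) * ?d"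
    by (intro comm_mult D_comm_P)+
  have "(?d * ?x * ?y) ^ r = ?d ^ r * (?x * ?y) ^ r"
    using power_mult_comm[OF 1(1)] by (simp only: mult.assoc)
  also have "\<dots> = (?d * (?y * ?x)) ^ r" using power_mult_comm[OF 1(2)] assms by simp
  also have "?d * (?y * ?x) = ?y * (?d * ?x)" using D_comm_P[of "Suc a"] by (simp only: mult.assoc[symmetric])
  finally have "br (alt_word (2 * r) (F a) (F (Suc a))) = br (alt_word (2 * r) (F (Suc a)) (F a))"
    by (simp only: br_alt_word alt_prod_even F)
  then show ?thesis by (simp only: br_eq_iff)
qed

text \<open>Half a period of the node walk, or a whole one. For \<open>a < b\<close> this is
  \<open>2 m(K)\<close>; if \<open>a = b\<close>, then \<open>s = n\<close> and the value is
  \<open>n + 1\<close>.\<close>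

definition min_braid :: nat where
  "min_braid = (if a = b \<or> a + b = n + 1 then Suc s else 2 * Suc s)"

lemma alt_F_min_braid: "alt_word min_braid (F a) (F (Suc a)) \<approx> alt_word min_braid (F (Suc a)) (F a)"
proof -
  consider "a = b" | "a \<noteq> b" "a + b = n + 1" | "a \<noteq> b" "a + b \<noteq> n + 1" by blast
  then show ?thesis
  proof cases
    case 1
    then have "D = []" using ab by (simp add: rev_word_empty)
    then have F: "F q = P q" for q by (simp add: full_word_def)
    have "min_braid = Suc s" unfolding min_braid_def using 1 by simp
    then show ?thesis using alt_P_eq_sym[of a] 1 F by (simp only: simp_thms)
  next
    case 2
    \<comment> \<open>In the centred case the length \<open>s + 1\<close> is even, as
      \<open>alt_F_even\<close> demands.\<close>
    then have sa: "Suc s = 2 * a" using s ab by auto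
    have "br (alt_word (2 * a) (P a) (P (Suc a))) = br (alt_word (2 * a) (P (Suc a)) (P a))"
      using alt_P_eq_sym[of a] 2 sa by (simp add: br_eq_iff)
    then have "alt_word (2 * a) (F a) (F (Suc a)) \<approx> alt_word (2 * a) (F (Suc a)) (F a)"
      by (intro alt_F_even) (simp only: br_alt_word alt_prod_even)
    then show ?thesis using 2 sa by (simp add: min_braid_def)
  next
    case 3
    interpret linear_coxeter n a b "b - a" s
      using n ab s by unfold_locales auto
    \<comment> \<open>Only the parity of \<open>a\<close> matters: one of the two factors is
      \<open>P 0\<close>, the other \<open>P 1\<close>.\<close>
    have P: "P a = P (a mod 2)" "P (Suc a) = P (1 - a mod 2)"
      by (rule par_word_cong, presburger)+
    have "(br (P 1) * br (P 0)) ^ Suc s = (br (P 0) * br (P 1)) ^ Suc s"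
      using bipartite_run_power by (simp only: br_par_word)
    then have "(br (P a) * br (P (Suc a))) ^ Suc s = (br (P (Suc a)) * br (P a)) ^ Suc s"
      unfolding P by (cases "even a") (auto simp: odd_iff_mod_2_eq_one simp del: power_Suc)
    then show ?thesis using alt_F_even[of "Suc s"] 3 by (simp only: min_braid_def) simp
  qed
qed

text \<open>The strand at node \<open>0\<close> sets off at once in one product and pauses for one
  step in the other, so after \<open>k\<close> steps its two images are one step apart on the walk.
  Within the bound they agree only at the pause at node \<open>s\<close>.\<close>

lemma alt_F_node_0:
  assumes eq: "alt_word k (F a) (F (Suc a)) \<approx> alt_word k (F (Suc a)) (F a)" and k: "0 < k" "k \<le> 2 * s + 1"
  shows "k = Suc s"
proof -
  have A: "act (alt_word k (F q) (F (Suc q))) (p 0) = p (if odd q then bounce s k else bounce s (k - 1))" for q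
  proof -
    have "act (alt_word k (F q) (F (Suc q))) (p 0) =
      p (if odd (0 + q) then (if 0 + k \<le> 2 * s + 1 then bounce s (0 + k) else bounce s (0 + k - (2 * s + 2)))
         else (if k \<le> 0 then 0 - k else bounce s (k - 0 - 1)))"
      using k by (intro act_alt_word_node[where W = F]) (auto simp: act_F_node F_Suc_Suc)
    then show ?thesis using k by simp
  qed
  have "act (alt_word k (F a) (F (Suc a))) (p 0) = act (alt_word k (F (Suc a)) (F (Suc (Suc a)))) (p 0)"
    using act_braid_eq[OF eq] by (simp only: F_Suc_Suc)
  then have "bounce s k = bounce s (k - 1)" unfolding A by (auto split: if_splits)
  then show ?thesis using k by (auto simp: bounce_def split: if_splits)
qed

text \<open>The missing letters are the walls that separate nodes from interior strands in a single
  factor.\<close>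

lemma notin_F:
  "even (q + a) \<Longrightarrow> a - 1 \<notin> set (F q)" "even (q + a) \<Longrightarrow> Suc b \<notin> set (F q)"
  "odd (q + a) \<Longrightarrow> a \<notin> set (F q)" "odd (q + a) \<Longrightarrow> b \<notin> set (F q)"
  using ab by (auto simp: set_F even_side_def odd_side_def)

text \<open>The bounds count the steps before the strand could cross the interior. Walking right, it
  may go as far as node \<open>a - 1\<close>; walking left, it has \<open>i\<close> steps to node
  \<open>0\<close>, one pause and \<open>a - 1\<close> steps back, \<open>i + a\<close> in
  all.\<close>

lemma not_cross_left:
  assumes "i \<le> a - 1" "(odd (i + q) \<and> i + k \<le> a - 1) \<or> (even (i + q) \<and> k \<le> i + a)" "a < x" "x \<le> b"
  shows "\<not> cross (alt_word k (F q) (F (Suc q))) (p i) x"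
  using assms
proof (induction k arbitrary: i q x)
  case (Suc k)
  have ile: "i \<le> s" using Suc.prems s ab by simp
  have 1: "\<not> cross (F q) (p i) x"
  proof (cases "even (q + a)")
    case True
    \<comment> \<open>A strand at node \<open>a - 1\<close> would walk right across the thick run,
      which the bound excludes.\<close>
    have "Suc i < a"
    proof (rule ccontr)
      assume "\<not> Suc i < a"
      then have "a = Suc i" using Suc.prems(1) ab by simp
      then show False using True Suc.prems(2) by auto
    qed
    then show ?thesis
      using notin_F(1)[OF True] Suc.prems by (intro not_cross_separated[of "a - 1"]) (auto simp: node_def)
  next
    case False
    then show ?thesis
      using notin_F(3)[OF False] Suc.prems ab by (intro not_cross_separated[of a]) (auto simp: node_def)
  qed
  have x': "a < act (F q) x" "act (F q) x \<le> b" using act_full_word_inner[OF ab(2)] Suc.prems by auto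
  have 2: "\<not> cross (alt_word k (F (Suc q)) (F (Suc (Suc q)))) (p (move q s i)) (act (F q) x)"
  proof (rule Suc.IH[OF _ _ x'])
    show "move q s i \<le> a - 1" using Suc.prems by (auto simp: move_def)
    show "odd (move q s i + Suc q) \<and> move q s i + k \<le> a - 1 \<or> even (move q s i + Suc q) \<and> k \<le> move q s i + a"
    proof (cases "odd (i + q)")
      case True
      then have "move q s i = Suc i" using Suc.prems s ab by (auto simp: move_def)
      then show ?thesis using True Suc.prems by auto
    next
      case False
      then show ?thesis using Suc.prems by (cases i) (auto simp: move_def)
    qed
  qed
  then show ?case using 1 2 ile by (simp add: cross_append act_F_node F_Suc_Suc)
qed simp

text \<open>The mirror image: walking right, the strand has \<open>s - i\<close> steps to node
  \<open>s\<close>, one pause and \<open>s - a\<close> steps back to node \<open>a\<close>.\<close>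

lemma not_cross_right:
  assumes "a \<le> i" "i \<le> s" "(even (i + q) \<and> a + k \<le> i) \<or> (odd (i + q) \<and> i + k + a \<le> 2 * s + 1)" "a < x" "x \<le> b"
  shows "\<not> cross (alt_word k (F q) (F (Suc q))) (p i) x"
  using assms
proof (induction k arbitrary: i q x)
  case (Suc k)
  have 1: "\<not> cross (F q) (p i) x"
  proof (cases "even (q + a)")
    case True
    have "a < i"
    proof (rule ccontr)
      assume "\<not> a < i"
      then have "a = i" using Suc.prems(1) by simp
      then show False using True Suc.prems(3) by auto
    qed
    then have "\<not> cross (F q) x (p i)"
      using notin_F(2)[OF True] Suc.prems by (intro not_cross_separated[of "Suc b"]) (auto simp: node_def)
    then show ?thesis by (simp add: cross_sym)
  next
    case False
    then have "\<not> cross (F q) x (p i)"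
      using notin_F(4)[OF False] Suc.prems ab by (intro not_cross_separated[of b]) (auto simp: node_def)
    then show ?thesis by (simp add: cross_sym)
  qed
  have x': "a < act (F q) x" "act (F q) x \<le> b" using act_full_word_inner[OF ab(2)] Suc.prems by auto
  have 2: "\<not> cross (alt_word k (F (Suc q)) (F (Suc (Suc q)))) (p (move q s i)) (act (F q) x)"
  proof (rule Suc.IH[OF _ _ _ x'])
    show "a \<le> move q s i" using Suc.prems by (auto simp: move_def)
    show "move q s i \<le> s" using Suc.prems by (auto simp: move_def)
    show "even (move q s i + Suc q) \<and> a + k \<le> move q s i \<or> odd (move q s i + Suc q) \<and> move q s i + k + a \<le> 2 * s + 1"
    proof (cases "odd (i + q)")
      case True
      then show ?thesis using Suc.prems by (cases "i = s") (auto simp: move_def)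
    next
      case False
      then show ?thesis using Suc.prems ab by (cases i) (auto simp: move_def)
    qed
  qed
  then show ?case using 1 2 Suc.prems(2) by (simp add: cross_append act_F_node F_Suc_Suc)
qed simp

text \<open>In the product that begins with \<open>F (Suc a)\<close> the nodes at the two ends of
  \<open>[a, b]\<close> first walk away from it. The one on the side with more nodes does not return
  in time to cross the interior, whereas adjacent strands must cross in a product that every
  generator divides.\<close>

lemma alt_F_asym:
  assumes eq: "alt_word (Suc s) (F a) (F (Suc a)) \<approx> alt_word (Suc s) (F (Suc a)) (F a)" and "a < b"
  shows "a + b = n + 1"
proof (rule ccontr)
  assume asym: "a + b \<noteq> n + 1"
  have div: "\<exists>z. alt_word (Suc s) (F a) (F (Suc a)) \<approx> i # z" if "i \<in> {1..n}" for i
    using alt_word_left_divisor[OF longest_F eq, of i] that sides by auto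
  have eq': "alt_word (Suc s) (F a) (F (Suc a)) \<approx> alt_word (Suc s) (F (Suc a)) (F (Suc (Suc a)))"
    using eq by (simp only: F_Suc_Suc)
  \<comment> \<open>There are \<open>a\<close> nodes to the left of the interior and
    \<open>s + 1 - a\<close> to its right; these numbers agree iff
    \<open>a + b = n + 1\<close>.\<close>
  consider "Suc s < 2 * a" | "2 * a < Suc s" using asym s ab by linarith
  then show False
  proof cases
    case 1
    have pa: "p (a - 1) = a" using ab by (simp add: node_def)
    have "cross (alt_word (Suc s) (F a) (F (Suc a))) a (Suc a)"
      using div ab by (intro cross_of_left_divisors) auto
    then have "cross (alt_word (Suc s) (F (Suc a)) (F (Suc (Suc a)))) (p (a - 1)) (Suc a)"
      using cross_braid_eq[OF eq'] pa by simp
    moreover have "\<not> cross (alt_word (Suc s) (F (Suc a)) (F (Suc (Suc a)))) (p (a - 1)) (Suc a)"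
      using 1 assms(2) ab by (intro not_cross_left) auto
    ultimately show False by simp
  next
    case 2
    have pa: "p a = Suc b" using ab by (simp add: node_def)
    have "cross (alt_word (Suc s) (F a) (F (Suc a))) b (Suc b)"
      using div ab by (intro cross_of_left_divisors) auto
    then have "cross (alt_word (Suc s) (F (Suc a)) (F (Suc (Suc a)))) (p a) b"
      using cross_braid_eq[OF eq'] pa cross_sym by simp
    moreover have "\<not> cross (alt_word (Suc s) (F (Suc a)) (F (Suc (Suc a)))) (p a) b"
      using 2 assms(2) ab by (intro not_cross_right) auto
    ultimately show False by simp
  qed
qed

lemma min_braid_le:
  assumes eq: "alt_word k (F a) (F (Suc a)) \<approx> alt_word k (F (Suc a)) (F a)" and k: "0 < k"
  shows "min_braid \<le> k"
proof (rule ccontr)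
  assume less: "\<not> min_braid \<le> k"
  then have "k \<le> 2 * s + 1" by (auto simp: min_braid_def split: if_splits)
  then have "k = Suc s" using alt_F_node_0[OF eq k] by simp
  then show False using alt_F_asym eq less ab by (auto simp: min_braid_def split: if_splits)
qed

end

section \<open>Homomorphisms from the dihedral Artin monoids\<close>

lemma coeff_le_2_iff: "coeff (type_A n) i j \<le> 2 \<longleftrightarrow> \<not> adj i j"
  using far_adj_cases[of i j] adj_not_far[of i j] adj_irrefl[of i]
  by (auto simp: coeff_type_A numeral_eq_enat one_enat_def)

lemma coeff_eq_2_iff: "coeff (type_A n) i j = 2 \<longleftrightarrow> far i j"
  using far_adj_cases[of i j] adj_not_far[of i j] far_irrefl[of i]
  by (auto simp: coeff_type_A numeral_eq_enat one_enat_def)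

lemma self_orthogonal_iff: "self_orthogonal (type_A n) S \<longleftrightarrow> (\<forall>i\<in>S. Suc i \<notin> S)"
  by (auto simp: self_orthogonal_def coeff_le_2_iff adj_def Suc_eq_plus1)

lemma orthogonal_iff: "orthogonal (type_A n) S T \<longleftrightarrow> (\<forall>i\<in>S. \<forall>j\<in>T. far i j)"
  by (simp add: orthogonal_def coeff_eq_2_iff)

text \<open>Apart from the pairs within \<open>[a, b]\<close>, neighbours never lie in the same set,
  so membership alternates with the distance from \<open>[a, b]\<close>.\<close>

lemma sides_unique:
  assumes JL: "J \<union> L = {1..n}" "J \<inter> L = {}" and ab: "1 \<le> a" "a \<le> b" "b \<le> n" "{a..b} \<subseteq> J"
    and J: "\<And>i. i \<in> J \<Longrightarrow> Suc i \<in> J \<Longrightarrow> a \<le> i \<and> i < b" and L: "\<And>i. i \<in> L \<Longrightarrow> Suc i \<notin> L"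
  shows "J = even_side n a b" "L = odd_side n a b"
proof -
  have below: "a - d \<in> J \<longleftrightarrow> even d" if "d < a" for d
    using that
  proof (induction d)
    case 0
    then show ?case using ab by auto
  next
    case (Suc d)
    define i where "i = a - Suc d"
    have i: "Suc i = a - d" "i < a" "i \<in> J \<union> L" using Suc.prems ab JL by (auto simp: i_def)
    show ?case
    proof (cases "even d")
      case True
      then have "Suc i \<in> J" using Suc i by simp
      then have "i \<notin> J" using J[of i] i by auto
      then show ?thesis using True by (simp add: i_def)
    next
      case False
      then have "Suc i \<notin> J" using Suc i by simp
      then have "Suc i \<in> L" using i(1) Suc.prems ab JL by auto
      then have "i \<notin> L" using L[of i] by auto
      then show ?thesis using False i by (auto simp: i_def)
    qed
  qed
  have above: "b + d \<in> J \<longleftrightarrow> even d" if "b + d \<le> n" for d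
    using that
  proof (induction d)
    case 0
    then show ?case using ab by auto
  next
    case (Suc d)
    define i where "i = b + d"
    have i: "Suc i \<in> J \<union> L" "b \<le> i" "i \<in> J \<union> L" using Suc.prems ab JL by (auto simp: i_def)
    show ?case
    proof (cases "even d")
      case True
      then have "i \<in> J" using Suc by (simp add: i_def)
      then have "Suc i \<notin> J" using J[of i] i by auto
      then show ?thesis using True by (simp add: i_def)
    next
      case False
      then have "i \<notin> J" using Suc by (simp add: i_def)
      then have "Suc i \<notin> L" using L[of i] i by auto
      then show ?thesis using False i by (auto simp: i_def)
    qed
  qed
  have mem: "i \<in> J \<longleftrightarrow> i \<in> even_side n a b" if "i \<in> {1..n}" for i
  proof -
    consider "i < a" | "i \<in> {a..b}" | "b < i" by fastforce
    then show ?thesis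
    proof cases
      case 1
      then show ?thesis using below[of "a - i"] that ab by (auto simp: even_side_def)
    next
      case 2
      then show ?thesis using ab by (auto simp: even_side_def)
    next
      case 3
      then show ?thesis using above[of "i - b"] that ab by (auto simp: even_side_def)
    qed
  qed
  moreover have sub: "even_side n a b \<subseteq> {1..n}" using ab by (auto simp: even_side_def)
  ultimately show J': "J = even_side n a b" using JL by blast
  have "even_side n a b \<union> odd_side n a b = {1..n}" "even_side n a b \<inter> odd_side n a b = {}"
    using ab by (auto simp: even_side_def odd_side_def)
  then show "L = odd_side n a b" using JL J' by blast
qed

lemma orth_partition_iff:
  assumes ab: "1 \<le> a" "a \<le> b" "b \<le> n"
  shows "orth_partition n {a..b} I' I'' \<longleftrightarrow> I' = even_side n a b - {a..b} \<and> I'' = odd_side n a b"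
proof
  assume "orth_partition n {a..b} I' I''"
  then have o: "I' \<union> I'' = {1..n} - {a..b}" "I' \<inter> I'' = {}" "\<And>i. i \<in> I' \<Longrightarrow> Suc i \<notin> I'"
    "\<And>i. i \<in> I'' \<Longrightarrow> Suc i \<notin> I''" "\<And>i j. i \<in> I' \<Longrightarrow> j \<in> {a..b} \<Longrightarrow> far i j"
    unfolding orth_partition_def self_orthogonal_iff orthogonal_iff by blast+
  have d: "I' \<inter> {a..b} = {}" using o(1) by blast
  \<comment> \<open>The union of \<open>I'\<close> and \<open>[a, b]\<close> takes the place of
    \<open>J\<close> in \<open>sides_unique\<close>.\<close>
  have u: "(I' \<union> {a..b}) \<union> I'' = {1..n}" "(I' \<union> {a..b}) \<inter> I'' = {}" using o(1,2) ab by auto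
  have "a \<le> i \<and> i < b" if "i \<in> I' \<union> {a..b}" "Suc i \<in> I' \<union> {a..b}" for i
  proof -
    have "i \<notin> I'" using that o(3)[of i] o(5)[of i "Suc i"] by (auto simp: far_def)
    moreover have "Suc i \<notin> I'" using that o(3)[of i] o(5)[of "Suc i" i] by (auto simp: far_def)
    ultimately show ?thesis using that by auto
  qed
  then have "I' \<union> {a..b} = even_side n a b" "I'' = odd_side n a b"
    using sides_unique[OF u ab] o(4) by blast+
  then show "I' = even_side n a b - {a..b} \<and> I'' = odd_side n a b" using d by blast
next
  assume "I' = even_side n a b - {a..b} \<and> I'' = odd_side n a b"
  then have I: "I' = {i. 1 \<le> i \<and> i < a \<and> even (i + a)} \<union> {i. Suc b \<le> i \<and> i < Suc n \<and> even (i + b)}"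
    "I'' = odd_side n a b"
    using ab by (auto simp: even_side_def)
  have "far i j" if "i \<in> I'" "j \<in> {a..b}" for i j
    using that far_below[of i a j] far_above[of i b j] far_sym unfolding I by auto
  then show "orth_partition n {a..b} I' I''"
    unfolding orth_partition_def self_orthogonal_iff orthogonal_iff
    using ab unfolding I by (auto simp: odd_side_def)
qed

lemma alt_word_cong: "u \<approx> u' \<Longrightarrow> v \<approx> v' \<Longrightarrow> alt_word k u v \<approx> alt_word k u' v'"
  by (induction k arbitrary: u u' v v') (auto intro: braid_eq_append)

lemma alt_word_lists: "u \<in> lists I \<Longrightarrow> v \<in> lists I \<Longrightarrow> alt_word k u v \<in> lists I"
  by (induction k arbitrary: u v) auto

lemma prod_in_artin_alternating:
  assumes "u \<in> lists {1..n}" "v \<in> lists {1..n}"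
  shows "prod_in (artin_monoid (type_A n)) (alternating k (artin_class n u) (artin_class n v)) = artin_class n (alt_word k u v)"
  unfolding artin_monoid_type_A alt_word_def by (rule prod_in_alternating[OF assms])

lemma braid_lengths_class:
  assumes "u \<in> lists {1..n}" "v \<in> lists {1..n}"
  shows "braid_lengths (artin_monoid (type_A n)) (artin_class n u) (artin_class n v) =
    {k. 0 < k \<and> alt_word k u v \<approx> alt_word k v u}"
  unfolding braid_lengths_def prod_in_artin_alternating[OF assms] prod_in_artin_alternating[OF assms(2,1)]
  using assms by (auto simp: artin_class_eq_iff alt_word_lists)

section \<open>Homomorphisms given by two words, and their optimality\<close>

lemma index_type_I2 [simp]: "index (type_I2 N) = {1, 2}"
  by (simp add: type_I2_def)

lemma coeff_type_I2: "coeff (type_I2 N) i j = (if i = j then 1 else enat N)"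
  by (simp add: type_I2_def)

lemma braid_rels_type_I2:
  "braid_rels (type_I2 N) = {(alternating N 1 2, alternating N 2 1), (alternating N 2 1, alternating N 1 2)}"
proof -
  have "(alternating N i j, alternating N j i) \<in> braid_rels (type_I2 N)" if "i \<in> {1, 2}" "j \<in> {1, 2}" "i \<noteq> j" for i j
    using that by (auto simp: braid_rels_def coeff_type_I2)
  then have "{(alternating N 1 2, alternating N 2 1), (alternating N 2 1, alternating N 1 2)} \<subseteq> braid_rels (type_I2 N)"
    by simp
  moreover have "braid_rels (type_I2 N) \<subseteq> {(alternating N 1 2, alternating N 2 1), (alternating N 2 1, alternating N 1 2)}"
    by (auto simp: braid_rels_def coeff_type_I2)
  ultimately show ?thesis by (rule subset_antisym[rotated])
qed

lemma artin_monoid_type_I2: "artin_monoid (type_I2 N) = pres_monoid {1, 2} (braid_rels (type_I2 N))"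
  by (simp add: artin_monoid_def)

lemma artin_gen_type_I2: "artin_gen (type_I2 N) i = word_class {1, 2} (braid_rels (type_I2 N)) [i]"
  by (simp add: artin_gen_def pres_gen_def)

lemma ex_hom_I2:
  assumes u: "u \<in> lists {1..n}" and v: "v \<in> lists {1..n}" and eq: "alt_word N u v \<approx> alt_word N v u"
  shows "\<exists>\<Phi> \<in> artin_homs (type_I2 N) (type_A n).
    \<Phi> (artin_gen (type_I2 N) 1) = artin_class n u \<and> \<Phi> (artin_gen (type_I2 N) 2) = artin_class n v"
proof -
  define f where "f = (\<lambda>i::nat. if i = 1 then u else v)"
  define \<Phi> where "\<Phi> = pres_lift {1..n} (braid_rels (type_A n)) f"
  have f: "f 1 = u" "f 2 = v" by (simp_all add: f_def)
  have fI: "f i \<in> lists {1..n}" for i using u v by (simp add: f_def)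
  have R: "(concat (map f x), concat (map f y)) \<in> artin_cong n" if "(x, y) \<in> braid_rels (type_I2 N)" for x y
  proof -
    have "concat (map f (alternating N i j)) = alt_word N (f i) (f j)" for i j
      by (simp add: alt_word_def map_alternating)
    then show ?thesis
      using that eq braid_eq_sym u v by (auto simp: braid_rels_type_I2 artin_cong_iff f alt_word_lists)
  qed
  have "\<Phi> \<in> artin_homs (type_I2 N) (type_A n)"
    using pres_lift_hom(1,2)[of "{1, 2}" f "{1..n}" "braid_rels (type_I2 N)" "braid_rels (type_A n)", OF fI R]
    by (simp add: artin_homs_def artin_monoid_type_I2 artin_monoid_type_A \<Phi>_def)
  moreover have "\<Phi> (artin_gen (type_I2 N) i) = artin_class n (f i)" if "i \<in> {1, 2}" for i
    using pres_lift_hom(3)[of "{1, 2}" f "{1..n}" "braid_rels (type_I2 N)" "braid_rels (type_A n)" i, OF fI R] that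
    by (simp add: artin_gen_def \<Phi>_def)
  ultimately show ?thesis using f by (intro bexI[of _ \<Phi>]) auto
qed

lemma supp_class:
  assumes "\<Phi> (artin_gen M i) = artin_class n u" "u \<in> lists {1..n}"
  shows "supp M \<Phi> i = set u"
proof -
  have "set x = set u" if "(u, x) \<in> artin_cong n" for x
    using that braid_eq_set by (auto simp: artin_cong_iff)
  moreover have "(u, u) \<in> artin_cong n" using assms(2) by (rule pres_cong.refl)
  ultimately show ?thesis unfolding supp_def assms(1) by blast
qed

lemma hom_I2_alternating:
  assumes \<Phi>: "\<Phi> \<in> artin_homs (type_I2 N) (type_A n)"
    and u: "\<Phi> (artin_gen (type_I2 N) 1) = artin_class n u" "u \<in> lists {1..n}"
    and v: "\<Phi> (artin_gen (type_I2 N) 2) = artin_class n v" "v \<in> lists {1..n}"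
  shows "alt_word N u v \<approx> alt_word N v u"
proof -
  let ?G = "artin_monoid (type_I2 N)" and ?g = "artin_gen (type_I2 N)"
  have al: "prod_in ?G (alternating N (?g i) (?g j)) = word_class {1, 2} (braid_rels (type_I2 N)) (alternating N i j)"
    if "i \<in> {1, 2}" "j \<in> {1, 2}" for i j
  proof -
    have "alternating N i j \<in> lists {1, 2}"
      using set_alternating[of N i j] that by (auto simp: in_lists_conv_set)
    then show ?thesis
      using prod_in_gens[of "alternating N i j" "{1, 2}" "braid_rels (type_I2 N)"]
      by (simp add: artin_monoid_type_I2 map_alternating artin_gen_def)
  qed
  have l: "alternating N 1 (2::nat) \<in> lists {1, 2}" "alternating N 2 (1::nat) \<in> lists {1, 2}"
    using set_alternating[of N "1::nat" 2] set_alternating[of N "2::nat" 1] by (auto simp: in_lists_conv_set)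
  have "(alternating N 1 2, alternating N 2 1) \<in> pres_cong {1, 2} (braid_rels (type_I2 N))"
    using pres_cong.rel[OF _ l, of "braid_rels (type_I2 N)" "[]" "[]"] by (simp add: braid_rels_type_I2)
  then have "prod_in ?G (alternating N (?g 1) (?g 2)) = prod_in ?G (alternating N (?g 2) (?g 1))"
    using l by (simp add: al word_class_eq_iff)
  then have "\<Phi> (prod_in ?G (alternating N (?g 1) (?g 2))) = \<Phi> (prod_in ?G (alternating N (?g 2) (?g 1)))" by simp
  moreover have "\<Phi> (prod_in ?G (alternating N (?g i) (?g j))) =
      prod_in (artin_monoid (type_A n)) (alternating N (\<Phi> (?g i)) (\<Phi> (?g j)))" if "i \<in> {1, 2}" "j \<in> {1, 2}" for i j
  proof -
    have "?g i \<in> carrier ?G" "?g j \<in> carrier ?G"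
      using that by (auto simp: artin_monoid_type_I2 carrier_pres_monoid artin_gen_type_I2)
    then have "set (alternating N (?g i) (?g j)) \<subseteq> carrier ?G"
      using set_alternating[of N "?g i" "?g j"] by auto
    then have "\<Phi> (prod_in ?G (alternating N (?g i) (?g j))) = prod_in (artin_monoid (type_A n)) (map \<Phi> (alternating N (?g i) (?g j)))"
      using \<Phi> monoid_pres_monoid by (intro hom_prod_in) (auto simp: artin_homs_def artin_monoid_type_I2)
    then show ?thesis by (simp only: map_alternating)
  qed
  ultimately have "artin_class n (alt_word N u v) = artin_class n (alt_word N v u)"
    using u v prod_in_artin_alternating by simp
  then show ?thesis using u(2) v(2) by (simp add: artin_class_eq_iff alt_word_lists)
qed

text \<open>\<open>ne\<close> and \<open>B\<close> discharge the guards in the definition of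
  \<open>optimal\<close>, which otherwise imposes nothing on \<open>N\<close>.\<close>

lemma optimal_I2_iff:
  assumes u: "\<Phi> (artin_gen (type_I2 N) 1) = artin_class n u" "u \<in> lists {1..n}"
    and v: "\<Phi> (artin_gen (type_I2 N) 2) = artin_class n v" "v \<in> lists {1..n}"
    and ne: "\<not> u \<approx> v" and B: "0 < k" "alt_word k u v \<approx> alt_word k v u"
  shows "optimal (type_I2 N) (type_A n) \<Phi> \<longleftrightarrow> N = (LEAST k. 0 < k \<and> alt_word k u v \<approx> alt_word k v u)"
proof -
  let ?B = "{k. 0 < k \<and> alt_word k u v \<approx> alt_word k v u}"
  have "alt_word j v u \<approx> alt_word j u v \<longleftrightarrow> alt_word j u v \<approx> alt_word j v u" for j
    using braid_eq_sym by blast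
  then have BL: "braid_lengths (artin_monoid (type_A n)) (artin_class n u) (artin_class n v) = ?B"
    "braid_lengths (artin_monoid (type_A n)) (artin_class n v) (artin_class n u) = ?B"
    using braid_lengths_class u(2) v(2) by auto
  have "artin_class n u \<noteq> artin_class n v" using ne u(2) v(2) by (simp add: artin_class_eq_iff)
  moreover have "?B \<noteq> {}" using B by blast
  ultimately show ?thesis
    unfolding optimal_def by (auto simp: u(1) v(1) BL Let_def coeff_type_I2)
qed

lemma least_alt_word:
  assumes "runs n a b s" and u: "longest_word (even_side n a b) u" and v: "longest_word (odd_side n a b) v"
  shows "(LEAST k. 0 < k \<and> alt_word k u v \<approx> alt_word k v u) = runs.min_braid n a b s"
    and "alt_word (runs.min_braid n a b s) u v \<approx> alt_word (runs.min_braid n a b s) v u"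
    and "0 < runs.min_braid n a b s"
proof -
  interpret runs n a b s by fact
  have uv: "u \<approx> F a" "v \<approx> F (Suc a)"
    using longest_word_unique[OF u longest_F(1)] longest_word_unique[OF v longest_F(2)] by auto
  have eq: "alt_word k u v \<approx> alt_word k v u \<longleftrightarrow> alt_word k (F a) (F (Suc a)) \<approx> alt_word k (F (Suc a)) (F a)" for k
    using alt_word_cong[OF uv, of k] alt_word_cong[OF uv(2,1), of k] braid_eq_sym braid_eq_trans by blast
  show pos: "0 < min_braid" by (simp add: min_braid_def)
  show "(LEAST k. 0 < k \<and> alt_word k u v \<approx> alt_word k v u) = min_braid"
    unfolding eq using alt_F_min_braid min_braid_le pos by (intro Least_equality) auto
  show "alt_word min_braid u v \<approx> alt_word min_braid v u" unfolding eq by (rule alt_F_min_braid)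
qed

text \<open>Since \<open>|K| = b - a + 1\<close>, the half period \<open>s + 1\<close> is
  \<open>n - |K| + 2\<close>. In the centred case it equals \<open>2 * a\<close>, and
  \<open>m(K) = a\<close>.\<close>

lemma min_braid_eq_m_of:
  assumes "runs n a b s" "a < b"
  shows "runs.min_braid n a b s = 2 * m_of n {a..b}"
proof -
  interpret runs n a b s by fact
  have flip: "flip n ` {a..b} = {n + 1 - b..n + 1 - a}"
  proof
    show "flip n ` {a..b} \<subseteq> {n + 1 - b..n + 1 - a}" using ab by (auto simp: flip_def)
    show "{n + 1 - b..n + 1 - a} \<subseteq> flip n ` {a..b}"
    proof
      fix x assume "x \<in> {n + 1 - b..n + 1 - a}"
      then have "x = flip n (n + 1 - x)" "n + 1 - x \<in> {a..b}" using ab by (auto simp: flip_def)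
      then show "x \<in> flip n ` {a..b}" by blast
    qed
  qed
  have f: "flip n ` {a..b} = {a..b} \<longleftrightarrow> a + b = n + 1"
    unfolding flip using ab by auto
  show ?thesis
  proof (cases "a + b = n + 1")
    case True
    have "min_braid = Suc s" unfolding min_braid_def using True by simp
    moreover have "m_of n {a..b} = (n - Suc (b - a)) div 2 + 1"
      unfolding m_of_def f using True ab by (simp add: Suc_diff_le)
    moreover have "n - Suc (b - a) = 2 * (a - 1)" "Suc s = 2 * a" using True ab s by auto
    ultimately show ?thesis using ab by simp
  next
    case False
    have "min_braid = 2 * Suc s" unfolding min_braid_def using False assms(2) by simp
    moreover have "m_of n {a..b} = n - Suc (b - a) + 2"
      unfolding m_of_def f using False ab by (simp add: Suc_diff_le)
    moreover have "n - Suc (b - a) + 2 = Suc s" if "b - a < n" using that s by auto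
    ultimately show ?thesis using ab by simp
  qed
qed

section \<open>Connected components of the two supports\<close>

lemma component_disjoint:
  assumes "component S a b" "component S c d"
  shows "(a = c \<and> b = d) \<or> b < c \<or> d < a"
proof (rule ccontr)
  assume n: "\<not> ?thesis"
  then have o: "c \<le> b" "a \<le> d" "a \<noteq> c \<or> b \<noteq> d" by auto
  have m: "{a..b} \<subseteq> S" "{c..d} \<subseteq> S" "a - 1 \<notin> S" "c - 1 \<notin> S" "Suc b \<notin> S" "Suc d \<notin> S" "1 \<le> a" "1 \<le> c" "a \<le> b" "c \<le> d"
    using assms by (auto simp: component_def)
  have "\<not> c < a"
  proof
    assume "c < a"
    then have "a - 1 \<in> {c..d}" using o by auto
    then show False using m by blast
  qed
  moreover have "\<not> a < c"
  proof
    assume "a < c"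
    then have "c - 1 \<in> {a..b}" using o by auto
    then show False using m by blast
  qed
  moreover have "\<not> b < d"
  proof
    assume "b < d"
    then have "Suc b \<in> {c..d}" using o by auto
    then show False using m by blast
  qed
  moreover have "\<not> d < b"
  proof
    assume "d < b"
    then have "Suc d \<in> {a..b}" using o by auto
    then show False using m by blast
  qed
  ultimately show False using o by simp
qed

lemma big_componentsD:
  assumes "K \<in> big_components S" "S \<subseteq> {1..n}"
  shows "\<exists>a b. K = {a..b} \<and> a < b \<and> component S a b"
proof -
  have c: "is_interval_nat K" "K \<subseteq> S" "1 < card K"
    and m: "\<And>D. is_interval_nat D \<Longrightarrow> K \<subseteq> D \<Longrightarrow> D \<subseteq> S \<Longrightarrow> D = K"
    using assms(1) by (auto simp: big_components_def conn_components_def)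
  obtain a b where K: "K = {a..b}" "a \<le> b" using c(1) by (auto simp: is_interval_nat_def)
  have sub: "{a..b} \<subseteq> S" and card: "1 < card {a..b}" using c K by auto
  have max: "{c..d} = {a..b}" if "c \<le> d" "{a..b} \<subseteq> {c..d}" "{c..d} \<subseteq> S" for c d
  proof -
    have "is_interval_nat {c..d}" using that(1) by (auto simp: is_interval_nat_def)
    then show ?thesis using m[of "{c..d}"] that(2,3) unfolding K(1) by blast
  qed
  have ab: "a < b" using card by simp
  have "a \<in> {a..b}" using ab by simp
  then have "a \<in> {1..n}" using sub assms(2) by blast
  then have a1: "1 \<le> a" by simp
  have "a - 1 \<notin> S"
  proof
    assume "a - 1 \<in> S"
    moreover have "{a - 1..b} = insert (a - 1) {a..b}" using a1 ab by auto
    ultimately have "{a - 1..b} \<subseteq> S" using sub by simp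
    then have "{a - 1..b} = {a..b}" using max[of "a - 1" b] ab by auto
    moreover have "a - 1 \<in> {a - 1..b}" "a - 1 \<notin> {a..b}" using a1 ab by auto
    ultimately show False by simp
  qed
  moreover have "Suc b \<notin> S"
  proof
    assume "Suc b \<in> S"
    moreover have "{a..Suc b} = insert (Suc b) {a..b}" using ab by auto
    ultimately have "{a..Suc b} \<subseteq> S" using sub by simp
    then have "{a..Suc b} = {a..b}" using max[of a "Suc b"] ab by auto
    moreover have "Suc b \<in> {a..Suc b}" "Suc b \<notin> {a..b}" using ab by auto
    ultimately show False by simp
  qed
  ultimately show ?thesis using K ab a1 sub by (auto simp: component_def)
qed

lemma ex_big_component:
  assumes "S \<subseteq> {1..n}" "i \<in> S" "Suc i \<in> S"
  shows "\<exists>a b. {a..b} \<in> big_components S \<and> a \<le> i \<and> i < b"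
proof -
  \<comment> \<open>A widest interval in \<open>S\<close> through \<open>i\<close> and
    \<open>i + 1\<close> is maximal for inclusion; widths are bounded because \<open>S\<close> lies
    in \<open>[1, n]\<close>.\<close>
  define P where "P = (\<lambda>(a, b). a \<le> i \<and> i < b \<and> {a..b} \<subseteq> S)"
  have P0: "P (i, Suc i)" using assms by (auto simp: P_def le_Suc_eq)
  have "b - a < Suc n" if "P (a, b)" for a b
  proof -
    have "b \<in> S" using that by (auto simp: P_def)
    then have "b \<in> {1..n}" using assms(1) by blast
    then show ?thesis by auto
  qed
  then have "\<forall>y. P y \<longrightarrow> (case y of (a, b) \<Rightarrow> b - a) < Suc n" by auto
  then obtain y where y: "P y" "\<And>z. P z \<Longrightarrow> (case z of (a, b) \<Rightarrow> b - a) \<le> (case y of (a, b) \<Rightarrow> b - a)"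
    using ex_has_greatest_nat[of P "(i, Suc i)" "\<lambda>(a, b). b - a"] P0 by blast
  obtain a b where ab: "y = (a, b)" by fastforce
  have p: "a \<le> i" "i < b" "{a..b} \<subseteq> S" using y(1) by (auto simp: P_def ab)
  have max: "D = {a..b}" if D: "is_interval_nat D" "{a..b} \<subseteq> D" "D \<subseteq> S" for D
  proof -
    obtain c d where cd: "c \<le> d" "D = {c..d}" using D(1) by (auto simp: is_interval_nat_def)
    then have le: "c \<le> a" "b \<le> d" using D(2) p by auto
    then have "P (c, d)" using D(3) cd p by (auto simp: P_def)
    then have "d - c \<le> b - a" using y(2)[of "(c, d)"] by (simp add: ab)
    then show ?thesis using cd le p by auto
  qed
  have "is_interval_nat {a..b}" using p by (auto simp: is_interval_nat_def)
  then have "{a..b} \<in> conn_components S"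
    unfolding conn_components_def using p(3) max by blast
  then have "{a..b} \<in> big_components S" using p by (simp add: big_components_def)
  then show ?thesis using p by blast
qed

text \<open>What is kept of an optimal fully supported disjoint standard homomorphism: the two
  supports, longest words for the two images, and \<open>N\<close> as the least length at which the
  alternating products agree.\<close>

locale braided_pair =
  fixes n :: nat and J L :: "nat set" and u v :: "nat list" and N :: nat
  assumes n: "2 \<le> n"
    and u: "longest_word J u" and v: "longest_word L v"
    and JL: "J \<union> L = {1..n}" "J \<inter> L = {}"
    and N: "0 < N" "alt_word N u v \<approx> alt_word N v u"
    and least: "N = (LEAST k. 0 < k \<and> alt_word k u v \<approx> alt_word k v u)"
begin

lemma swap: "braided_pair n L J v u N"
proof
  have "alt_word k v u \<approx> alt_word k u v \<longleftrightarrow> alt_word k u v \<approx> alt_word k v u" for k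
    using braid_eq_sym by blast
  then show "N = (LEAST k. 0 < k \<and> alt_word k v u \<approx> alt_word k u v)" using least by simp
qed (use n u v JL N braid_eq_sym in auto)

lemma big_component_unique:
  assumes "K \<in> big_components S" "S = J \<or> S = L" "K' \<in> big_components S'" "S' = J \<or> S' = L"
  shows "K = K' \<and> S = S'"
proof -
  have S: "S \<subseteq> {1..n}" "S' \<subseteq> {1..n}" using assms(2,4) JL by auto
  obtain a b where ab: "K = {a..b}" "a < b" "component S a b" using big_componentsD[OF assms(1) S(1)] by blast
  obtain c d where cd: "K' = {c..d}" "c < d" "component S' c d" using big_componentsD[OF assms(3) S(2)] by blast
  have C: "component J a b \<or> component L a b" "component J c d \<or> component L c d"
    using ab cd assms(2,4) by auto
  have "\<not> b < c" using at_most_one_big_component[OF u v N(2,1) JL C(1) ab(2) C(2) cd(2)] by blast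
  moreover have "\<not> d < a" using at_most_one_big_component[OF u v N(2,1) JL C(2) cd(2) C(1) ab(2)] by blast
  moreover have "S = S'"
  proof (rule ccontr)
    assume "S \<noteq> S'"
    then have "S \<inter> S' = {}" using assms(2,4) JL(2) by auto
    then have "{a..b} \<inter> {c..d} = {}" using ab(3) cd(3) unfolding component_def by blast
    \<comment> \<open>Two intervals neither of which precedes the other share the larger of their
      left ends.\<close>
    moreover have "max a c \<in> {a..b} \<inter> {c..d}"
      using \<open>\<not> b < c\<close> \<open>\<not> d < a\<close> ab(2) cd(2) by auto
    ultimately show False by blast
  qed
  ultimately show ?thesis using component_disjoint[OF ab(3)] ab cd by auto
qed

lemma sides_of_big_component:
  assumes "{a..b} \<in> big_components J"
  shows "a < b" "1 \<le> a" "b \<le> n" "J = even_side n a b" "L = odd_side n a b"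
proof -
  have JS: "J \<subseteq> {1..n}" "L \<subseteq> {1..n}" using JL by auto
  obtain c d where "{a..b} = {c..d}" "c < d" "component J c d" using big_componentsD[OF assms JS(1)] by blast
  then have ab: "a < b" "component J a b" by (auto simp: Icc_eq_Icc)
  then have sub: "{a..b} \<subseteq> J" by (simp add: component_def)
  then have "b \<in> J" using ab(1) by auto
  then have "b \<in> {1..n}" using JS by blast
  then show b: "b \<le> n" by simp
  show "a < b" "1 \<le> a" using ab by (auto simp: component_def)
  have "a \<le> i \<and> i < b" if i: "i \<in> J" "Suc i \<in> J" for i
  proof -
    obtain c d where cd: "{c..d} \<in> big_components J" "c \<le> i" "i < d" using ex_big_component[OF JS(1) i] by blast
    then have "{c..d} = {a..b}" using big_component_unique[OF cd(1) _ assms] by simp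
    then show ?thesis using cd by (auto simp: Icc_eq_Icc)
  qed
  moreover have "Suc i \<notin> L" if i: "i \<in> L" for i
  proof
    assume "Suc i \<in> L"
    then obtain c d where cd: "{c..d} \<in> big_components L" using ex_big_component[OF JS(2) i] by blast
    then have "L = J" using big_component_unique[OF cd(1) _ assms] by simp
    then show False using JL(2) i by simp
  qed
  ultimately show "J = even_side n a b" "L = odd_side n a b"
    using sides_unique[OF JL \<open>1 \<le> a\<close> _ b sub] ab(1) by auto
qed

lemma N_eq_min_braid:
  assumes "runs n a b s" "J = even_side n a b" "L = odd_side n a b"
  shows "N = runs.min_braid n a b s"
  using least_alt_word(1)[OF assms(1)] u v assms(2,3) least by simp

lemma N_of_big_component:
  assumes "{a..b} \<in> big_components J"
  shows "N = 2 * m_of n {a..b}"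
proof -
  note s = sides_of_big_component[OF assms]
  have "runs n a b (n - (b - a))" using s n by unfold_locales auto
  then show ?thesis using N_eq_min_braid[OF _ s(4,5)] min_braid_eq_m_of[OF _ s(1)] by simp
qed

text \<open>The single letter \<open>1\<close> takes the place of \<open>K\<close>: with
  \<open>a = b = 1\<close> all runs are letters and \<open>s = n\<close>, so the sides are given by
  parity.\<close>

lemma self_orthogonal_sides:
  assumes J: "\<And>i. i \<in> J \<Longrightarrow> Suc i \<notin> J" and L: "\<And>i. i \<in> L \<Longrightarrow> Suc i \<notin> L" and 1: "1 \<in> J"
  shows "N = n + 1" "J = {i. 1 \<le> i \<and> i < n + 1 \<and> odd i}" "L = {i. 1 \<le> i \<and> i < n + 1 \<and> even i}"
proof -
  have sides_eq: "J = even_side n 1 1" "L = odd_side n 1 1"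
    using sides_unique[OF JL, of 1 1] n J L 1 by auto
  have r: "runs n 1 1 n" using n by unfold_locales auto
  then interpret runs n 1 1 n .
  show "N = n + 1" using N_eq_min_braid[OF r sides_eq] by (simp add: min_braid_def)
  show "J = {i. 1 \<le> i \<and> i < n + 1 \<and> odd i}" "L = {i. 1 \<le> i \<and> i < n + 1 \<and> even i}"
    unfolding sides_eq even_side_def odd_side_def using n by (auto simp: Suc_le_eq less_Suc_eq_le le_Suc_eq)
qed

end

lemma longest_word_lists: "longest_word J u \<Longrightarrow> J \<subseteq> {1..n} \<Longrightarrow> u \<in> lists {1..n}"
  by (auto simp: longest_word_def in_lists_conv_set)

lemma ex_standard_hom:
  assumes n: "2 \<le> n" and lt: "1 \<le> a" "a < b" "b \<le> n" and N: "N = 2 * m_of n {a..b}"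
  shows "\<exists>\<Phi> \<in> artin_homs (type_I2 N) (type_A n).
    \<Phi> (artin_gen (type_I2 N) 1) = artin_T (type_A n) (longest_elt (type_A n) (even_side n a b)) \<and>
    \<Phi> (artin_gen (type_I2 N) 2) = artin_T (type_A n) (longest_elt (type_A n) (odd_side n a b)) \<and>
    optimal (type_I2 N) (type_A n) \<Phi> \<and>
    disjoint_hom (type_I2 N) \<Phi> \<and>
    standard (type_I2 N) (type_A n) \<Phi>"
proof -
  let ?J = "even_side n a b" and ?L = "odd_side n a b"
  have r: "runs n a b (n - (b - a))" using n lt by unfold_locales auto
  then interpret runs n a b "n - (b - a)" .
  have JS: "?J \<subseteq> {1..n}" "?L \<subseteq> {1..n}" using sides by auto
  note u = longest_F(1) and v = longest_F(2)
  have uI: "F a \<in> lists {1..n}" "F (Suc a) \<in> lists {1..n}" using longest_word_lists u v JS by blast+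
  have N_eq: "N = min_braid" using N min_braid_eq_m_of[OF r lt(2)] by simp
  note la = least_alt_word[OF r u v, folded N_eq]
  obtain \<Phi> where \<Phi>: "\<Phi> \<in> artin_homs (type_I2 N) (type_A n)"
    and g: "\<Phi> (artin_gen (type_I2 N) 1) = artin_class n (F a)"
      "\<Phi> (artin_gen (type_I2 N) 2) = artin_class n (F (Suc a))"
    using ex_hom_I2[OF uI la(2)] by blast
  have T: "artin_T (type_A n) (longest_elt (type_A n) ?J) = artin_class n (F a)"
    "artin_T (type_A n) (longest_elt (type_A n) ?L) = artin_class n (F (Suc a))"
    using artin_T_longest_elt u v JS by blast+
  have sp: "supp (type_I2 N) \<Phi> 1 = ?J" "supp (type_I2 N) \<Phi> 2 = ?L"
    using supp_class[of \<Phi>, OF g(1) uI(1)] supp_class[of \<Phi>, OF g(2) uI(2)] set_longest_word u v by auto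
  have "\<not> F a \<approx> F (Suc a)"
  proof
    assume "F a \<approx> F (Suc a)"
    then have "?J = ?L" using braid_eq_set set_longest_word u v by blast
    moreover have "a \<in> ?J" using lt by (simp add: even_side_def)
    ultimately show False using sides(2) by blast
  qed
  then have "optimal (type_I2 N) (type_A n) \<Phi>"
    using optimal_I2_iff[of \<Phi>, OF g(1) uI(1) g(2) uI(2) _ la(3,2)] la(1) by simp
  moreover have "disjoint_hom (type_I2 N) \<Phi>"
    using sp sides(2) by (auto simp: disjoint_hom_def)
  moreover have "standard (type_I2 N) (type_A n) \<Phi>"
    by (simp add: standard_def sp T g)
  ultimately show ?thesis using \<Phi> g T by (intro bexI[of _ \<Phi>]) auto
qed

lemma braided_pair_of_hom:
  assumes n: "2 \<le> n" and N: "2 \<le> N" and \<Phi>: "\<Phi> \<in> artin_homs (type_I2 N) (type_A n)"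
    and opt: "optimal (type_I2 N) (type_A n) \<Phi>" and full: "fully_supported (type_I2 N) (type_A n) \<Phi>"
    and disj: "disjoint_hom (type_I2 N) \<Phi>" and std: "standard (type_I2 N) (type_A n) \<Phi>"
    and ne: "\<forall>i\<in>{1, 2}. supp (type_I2 N) \<Phi> i \<noteq> {}"
  shows "\<exists>u v. braided_pair n (supp (type_I2 N) \<Phi> 1) (supp (type_I2 N) \<Phi> 2) u v N"
proof -
  let ?J = "supp (type_I2 N) \<Phi> 1" and ?L = "supp (type_I2 N) \<Phi> 2"
  have JL: "?J \<union> ?L = {1..n}" using full by (simp add: fully_supported_def)
  have JL': "?J \<inter> ?L = {}" using disj by (simp add: disjoint_hom_def)
  have JS: "?J \<subseteq> {1..n}" "?L \<subseteq> {1..n}" using JL by auto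
  obtain u v where u: "longest_word ?J u" and v: "longest_word ?L v"
    using ex_longest_word[OF JS(1)] ex_longest_word[OF JS(2)] by blast
  have uI: "u \<in> lists {1..n}" "v \<in> lists {1..n}" using longest_word_lists u v JS by blast+
  have g: "\<Phi> (artin_gen (type_I2 N) 1) = artin_class n u" "\<Phi> (artin_gen (type_I2 N) 2) = artin_class n v"
    using std artin_T_longest_elt[OF u JS(1)] artin_T_longest_elt[OF v JS(2)] by (simp_all add: standard_def)
  have eq: "alt_word N u v \<approx> alt_word N v u" by (rule hom_I2_alternating[OF \<Phi> g(1) uI(1) g(2) uI(2)])
  \<comment> \<open>Optimality speaks only of distinct images; disjoint nonempty supports provide
    this.\<close>
  have "\<not> u \<approx> v"
  proof
    assume "u \<approx> v"
    then have "?J = ?L" using braid_eq_set[of u v] set_longest_word[OF u] set_longest_word[OF v] by simp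
    then show False using JL' ne by simp
  qed
  then have "N = (LEAST k. 0 < k \<and> alt_word k u v \<approx> alt_word k v u)"
    using optimal_I2_iff[of \<Phi>, OF g(1) uI(1) g(2) uI(2) _ _ eq] opt N by simp
  then have "braided_pair n ?J ?L u v N" using n N u v JL JL' eq by unfold_locales auto
  then show ?thesis by blast
qed

lemma standard_hom_filter:
  assumes std: "standard (type_I2 N) (type_A n) \<Phi>" and i: "i \<in> {1, 2}"
    and S: "supp (type_I2 N) \<Phi> i = {i. 1 \<le> i \<and> i < n + 1 \<and> P i}"
    and P: "\<And>i j. P i \<Longrightarrow> P j \<Longrightarrow> i \<noteq> j \<Longrightarrow> far i j"
  shows "\<Phi> (artin_gen (type_I2 N) i) = prod_in (artin_monoid (type_A n)) (map (artin_gen (type_A n)) (filter P [1..<n + 1]))"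
proof -
  let ?w = "filter P [1..<n + 1]"
  have w: "longest_word (supp (type_I2 N) \<Phi> i) ?w" unfolding S by (rule longest_word_filter[OF P])
  have "\<Phi> (artin_gen (type_I2 N) i) = artin_T (type_A n) (longest_elt (type_A n) (supp (type_I2 N) \<Phi> i))"
    using std i by (simp only: standard_def index_type_I2)
  then have "\<Phi> (artin_gen (type_I2 N) i) = artin_class n ?w"
  proof -
    have "supp (type_I2 N) \<Phi> i \<subseteq> {1..n}" unfolding S by auto
    then show ?thesis using artin_T_longest_elt[OF w] \<open>\<Phi> (artin_gen (type_I2 N) i) = _\<close> by simp
  qed
  moreover have "?w \<in> lists {1..n}" by (auto simp: in_lists_conv_set)
  ultimately show ?thesis
    using prod_in_gens[of ?w "{1..n}" "braid_rels (type_A n)"]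
    by (simp add: artin_monoid_type_A artin_gen_def[abs_def])
qed

theorem theorem5p4:
  fixes n :: nat
  assumes "n > 1"
  shows "(\<forall>K. K \<subset> {1..n} \<and> is_interval_nat K \<and> card K > 1 \<longrightarrow>
            (\<exists>!P. orth_partition n K (fst P) (snd P)) \<and>
            (\<forall>I' I''. orth_partition n K I' I'' \<longrightarrow>
              (\<exists>\<Phi> \<in> artin_homs (type_I2 (2 * m_of n K)) (type_A n).
                 \<Phi> (artin_gen (type_I2 (2 * m_of n K)) 1)
                   = artin_T (type_A n) (longest_elt (type_A n) (I' \<union> K)) \<and>
                 \<Phi> (artin_gen (type_I2 (2 * m_of n K)) 2)
                   = artin_T (type_A n) (longest_elt (type_A n) I'') \<and>
                 optimal (type_I2 (2 * m_of n K)) (type_A n) \<Phi> \<and>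
                 disjoint_hom (type_I2 (2 * m_of n K)) \<Phi> \<and>
                 standard (type_I2 (2 * m_of n K)) (type_A n) \<Phi>)))
       \<and>
         (\<forall>N \<ge> 2. \<forall>\<Phi> \<in> artin_homs (type_I2 N) (type_A n).
            optimal (type_I2 N) (type_A n) \<Phi> \<and>
            fully_supported (type_I2 N) (type_A n) \<Phi> \<and>
            disjoint_hom (type_I2 N) \<Phi> \<and>
            standard (type_I2 N) (type_A n) \<Phi> \<and>
            (\<forall>i\<in>{1, 2}. supp (type_I2 N) \<Phi> i \<noteq> {}) \<longrightarrow>
              ((\<forall>i\<in>{1, 2}. self_orthogonal (type_A n) (supp (type_I2 N) \<Phi> i)) \<or>
               (\<exists>i\<in>{1, 2}. \<exists>j\<in>{1, 2}. i \<noteq> j \<and>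
                  (\<exists>!K. K \<in> big_components (supp (type_I2 N) \<Phi> i)) \<and>
                  big_components (supp (type_I2 N) \<Phi> j) = {}))
            \<and> ((\<forall>i\<in>{1, 2}. self_orthogonal (type_A n) (supp (type_I2 N) \<Phi> i)) \<longrightarrow>
                 n = N - 1 \<and>
                 (\<exists>i\<in>{1, 2}. \<exists>j\<in>{1, 2}. i \<noteq> j \<and>
                    \<Phi> (artin_gen (type_I2 N) i)
                      = prod_in (artin_monoid (type_A n))
                          (map (artin_gen (type_A n)) (filter even [1..<n + 1])) \<and>
                    \<Phi> (artin_gen (type_I2 N) j)
                      = prod_in (artin_monoid (type_A n))
                          (map (artin_gen (type_A n)) (filter odd [1..<n + 1]))))
            \<and> (\<forall>i\<in>{1, 2}. \<forall>j\<in>{1, 2}. \<forall>K. i \<noteq> j \<and>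
                 big_components (supp (type_I2 N) \<Phi> i) = {K} \<and>
                 \<not> (\<exists>!L. L \<in> big_components (supp (type_I2 N) \<Phi> j)) \<longrightarrow>
                 N = 2 * m_of n K))"
proof (rule conjI, goal_cases)
  case 1
  have n: "2 \<le> n" using assms by simp
  show ?case
  proof (intro allI impI, goal_cases)
    case K: (1 K)
    then obtain a b where Kab: "K = {a..b}" by (auto simp: is_interval_nat_def)
    then have ab: "a < b" "a \<in> {1..n}" "b \<in> {1..n}" using K by auto
    then have orth: "orth_partition n K I' I'' \<longleftrightarrow> I' = even_side n a b - K \<and> I'' = odd_side n a b" for I' I''
      unfolding Kab by (intro orth_partition_iff) auto
    have "\<exists>!P. orth_partition n K (fst P) (snd P)"
      unfolding orth by (intro ex1I[of _ "(even_side n a b - K, odd_side n a b)"]) (auto simp: prod_eq_iff)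
    moreover have "even_side n a b - K \<union> K = even_side n a b" by (auto simp: Kab even_side_def)
    ultimately show ?case
      using ex_standard_hom[OF n _ ab(1) _ HOL.refl] ab(2,3) orth Kab by auto
  qed
next
  case 2
  have n: "2 \<le> n" using assms by simp
  show ?case
    (is "\<forall>N \<ge> 2. \<forall>\<Phi> \<in> artin_homs (type_I2 N) (type_A n). ?H N \<Phi> \<longrightarrow> ?A N \<Phi> \<and> ?B N \<Phi> \<and> ?C N \<Phi>")
  proof (intro allI ballI impI)
    fix N :: nat and \<Phi>
    assume N: "2 \<le> N" and \<Phi>: "\<Phi> \<in> artin_homs (type_I2 N) (type_A n)" and H: "?H N \<Phi>"
    let ?S = "supp (type_I2 N) \<Phi>"
    have std: "standard (type_I2 N) (type_A n) \<Phi>" using H by blast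
    obtain u v where uv: "braided_pair n (?S 1) (?S 2) u v N"
      using braided_pair_of_hom[OF n N \<Phi>] H by blast
    then interpret p: braided_pair n "?S 1" "?S 2" u v N .
    \<comment> \<open>The exchanged pair makes results about the first support available for the
      second.\<close>
    interpret q: braided_pair n "?S 2" "?S 1" v u N by (rule p.swap)
    have sub: "?S 1 \<subseteq> {1..n}" "?S 2 \<subseteq> {1..n}" using p.JL by auto
    have so: "self_orthogonal (type_A n) S" if "big_components S = {}" "S \<subseteq> {1..n}" for S
      using that ex_big_component[OF that(2)] by (auto simp: self_orthogonal_iff)
    have uniq: "K = K' \<and> ?S i = ?S j"
      if "K \<in> big_components (?S i)" "K' \<in> big_components (?S j)" "i \<in> {1, 2}" "j \<in> {1, 2}" for K K' i j
      using p.big_component_unique[OF that(1) _ that(2)] that(3,4) by auto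
    have ne: "?S 1 \<noteq> ?S 2"
    proof
      assume "?S 1 = ?S 2"
      then show False using p.JL n by auto
    qed
    have A: "?A N \<Phi>"
    proof (cases "big_components (?S 1) = {} \<and> big_components (?S 2) = {}")
      case True
      then show ?thesis using so sub by simp
    next
      case False
      then have "\<exists>i\<in>{1, 2}. big_components (?S i) \<noteq> {}" by simp
      then obtain i where i1: "i \<in> {1, 2}" and "big_components (?S i) \<noteq> {}" by (rule bexE)
      then have "\<exists>K. K \<in> big_components (?S i)" by (simp add: ex_in_conv)
      then obtain K where "K \<in> big_components (?S i)" by (rule exE)
      note i = i1 this
      obtain j where j: "j \<in> {1, 2}" "i \<noteq> j" "?S i \<noteq> ?S j"
      proof (cases "i = 1")
        case True
        then show ?thesis using that[of 2] ne by simp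
      next
        case False
        then have "i = 2" using i1 by simp
        then show ?thesis using that[of 1] ne[symmetric] by simp
      qed
      have "\<exists>!K. K \<in> big_components (?S i)"
      proof (rule ex1I)
        show "K \<in> big_components (?S i)" by (rule i(2))
        fix K' assume "K' \<in> big_components (?S i)"
        then show "K' = K" using uniq[OF i(2) _ i(1) i(1)] by simp
      qed
      moreover have "big_components (?S j) = {}"
      proof (rule equals0I)
        fix K' assume "K' \<in> big_components (?S j)"
        then show False using uniq[OF i(2) _ i(1) j(1)] j(3) by simp
      qed
      ultimately have "i \<noteq> j \<and> (\<exists>!K. K \<in> big_components (?S i)) \<and> big_components (?S j) = {}"
        using j(2) by simp
      then show ?thesis by (intro disjI2 bexI[OF _ i(1)] bexI[OF _ j(1)])
    qed
    moreover have "?B N \<Phi>"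
    proof (rule impI, goal_cases)
      case 1
      then have adj: "\<And>i. i \<in> ?S 1 \<Longrightarrow> Suc i \<notin> ?S 1" "\<And>i. i \<in> ?S 2 \<Longrightarrow> Suc i \<notin> ?S 2"
        by (auto simp: self_orthogonal_iff)
      have far: "\<And>i j. even i \<Longrightarrow> even j \<Longrightarrow> i \<noteq> j \<Longrightarrow> far i j" "\<And>i j. odd i \<Longrightarrow> odd j \<Longrightarrow> i \<noteq> j \<Longrightarrow> far i j"
        by (auto intro: far_of_parity)
      \<comment> \<open>The support containing \<open>1\<close> is the one with the odd
        letters.\<close>
      have "1 \<in> ?S 1 \<union> ?S 2" using p.JL(1) n by auto
      then have "N = n + 1 \<and> (\<exists>i\<in>{1, 2}. \<exists>j\<in>{1, 2}. i \<noteq> j \<and>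
        ?S i = {i. 1 \<le> i \<and> i < n + 1 \<and> even i} \<and> ?S j = {i. 1 \<le> i \<and> i < n + 1 \<and> odd i})"
      proof
        assume "1 \<in> ?S 1"
        then show ?thesis using p.self_orthogonal_sides[OF adj] by auto
      next
        assume "1 \<in> ?S 2"
        then show ?thesis using q.self_orthogonal_sides[OF adj(2,1)] by auto
      qed
      then obtain i j where ij: "N = n + 1" "i \<in> {1, 2}" "j \<in> {1, 2}" "i \<noteq> j"
        "?S i = {i. 1 \<le> i \<and> i < n + 1 \<and> even i}" "?S j = {i. 1 \<le> i \<and> i < n + 1 \<and> odd i}"
        by blast
      have "n = N - 1" using ij(1) by simp
      then show ?case
        using standard_hom_filter[OF std ij(2,5) far(1)] standard_hom_filter[OF std ij(3,6) far(2)] ij(2-4)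
        by blast
    qed
    moreover have "?C N \<Phi>"
    proof (intro ballI allI impI)
      fix i j :: nat and K
      assume i: "i \<in> {1, 2}" and K: "i \<noteq> j \<and> big_components (?S i) = {K} \<and> \<not> (\<exists>!L. L \<in> big_components (?S j))"
      then have K': "K \<in> big_components (?S i)" by blast
      then obtain a b where ab: "K = {a..b}" by (auto simp: big_components_def conn_components_def is_interval_nat_def)
      from i consider "i = 1" | "i = 2" by blast
      then show "N = 2 * m_of n K"
        using K' p.N_of_big_component q.N_of_big_component unfolding ab by cases auto
    qed
    ultimately show "?A N \<Phi> \<and> ?B N \<Phi> \<and> ?C N \<Phi>" by blast
  qed
qed

end
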